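(* Let $\mathcal M$ be a local Moufang set with basis $(0,\infty)$ satisfying (J1)–(J4), and let $V=(V^+,V^-)$ be the pair of abelian groups constructed below. Then $V$ is a Jordan pair over $\mathbb Z$ with quadratic maps $Q^+_x=\mu_{x,x}\cdot\frac12$ ($x\in V^+$) and $Q^-_y=\tilde\mu_{y,y}\tilde\cdot\frac12$ ($y\in V^-$). Moreover $V$ is local: its set of non-invertible elements is the proper ideal $(\overline 0,\overline\infty)$, which equals the Jacobson radical $\mathrm{Rad}\,V$; and $V^+$ is uniquely $2$- and $3$-divisible.
   Context: Local Moufang set: $(X,\sim)$, $|\overline X|>2$, subgroups $U_x$ of equivalence-preserving bijections (right actions, $g^h=h^{-1}gh$) with (LM0) $x\sim y\Rightarrow$ same induced group on $\overline X$; (LM1) $U_x$ fixes $x$, sharply transitive on $X\setminus\overline x$; (LM1') induced group fixes $\overline x$, sharply transitive on other classes; (LM2) $U_x^g=U_{xg}$ for $g\in\langle U_y\rangle$. Basis $(0,\infty)$; $\alpha_x\in U_\infty$ with $0\alpha_x=x$; $-x=0\alpha_x^{-1}$; $x\cdot k=0\alpha_x^k$; units $x\not\sim0,\infty$; $\mu_x\in U_0\alpha_xU_0$ the unique element swapping $0,\infty$; special: $(-(x\tau^{-1}))\tau=-x$ for units $x$. Hypotheses: (J1) special; (J2) $U_\infty$ abelian; (J3) $x$ unit $\Rightarrow x\cdot2,x\cdot3$ units. Fix a $\mu$-map $\tau$ (an involution here), $\gamma_x=\alpha_x^\tau$. $V^+=X\setminus\overline\infty$ with $x+z=0\alpha_x\alpha_z$;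 $V^-=X\setminus\overline0$ with $y\tilde+w=\infty\gamma_{y\tau}\gamma_{w\tau}$. Each $\mu_t$ ($t$ unit) restricts to group isomorphisms $V^\pm\to V^\mp$. For units $x,z\in V^+$ with $x+z$ a unit, $\mu_{x,z}:=\mu_{x+z}-\mu_x-\mu_z:V^-\to V^+$ (pointwise); for units $y,w\in V^-$ with $y\tilde+w$ a unit, $\tilde\mu_{y,w}:=\mu_{y\tilde+w}\tilde-\mu_y\tilde-\mu_w:V^+\to V^-$. (J4) there are biadditive maps $V^+\times V^+\to\mathrm{Hom}(V^-,V^+)$ and $V^-\times V^-\to\mathrm{Hom}(V^+,V^-)$ extending these. $\frac12$ denotes unique halving in these groups. Jordan pair over $\mathbb Z$: abelian groups $V^\pm$ with quadratic maps $Q:V^\sigma\to\mathrm{Hom}(V^{-\sigma},V^\sigma)$ (written $y\mapsto yQ_x$), $Q_{x,z}=Q_{x+z}-Q_x-Q_z$, $\{xyz\}=yQ_{x,z}$, satisfying in all scalar extensions $\{x\,y\,zQ_x\}=\{yxz\}Q_x$, $\{yQ_x\,y\,z\}=\{x\,xQ_y\,z\}$, $Q_{yQ_x}=Q_xQ_yQ_x$. $x$ invertible iff $Q_x$ bijective; ideal: pair of subgroups closed under $xQ_y,yQ_x,\{xyz\}$ with $x$ in it; local: non-invertible elements form a proper ideal. $(x,y)$ quasi-invertible iff $B_{x,y}=\mathrm{id}-D_{x,y}+Q_yQ_x$ is invertible ($zD_{x,y}=\{xyz\}$); $\mathrm{Rad}\,V$ consists of elements quasi-invertible with every element of the opposite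 space. *)

theory Defs
  imports "HOL-Algebra.Group"
begin

text \<open>The set X is the whole type 'a; the equivalence is sim. Permutations act on
the right in the paper; a product gh (first g, then h) is the function h o g, and
the point xg is g x.\<close>

definition cls :: "('a \<Rightarrow> 'a \<Rightarrow> bool) \<Rightarrow> 'a \<Rightarrow> 'a set" where
  "cls sim x = {y. sim x y}"

definition eqclasses :: "('a \<Rightarrow> 'a \<Rightarrow> bool) \<Rightarrow> 'a set set" where
  "eqclasses sim = range (cls sim)"

definition equiv_pres :: "('a \<Rightarrow> 'a \<Rightarrow> bool) \<Rightarrow> ('a \<Rightarrow> 'a) \<Rightarrow> bool" where
  "equiv_pres sim g \<longleftrightarrow> bij g \<and> (\<forall>x y. sim (g x) (g y) \<longleftrightarrow> sim x y)"

definition perm_subgroup :: "('a \<Rightarrow> 'a \<Rightarrow> bool) \<Rightarrow> ('a \<Rightarrow> 'a) set \<Rightarrow> bool" where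
  "perm_subgroup sim H \<longleftrightarrow> (\<forall>g\<in>H. equiv_pres sim g) \<and> id \<in> H
     \<and> (\<forall>g\<in>H. \<forall>h\<in>H. h \<circ> g \<in> H) \<and> (\<forall>g\<in>H. inv_into UNIV g \<in> H)"

definition induced :: "('a \<Rightarrow> 'a \<Rightarrow> bool) \<Rightarrow> ('a \<Rightarrow> 'a) set \<Rightarrow> ('a set \<Rightarrow> 'a set) set" where
  "induced sim H = (\<lambda>g. restrict (image g) (eqclasses sim)) ` H"

inductive_set little_group :: "('a \<Rightarrow> ('a \<Rightarrow> 'a) set) \<Rightarrow> ('a \<Rightarrow> 'a) set" for U where
  lg_id: "id \<in> little_group U"
| lg_gen: "g \<in> U y \<Longrightarrow> g \<in> little_group U"
| lg_comp: "g \<in> little_group U \<Longrightarrow> h \<in> little_group U \<Longrightarrow> h \<circ> g \<in> little_group U"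
| lg_inv: "g \<in> little_group U \<Longrightarrow> inv_into UNIV g \<in> little_group U"

definition local_moufang_set :: "('a \<Rightarrow> 'a \<Rightarrow> bool) \<Rightarrow> ('a \<Rightarrow> ('a \<Rightarrow> 'a) set) \<Rightarrow> bool" where
  "local_moufang_set sim U \<longleftrightarrow>
     equivp sim
   \<and> (\<exists>a b c. \<not> sim a b \<and> \<not> sim b c \<and> \<not> sim a c)
   \<and> (\<forall>x. perm_subgroup sim (U x))
   \<comment> \<open>(LM0)\<close>
   \<and> (\<forall>x y. sim x y \<longrightarrow> induced sim (U x) = induced sim (U y))
   \<comment> \<open>(LM1)\<close>
   \<and> (\<forall>x. (\<forall>g\<in>U x. g x = x)
        \<and> (\<forall>z w. \<not> sim x z \<longrightarrow> \<not> sim x w \<longrightarrow> (\<exists>!g. g \<in> U x \<and> g z = w)))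
   \<comment> \<open>(LM1')\<close>
   \<and> (\<forall>x. (\<forall>h\<in>induced sim (U x). h (cls sim x) = cls sim x)
        \<and> (\<forall>C\<in>eqclasses sim. \<forall>D\<in>eqclasses sim. C \<noteq> cls sim x \<longrightarrow> D \<noteq> cls sim x \<longrightarrow>
              (\<exists>!h. h \<in> induced sim (U x) \<and> h C = D)))
   \<comment> \<open>(LM2): U x conjugated by g equals U (x g)\<close>
   \<and> (\<forall>g\<in>little_group U. \<forall>x. (\<lambda>u. g \<circ> u \<circ> inv_into UNIV g) ` U x = U (g x))"

definition unit_el :: "('a \<Rightarrow> 'a \<Rightarrow> bool) \<Rightarrow> 'a \<Rightarrow> 'a \<Rightarrow> 'a \<Rightarrow> bool" where
  "unit_el sim p0 pinf x \<longleftrightarrow> \<not> sim x p0 \<and> \<not> sim x pinf"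

definition alpha :: "('a \<Rightarrow> ('a \<Rightarrow> 'a) set) \<Rightarrow> 'a \<Rightarrow> 'a \<Rightarrow> 'a \<Rightarrow> ('a \<Rightarrow> 'a)" where
  "alpha U p0 pinf x = (THE g. g \<in> U pinf \<and> g p0 = x)"

definition negp :: "('a \<Rightarrow> ('a \<Rightarrow> 'a) set) \<Rightarrow> 'a \<Rightarrow> 'a \<Rightarrow> 'a \<Rightarrow> 'a" where
  "negp U p0 pinf x = inv_into UNIV (alpha U p0 pinf x) p0"

definition smul :: "('a \<Rightarrow> ('a \<Rightarrow> 'a) set) \<Rightarrow> 'a \<Rightarrow> 'a \<Rightarrow> 'a \<Rightarrow> nat \<Rightarrow> 'a" where
  "smul U p0 pinf x k = (alpha U p0 pinf x ^^ k) p0"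

definition mu :: "('a \<Rightarrow> ('a \<Rightarrow> 'a) set) \<Rightarrow> 'a \<Rightarrow> 'a \<Rightarrow> 'a \<Rightarrow> ('a \<Rightarrow> 'a)" where
  "mu U p0 pinf x = (THE m. (\<exists>a\<in>U p0. \<exists>b\<in>U p0. m = b \<circ> alpha U p0 pinf x \<circ> a)
                        \<and> m p0 = pinf \<and> m pinf = p0)"

definition is_mu_map :: "('a \<Rightarrow> 'a \<Rightarrow> bool) \<Rightarrow> ('a \<Rightarrow> ('a \<Rightarrow> 'a) set) \<Rightarrow> 'a \<Rightarrow> 'a \<Rightarrow> ('a \<Rightarrow> 'a) \<Rightarrow> bool" where
  "is_mu_map sim U p0 pinf \<tau> \<longleftrightarrow> (\<exists>e. unit_el sim p0 pinf e \<and> \<tau> = mu U p0 pinf e)"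

definition special :: "('a \<Rightarrow> 'a \<Rightarrow> bool) \<Rightarrow> ('a \<Rightarrow> ('a \<Rightarrow> 'a) set) \<Rightarrow> 'a \<Rightarrow> 'a \<Rightarrow> ('a \<Rightarrow> 'a) \<Rightarrow> bool" where
  "special sim U p0 pinf \<tau> \<longleftrightarrow>
     (\<forall>x. unit_el sim p0 pinf x \<longrightarrow> \<tau> (negp U p0 pinf (inv_into UNIV \<tau> x)) = negp U p0 pinf x)"

definition gamma :: "('a \<Rightarrow> ('a \<Rightarrow> 'a) set) \<Rightarrow> 'a \<Rightarrow> 'a \<Rightarrow> ('a \<Rightarrow> 'a) \<Rightarrow> 'a \<Rightarrow> ('a \<Rightarrow> 'a)" where
  "gamma U p0 pinf \<tau> x = \<tau> \<circ> alpha U p0 pinf x \<circ> inv_into UNIV \<tau>"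

definition Vplus :: "('a \<Rightarrow> 'a \<Rightarrow> bool) \<Rightarrow> ('a \<Rightarrow> ('a \<Rightarrow> 'a) set) \<Rightarrow> 'a \<Rightarrow> 'a \<Rightarrow> 'a monoid" where
  "Vplus sim U p0 pinf = \<lparr> carrier = {x. \<not> sim x pinf},
      mult = (\<lambda>x z. alpha U p0 pinf z (alpha U p0 pinf x p0)), one = p0 \<rparr>"

definition Vminus :: "('a \<Rightarrow> 'a \<Rightarrow> bool) \<Rightarrow> ('a \<Rightarrow> ('a \<Rightarrow> 'a) set) \<Rightarrow> 'a \<Rightarrow> 'a \<Rightarrow> ('a \<Rightarrow> 'a) \<Rightarrow> 'a monoid" where
  "Vminus sim U p0 pinf \<tau> = \<lparr> carrier = {y. \<not> sim y p0},
      mult = (\<lambda>y w. gamma U p0 pinf \<tau> (\<tau> w) (gamma U p0 pinf \<tau> (\<tau> y) pinf)), one = pinf \<rparr>"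

text \<open>Pointwise m_{x+z} - m_x - m_z, where the sum x+z and the differences of values are
computed in the same group G (V+ for mu_{x,z}, V- for mu~_{y,w}).\<close>
definition mu_pair :: "('a, 'm) monoid_scheme \<Rightarrow> ('a \<Rightarrow> ('a \<Rightarrow> 'a)) \<Rightarrow> 'a \<Rightarrow> 'a \<Rightarrow> 'a \<Rightarrow> 'a" where
  "mu_pair G m x z y = m (x \<otimes>\<^bsub>G\<^esub> z) y \<otimes>\<^bsub>G\<^esub> inv\<^bsub>G\<^esub> (m x y) \<otimes>\<^bsub>G\<^esub> inv\<^bsub>G\<^esub> (m z y)"

definition biadd_extension :: "('a, 'm) monoid_scheme \<Rightarrow> ('a, 'n) monoid_scheme \<Rightarrow> ('a \<Rightarrow> bool)
    \<Rightarrow> ('a \<Rightarrow> ('a \<Rightarrow> 'a)) \<Rightarrow> ('a \<Rightarrow> 'a \<Rightarrow> 'a \<Rightarrow> 'a) \<Rightarrow> bool" where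
  "biadd_extension V W isunit m P \<longleftrightarrow>
     (\<forall>x\<in>carrier V. \<forall>z\<in>carrier V. P x z \<in> hom W V)
   \<and> (\<forall>x1\<in>carrier V. \<forall>x2\<in>carrier V. \<forall>z\<in>carrier V. \<forall>y\<in>carrier W.
        P (x1 \<otimes>\<^bsub>V\<^esub> x2) z y = P x1 z y \<otimes>\<^bsub>V\<^esub> P x2 z y
      \<and> P z (x1 \<otimes>\<^bsub>V\<^esub> x2) y = P z x1 y \<otimes>\<^bsub>V\<^esub> P z x2 y)
   \<and> (\<forall>x\<in>carrier V. \<forall>z\<in>carrier V. isunit x \<longrightarrow> isunit z \<longrightarrow> isunit (x \<otimes>\<^bsub>V\<^esub> z) \<longrightarrow>
        (\<forall>y\<in>carrier W. P x z y = mu_pair V m x z y))"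

definition half :: "('a, 'm) monoid_scheme \<Rightarrow> 'a \<Rightarrow> 'a" where
  "half G a = (THE h. h \<in> carrier G \<and> h \<otimes>\<^bsub>G\<^esub> h = a)"

definition uniquely_divisible :: "('a, 'm) monoid_scheme \<Rightarrow> nat \<Rightarrow> bool" where
  "uniquely_divisible G n \<longleftrightarrow> (\<forall>a\<in>carrier G. \<exists>!h. h \<in> carrier G \<and> h [^]\<^bsub>G\<^esub> n = a)"

text \<open>Q x z y = y Q_{x,z} = y Q_{x+z} - y Q_x - y Q_z; here Q x y stands for y Q_x.\<close>
definition qq :: "('a, 'm) monoid_scheme \<Rightarrow> ('a \<Rightarrow> 'b \<Rightarrow> 'a) \<Rightarrow> 'a \<Rightarrow> 'a \<Rightarrow> 'b \<Rightarrow> 'a" where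
  "qq V Q x z y = Q (x \<otimes>\<^bsub>V\<^esub> z) y \<otimes>\<^bsub>V\<^esub> inv\<^bsub>V\<^esub> (Q x y) \<otimes>\<^bsub>V\<^esub> inv\<^bsub>V\<^esub> (Q z y)"

definition trip :: "('a, 'm) monoid_scheme \<Rightarrow> ('a \<Rightarrow> 'b \<Rightarrow> 'a) \<Rightarrow> 'a \<Rightarrow> 'b \<Rightarrow> 'a \<Rightarrow> 'a" where
  "trip V Q x y z = qq V Q x z y"

definition quadratic_map :: "('a, 'm) monoid_scheme \<Rightarrow> ('b, 'n) monoid_scheme \<Rightarrow> ('a \<Rightarrow> 'b \<Rightarrow> 'a) \<Rightarrow> bool" where
  "quadratic_map V W Q \<longleftrightarrow>
     (\<forall>x\<in>carrier V. Q x \<in> hom W V)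
   \<and> (\<forall>x\<in>carrier V. \<forall>n::int. \<forall>y\<in>carrier W. Q (x [^]\<^bsub>V\<^esub> n) y = Q x y [^]\<^bsub>V\<^esub> (n * n))
   \<and> (\<forall>x1\<in>carrier V. \<forall>x2\<in>carrier V. \<forall>z\<in>carrier V. \<forall>y\<in>carrier W.
        qq V Q (x1 \<otimes>\<^bsub>V\<^esub> x2) z y = qq V Q x1 z y \<otimes>\<^bsub>V\<^esub> qq V Q x2 z y)"

text \<open>Scalar extension V (tensor over Z) R for a commutative ring R: elements are
represented by finite formal sums (lists) of pure tensors v (x) r, and equality in the
tensor product is the congruence generated by the defining relations.\<close>
inductive tensor_eq :: "('a, 'm) monoid_scheme \<Rightarrow> ('a \<times> 'r::comm_ring_1) list \<Rightarrow> ('a \<times> 'r) list \<Rightarrow> bool"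
  for G where
  te_refl: "tensor_eq G xs xs"
| te_sym: "tensor_eq G xs ys \<Longrightarrow> tensor_eq G ys xs"
| te_trans: "tensor_eq G xs ys \<Longrightarrow> tensor_eq G ys zs \<Longrightarrow> tensor_eq G xs zs"
| te_app: "tensor_eq G xs ys \<Longrightarrow> tensor_eq G us vs \<Longrightarrow> tensor_eq G (xs @ us) (ys @ vs)"
| te_swap: "tensor_eq G (xs @ ys) (ys @ xs)"
| te_addl: "v \<in> carrier G \<Longrightarrow> w \<in> carrier G \<Longrightarrow> tensor_eq G [(v \<otimes>\<^bsub>G\<^esub> w, r)] [(v, r), (w, r)]"
| te_addr: "v \<in> carrier G \<Longrightarrow> tensor_eq G [(v, r + s)] [(v, r), (v, s)]"
| te_zero: "tensor_eq G [(\<one>\<^bsub>G\<^esub>, r)] []"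

definition ext_elems :: "('a, 'm) monoid_scheme \<Rightarrow> 'r itself \<Rightarrow> ('a \<times> 'r) list set" where
  "ext_elems G R = {xs. set (map fst xs) \<subseteq> carrier G}"

text \<open>Extension of Q to scalar extensions:
Q_{sum x_i r_i} = sum Q_{x_i} r_i^2 + sum_{i<k} Q_{x_i,x_k} r_i r_k.\<close>
definition qext :: "('a, 'm) monoid_scheme \<Rightarrow> ('a \<Rightarrow> 'b \<Rightarrow> 'a) \<Rightarrow> ('a \<times> 'r::comm_ring_1) list
    \<Rightarrow> ('b \<times> 'r) list \<Rightarrow> ('a \<times> 'r) list" where
  "qext V Q xs ys =
     [(Q (fst (xs ! i)) w, snd (xs ! i) * snd (xs ! i) * s). i \<leftarrow> [0..<length xs], (w, s) \<leftarrow> ys]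
   @ [(qq V Q (fst (xs ! i)) (fst (xs ! k)) w, snd (xs ! i) * snd (xs ! k) * s).
        i \<leftarrow> [0..<length xs], k \<leftarrow> [Suc i..<length xs], (w, s) \<leftarrow> ys]"

definition text_ext :: "('a, 'm) monoid_scheme \<Rightarrow> ('a \<Rightarrow> 'b \<Rightarrow> 'a) \<Rightarrow> ('a \<times> 'r::comm_ring_1) list
    \<Rightarrow> ('b \<times> 'r) list \<Rightarrow> ('a \<times> 'r) list \<Rightarrow> ('a \<times> 'r) list" where
  "text_ext V Q xs ys zs = [(trip V Q x y z, r * s * t). (x, r) \<leftarrow> xs, (y, s) \<leftarrow> ys, (z, t) \<leftarrow> zs]"

definition jp_identities :: "'r::comm_ring_1 itself \<Rightarrow> ('a, 'm) monoid_scheme \<Rightarrow> ('b, 'n) monoid_scheme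
    \<Rightarrow> ('a \<Rightarrow> 'b \<Rightarrow> 'a) \<Rightarrow> ('b \<Rightarrow> 'a \<Rightarrow> 'b) \<Rightarrow> bool" where
  "jp_identities R V W Q Q' \<longleftrightarrow>
     (\<forall>xs\<in>ext_elems V R. \<forall>ys\<in>ext_elems W R.
        (\<forall>zs\<in>ext_elems W R.
            tensor_eq V (text_ext V Q xs ys (qext V Q xs zs)) (qext V Q xs (text_ext W Q' ys xs zs))
          \<and> tensor_eq V (qext V Q (qext V Q xs ys) zs) (qext V Q xs (qext W Q' ys (qext V Q xs zs))))
      \<and> (\<forall>zs\<in>ext_elems V R.
            tensor_eq V (text_ext V Q (qext V Q xs ys) ys zs) (text_ext V Q xs (qext W Q' ys xs) zs)))"

text \<open>Jordan pair over Z; the identities are required in the scalar extension by R.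
A theorem with R a free type variable asserts them for all commutative rings R.\<close>
definition jordan_pair :: "'r::comm_ring_1 itself \<Rightarrow> ('a, 'm) monoid_scheme \<Rightarrow> ('b, 'n) monoid_scheme
    \<Rightarrow> ('a \<Rightarrow> 'b \<Rightarrow> 'a) \<Rightarrow> ('b \<Rightarrow> 'a \<Rightarrow> 'b) \<Rightarrow> bool" where
  "jordan_pair R Vp Vm Qp Qm \<longleftrightarrow>
     comm_group Vp \<and> comm_group Vm
   \<and> quadratic_map Vp Vm Qp \<and> quadratic_map Vm Vp Qm
   \<and> jp_identities R Vp Vm Qp Qm \<and> jp_identities R Vm Vp Qm Qp"

definition jp_invertible :: "('a, 'm) monoid_scheme \<Rightarrow> ('b, 'n) monoid_scheme \<Rightarrow> ('a \<Rightarrow> 'b \<Rightarrow> 'a) \<Rightarrow> 'a \<Rightarrow> bool" where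
  "jp_invertible V W Q x \<longleftrightarrow> x \<in> carrier V \<and> bij_betw (Q x) (carrier W) (carrier V)"

definition non_invertibles :: "('a, 'm) monoid_scheme \<Rightarrow> ('b, 'n) monoid_scheme \<Rightarrow> ('a \<Rightarrow> 'b \<Rightarrow> 'a) \<Rightarrow> 'a set" where
  "non_invertibles V W Q = {x \<in> carrier V. \<not> jp_invertible V W Q x}"

definition ideal_cond :: "('a, 'm) monoid_scheme \<Rightarrow> ('b, 'n) monoid_scheme \<Rightarrow> ('a \<Rightarrow> 'b \<Rightarrow> 'a)
    \<Rightarrow> ('b \<Rightarrow> 'a \<Rightarrow> 'b) \<Rightarrow> 'a set \<Rightarrow> 'b set \<Rightarrow> bool" where
  "ideal_cond V W Q Q' I I' \<longleftrightarrow>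
     (\<forall>x\<in>I. \<forall>y\<in>carrier W. Q x y \<in> I \<and> Q' y x \<in> I' \<and> (\<forall>z\<in>carrier V. trip V Q x y z \<in> I))"

definition jp_ideal :: "('a, 'm) monoid_scheme \<Rightarrow> ('b, 'n) monoid_scheme \<Rightarrow> ('a \<Rightarrow> 'b \<Rightarrow> 'a)
    \<Rightarrow> ('b \<Rightarrow> 'a \<Rightarrow> 'b) \<Rightarrow> 'a set \<Rightarrow> 'b set \<Rightarrow> bool" where
  "jp_ideal Vp Vm Qp Qm Ip Im \<longleftrightarrow> subgroup Ip Vp \<and> subgroup Im Vm
     \<and> ideal_cond Vp Vm Qp Qm Ip Im \<and> ideal_cond Vm Vp Qm Qp Im Ip"

definition jp_proper_ideal :: "('a, 'm) monoid_scheme \<Rightarrow> ('b, 'n) monoid_scheme \<Rightarrow> ('a \<Rightarrow> 'b \<Rightarrow> 'a)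
    \<Rightarrow> ('b \<Rightarrow> 'a \<Rightarrow> 'b) \<Rightarrow> 'a set \<Rightarrow> 'b set \<Rightarrow> bool" where
  "jp_proper_ideal Vp Vm Qp Qm Ip Im \<longleftrightarrow> jp_ideal Vp Vm Qp Qm Ip Im
     \<and> (Ip, Im) \<noteq> (carrier Vp, carrier Vm)"

definition jp_local :: "('a, 'm) monoid_scheme \<Rightarrow> ('b, 'n) monoid_scheme \<Rightarrow> ('a \<Rightarrow> 'b \<Rightarrow> 'a)
    \<Rightarrow> ('b \<Rightarrow> 'a \<Rightarrow> 'b) \<Rightarrow> bool" where
  "jp_local Vp Vm Qp Qm \<longleftrightarrow>
     jp_proper_ideal Vp Vm Qp Qm (non_invertibles Vp Vm Qp) (non_invertibles Vm Vp Qm)"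

definition bergman :: "('a, 'm) monoid_scheme \<Rightarrow> ('a \<Rightarrow> 'b \<Rightarrow> 'a) \<Rightarrow> ('b \<Rightarrow> 'a \<Rightarrow> 'b)
    \<Rightarrow> 'a \<Rightarrow> 'b \<Rightarrow> 'a \<Rightarrow> 'a" where
  "bergman V Q Q' x y z = z \<otimes>\<^bsub>V\<^esub> inv\<^bsub>V\<^esub> (trip V Q x y z) \<otimes>\<^bsub>V\<^esub> Q x (Q' y z)"

definition quasi_invertible :: "('a, 'm) monoid_scheme \<Rightarrow> ('a \<Rightarrow> 'b \<Rightarrow> 'a) \<Rightarrow> ('b \<Rightarrow> 'a \<Rightarrow> 'b)
    \<Rightarrow> 'a \<Rightarrow> 'b \<Rightarrow> bool" where
  "quasi_invertible V Q Q' x y \<longleftrightarrow> bij_betw (bergman V Q Q' x y) (carrier V) (carrier V)"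

definition jp_rad :: "('a, 'm) monoid_scheme \<Rightarrow> ('b, 'n) monoid_scheme \<Rightarrow> ('a \<Rightarrow> 'b \<Rightarrow> 'a)
    \<Rightarrow> ('b \<Rightarrow> 'a \<Rightarrow> 'b) \<Rightarrow> 'a set" where
  "jp_rad V W Q Q' = {x \<in> carrier V. \<forall>y\<in>carrier W. quasi_invertible V Q Q' x y}"

end

theory Submission
  imports Defs
begin

text \<open>Write \<open>\<mu>\<^sub>x = \<alpha>\<^sub>x \<beta>\<^bsub>-x\<^esub> \<alpha>\<^sub>x = \<beta>\<^bsub>-x\<^esub> \<alpha>\<^sub>x \<beta>\<^bsub>-x\<^esub>\<close> with \<open>\<beta>\<^sub>y\<close> the element of
  \<open>U\<^sub>0\<close> mapping \<open>\<infinity>\<close> to \<open>y\<close>. Two facts about units drive everything: the conjugation rule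
  \<open>\<mu>\<^bsub>\<mu>a(b)\<^esub> = \<mu>\<^sub>a \<mu>\<^bsub>-b\<^esub> \<mu>\<^bsub>-a\<^esub>\<close>, and the Hua-type relation: if \<open>c\<close> is the difference of \<open>a\<close> and \<open>b\<close>
  in \<open>V\<^sup>-\<close> and \<open>d\<close> their difference in \<open>V\<^sup>+\<close>, then \<open>c = \<mu>\<^sub>b(d) - b\<close> and \<open>\<mu>\<^sub>c = \<mu>\<^sub>a \<mu>\<^bsub>-d\<^esub> \<mu>\<^bsub>-b\<^esub>\<close>.
  Write \<open>{x y z}\<close> for the biadditive extension of \<open>\<mu>\<^bsub>x,z\<^esub>(y)\<close>. The Hua relation gives \<open>{x c c} = -2x\<close>
  for every unit \<open>c\<close> and, by the symmetry of \<open>\<mu>\<^sub>c\<close> in \<open>a\<close> and \<open>-b\<close>, that \<open>\<mu>\<^sub>a - \<mu>\<^bsub>-a\<^esub>\<close>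
  kills all \<open>{x y a}\<close>; hence \<open>\<mu>\<close>-maps are involutions.
  The conjugation rule then becomes the fundamental formula \<open>Q\<^bsub>Q(x)y\<^esub> = Q\<^sub>x Q\<^sub>y Q\<^sub>x\<close> for units
  \<open>x\<close>. Its linearization in \<open>x\<close> at a unit \<open>b\<close>, evaluated at the point \<open>b\<close> itself, first shows
  \<open>{\<mu>\<^sub>b(y) b z} = \<mu>\<^sub>b{y z b}\<close>, and then turns into the five-linear identity
  \<open>{x y {u v z}} - {u v {x y z}} = {{x y u} v z} - {u {y x v} z}\<close> for all units \<open>y\<close>, so for
  all \<open>y\<close>. The five-linear identity extends to every scalar extension and, 6 being
  invertible, implies the Jordan pair identities there. For the radical, the
  Bergman operator at \<open>(x, w)\<close> with \<open>x \<sim> 0\<close> and \<open>w\<close> a unit is \<open>\<mu>\<^bsub>w+x\<^esub> \<mu>\<^sub>w\<close>, and at a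
  non-unit \<open>y\<close> it is the composition of two such operators.\<close>

section \<open>A universal additive host for abelian groups\<close>

text \<open>Three obstacles shape the argument. First, (J3) speaks of units only, while every
  linearization has to cancel 2 and 3 in the whole groups. The Hua relation supplies this: passing
  to the opposite group behaves like inversion, so that twice a unit in one group is half of it in
  the other; torsion and divisibility then follow on both sides. Second, no scalars are at hand for
  splitting an expression into homogeneous components. The term linear in \<open>z\<close> is
  recovered from the values at \<open>z\<close>, \<open>-z\<close>, \<open>2z\<close>,
  \<open>-2z\<close>: differences remove the even terms, and cancelling 3 removes the cubic one.
  Such values need units, so additive claims are first proved at units in general position and then
  spread by the fact that a unit plus a non-unit is a unit. Third, the two groups are not symmetric
  at the start: seen from the other basis point a \<open>\<mu>\<close>-map becomes its inverse, and
  the addition of \<open>Vminus\<close> depends on \<open>\<tau>\<close>. The proof that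
  \<open>\<mu>\<close>-maps are involutions therefore works with the triple product of one side
  alone.\<close>

lemma
  assumes "comm_group G"
  shows comm_group_one_closed: "\<one>\<^bsub>G\<^esub> \<in> carrier G"
    and comm_group_m_closed: "x \<in> carrier G \<Longrightarrow> y \<in> carrier G \<Longrightarrow> x \<otimes>\<^bsub>G\<^esub> y \<in> carrier G"
    and comm_group_inv_closed: "x \<in> carrier G \<Longrightarrow> inv\<^bsub>G\<^esub> x \<in> carrier G"
proof -
  interpret comm_group G by fact
  show "\<one>\<^bsub>G\<^esub> \<in> carrier G"
    and "x \<in> carrier G \<Longrightarrow> y \<in> carrier G \<Longrightarrow> x \<otimes>\<^bsub>G\<^esub> y \<in> carrier G"
    and "x \<in> carrier G \<Longrightarrow> inv\<^bsub>G\<^esub> x \<in> carrier G"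
    by simp_all
qed

text \<open>The product of all abelian groups whose carrier lies in the type \<open>'a\<close>. Each such group is a direct
  summand (\<open>embed\<close>, \<open>proj\<close>), so multiadditive maps between carriers become total multiadditive
  maps on a single type of class \<open>ab_group_add\<close>.\<close>
typedef 'a group_product = "{f :: 'a monoid \<Rightarrow> 'a.
    \<forall>G. (comm_group G \<longrightarrow> f G \<in> carrier G) \<and> (\<not> comm_group G \<longrightarrow> f G = undefined)}"
  by (rule exI[where x = "\<lambda>G. if comm_group G then \<one>\<^bsub>G\<^esub> else undefined"])
    (simp add: comm_group_one_closed)

setup_lifting type_definition_group_product

lift_definition proj :: "'a monoid \<Rightarrow> 'a group_product \<Rightarrow> 'a" is "\<lambda>G f. f G" .

lemma proj_closed: "comm_group G \<Longrightarrow> proj G u \<in> carrier G"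
  by transfer auto

lemma group_product_eqI: "(\<And>G. comm_group G \<Longrightarrow> proj G u = proj G v) \<Longrightarrow> u = v"
  by transfer (metis ext)

instantiation group_product :: (type) ab_group_add
begin

lift_definition zero_group_product :: "'a group_product" is "\<lambda>G. if comm_group G then \<one>\<^bsub>G\<^esub> else undefined"
  by (simp add: comm_group_one_closed)

lift_definition plus_group_product :: "'a group_product \<Rightarrow> 'a group_product \<Rightarrow> 'a group_product"
  is "\<lambda>f g G. if comm_group G then f G \<otimes>\<^bsub>G\<^esub> g G else undefined"
  by (simp add: comm_group_m_closed)

lift_definition uminus_group_product :: "'a group_product \<Rightarrow> 'a group_product"
  is "\<lambda>f G. if comm_group G then inv\<^bsub>G\<^esub> (f G) else undefined"
  by (simp add: comm_group_inv_closed)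

definition minus_group_product :: "'a group_product \<Rightarrow> 'a group_product \<Rightarrow> 'a group_product" where
  "minus_group_product u v = u + - v"

lemma proj_zero: "comm_group G \<Longrightarrow> proj G 0 = \<one>\<^bsub>G\<^esub>"
  by transfer simp

lemma proj_add: "comm_group G \<Longrightarrow> proj G (u + v) = proj G u \<otimes>\<^bsub>G\<^esub> proj G v"
  by transfer simp

lemma proj_uminus: "comm_group G \<Longrightarrow> proj G (- u) = inv\<^bsub>G\<^esub> (proj G u)"
  by transfer simp

instance
proof
  fix a b c :: "'a group_product"
  show "a + b + c = a + (b + c)"
    by (rule group_product_eqI) (simp add: proj_add proj_closed comm_group.axioms(1) comm_monoid.axioms(1) monoid.m_assoc)
  show "a + b = b + a"
    by (rule group_product_eqI) (simp add: proj_add proj_closed comm_group.axioms(1) comm_monoid.m_comm)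
  show "0 + a = a"
    by (rule group_product_eqI) (simp add: proj_add proj_zero proj_closed comm_group.axioms(1) comm_monoid.axioms(1) monoid.l_one)
  show "- a + a = 0"
    by (rule group_product_eqI) (simp add: proj_add proj_zero proj_uminus proj_closed comm_group.axioms(2) group.l_inv)
  show "a - b = a + - b"
    by (simp add: minus_group_product_def)
qed

end

text \<open>Distinct records are distinct indices, so the two groups of a Jordan pair become
  independent summands of one type although their carriers overlap.\<close>

lift_definition embed :: "'a monoid \<Rightarrow> 'a \<Rightarrow> 'a group_product"
  is "\<lambda>G x H. if comm_group H then (if H = G \<and> x \<in> carrier G then x else \<one>\<^bsub>H\<^esub>) else undefined"
  by (simp add: comm_group_one_closed)

lemma proj_embed: "comm_group G \<Longrightarrow> x \<in> carrier G \<Longrightarrow> proj G (embed G x) = x"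
  by transfer simp

lemma embed_inj: "comm_group G \<Longrightarrow> x \<in> carrier G \<Longrightarrow> y \<in> carrier G \<Longrightarrow> embed G x = embed G y \<longleftrightarrow> x = y"
  by (metis proj_embed)

lemma proj_embed_other: "comm_group H \<Longrightarrow> H \<noteq> G \<Longrightarrow> proj H (embed G x) = \<one>\<^bsub>H\<^esub>"
  by transfer simp

lemma embed_mult:
  assumes "comm_group G" "x \<in> carrier G" "y \<in> carrier G"
  shows "embed G (x \<otimes>\<^bsub>G\<^esub> y) = embed G x + embed G y"
proof (rule group_product_eqI)
  fix H :: "'a monoid" assume H: "comm_group H"
  interpret H: comm_group H by fact
  interpret G: comm_group G by fact
  show "proj H (embed G (x \<otimes>\<^bsub>G\<^esub> y)) = proj H (embed G x + embed G y)"
    using assms H by (cases "H = G") (simp_all add: proj_add proj_embed proj_embed_other)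
qed

lemma embed_one: "comm_group G \<Longrightarrow> embed G \<one>\<^bsub>G\<^esub> = 0"
  by transfer auto

lemma embed_inv:
  assumes "comm_group G" "x \<in> carrier G"
  shows "embed G (inv\<^bsub>G\<^esub> x) = - embed G x"
proof -
  interpret comm_group G by fact
  have "embed G (inv\<^bsub>G\<^esub> x) + embed G x = 0"
    using assms by (simp flip: embed_mult add: embed_one)
  then show ?thesis by (simp add: eq_neg_iff_add_eq_0)
qed

text \<open>Lifted maps are total on the host, but symmetry, torsion and divisibility are claimed on
  this summand only; hence the sets \<open>A\<close> and \<open>A'\<close> in the locales
  below.\<close>

definition embedded :: "'a monoid \<Rightarrow> 'a group_product set" where
  "embedded G = embed G ` carrier G"

lemma embed_in_embedded: "x \<in> carrier G \<Longrightarrow> embed G x \<in> embedded G"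
  by (simp add: embedded_def)

lemma embedded_zero: "comm_group G \<Longrightarrow> 0 \<in> embedded G"
  by (metis embed_in_embedded embed_one comm_group_one_closed)

lemma embedded_add:
  assumes "comm_group G" "u \<in> embedded G" "v \<in> embedded G"
  shows "u + v \<in> embedded G"
proof -
  interpret comm_group G by fact
  obtain x y where "x \<in> carrier G" "u = embed G x" "y \<in> carrier G" "v = embed G y"
    using assms by (auto simp: embedded_def)
  then have "u + v = embed G (x \<otimes>\<^bsub>G\<^esub> y)" "x \<otimes>\<^bsub>G\<^esub> y \<in> carrier G"
    by (simp_all add: embed_mult comm_group_axioms)
  then show ?thesis by (simp add: embed_in_embedded)
qed

lemma embedded_uminus:
  assumes "comm_group G" "u \<in> embedded G"
  shows "- u \<in> embedded G"
proof -
  interpret comm_group G by fact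
  obtain x where "x \<in> carrier G" "u = embed G x"
    using assms by (auto simp: embedded_def)
  then have "- u = embed G (inv\<^bsub>G\<^esub> x)" "inv\<^bsub>G\<^esub> x \<in> carrier G"
    by (simp_all add: embed_inv comm_group_axioms)
  then show ?thesis by (simp add: embed_in_embedded)
qed

section \<open>Jordan identities from the five-linear identity\<close>

lemma additive_zero:
  fixes f :: "'x::ab_group_add \<Rightarrow> 'y::ab_group_add"
  assumes "\<And>x y. f (x + y) = f x + f y"
  shows "f 0 = 0"
  using assms[of 0 0] by simp

lemma additive_uminus:
  fixes f :: "'x::ab_group_add \<Rightarrow> 'y::ab_group_add"
  assumes "\<And>x y. f (x + y) = f x + f y"
  shows "f (- x) = - f x"
  using assms[of x "- x"] additive_zero[of f, OF assms] by (simp add: eq_neg_iff_add_eq_0 add.commute)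

lemma additive_diff:
  fixes f :: "'x::ab_group_add \<Rightarrow> 'y::ab_group_add"
  assumes "\<And>x y. f (x + y) = f x + f y"
  shows "f (x - y) = f x - f y"
  using assms[of x "- y"] additive_uminus[of f, OF assms] by simp

text \<open>By the hypotheses \<open>a - c\<close> equals both \<open>2(a - b)\<close> and
  \<open>-(a - b)\<close>. They arise as one instance of the five-linear identity and the same
  instance with two arguments exchanged.\<close>

lemma sub_three_eq_zero:
  fixes a b c :: "'x::ab_group_add"
  assumes "a - b = b - c" and "b - a = a - c"
  shows "(a - c) + (a - c) + (a - c) = 0"
proof -
  have "a - c = (a - b) + (b - c)" by simp
  then have "a - c = (a - b) + (a - b)" using assms(1) by simp
  then have "(a - c) + (a - c) + (a - c) = (b - a) + ((a - b) + (a - b)) + (b - a)"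
    using assms(2) by simp
  also have "\<dots> = 0" by (simp add: algebra_simps)
  finally show ?thesis .
qed

locale trilinear =
  fixes T :: "'f::ab_group_add \<Rightarrow> 'g::ab_group_add \<Rightarrow> 'f \<Rightarrow> 'f"
  assumes T_add1: "T (x + x') y z = T x y z + T x' y z"
    and T_add2: "T x (y + y') z = T x y z + T x y' z"
    and T_add3: "T x y (z + z') = T x y z + T x y z'"
begin

lemmas T_add = T_add1 T_add2 T_add3

lemmas T_zero =
  additive_zero[of "\<lambda>x. T x y z" for y z, OF T_add1]
  additive_zero[of "\<lambda>y. T x y z" for x z, OF T_add2]
  additive_zero[of "\<lambda>z. T x y z" for x y, OF T_add3]

lemmas T_uminus =
  additive_uminus[of "\<lambda>x. T x y z" for y z, OF T_add1]
  additive_uminus[of "\<lambda>y. T x y z" for x z, OF T_add2]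
  additive_uminus[of "\<lambda>z. T x y z" for x y, OF T_add3]

lemmas T_diff =
  additive_diff[of "\<lambda>x. T x y z" for y z, OF T_add1]
  additive_diff[of "\<lambda>y. T x y z" for x z, OF T_add2]
  additive_diff[of "\<lambda>z. T x y z" for x y, OF T_add3]

lemmas T_lin = T_add T_zero T_uminus T_diff

end

text \<open>This half covers the identities with values in \<open>A\<close>;
  \<open>five_linear\<close> adds the mirror image. The proofs only cancel 2 and 3, so absence of
  torsion is assumed, and halves are handed in as elements with a given double.\<close>

locale five_linear_half = trilinear T
  for T :: "'f::ab_group_add \<Rightarrow> 'g::ab_group_add \<Rightarrow> 'f \<Rightarrow> 'f" +
  fixes T' :: "'g \<Rightarrow> 'f \<Rightarrow> 'g \<Rightarrow> 'g" and A :: "'f set" and A' :: "'g set"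
  assumes A_add: "x \<in> A \<Longrightarrow> x' \<in> A \<Longrightarrow> x + x' \<in> A"
    and A_uminus: "x \<in> A \<Longrightarrow> - x \<in> A"
    and T_closed: "x \<in> A \<Longrightarrow> y \<in> A' \<Longrightarrow> z \<in> A \<Longrightarrow> T x y z \<in> A"
    and T_sym: "x \<in> A \<Longrightarrow> y \<in> A' \<Longrightarrow> z \<in> A \<Longrightarrow> T x y z = T z y x"
    and tor2: "x \<in> A \<Longrightarrow> x + x = 0 \<Longrightarrow> x = 0"
    and tor3: "x \<in> A \<Longrightarrow> x + x + x = 0 \<Longrightarrow> x = 0"
    and five: "x \<in> A \<Longrightarrow> y \<in> A' \<Longrightarrow> u \<in> A \<Longrightarrow> v \<in> A' \<Longrightarrow> z \<in> A \<Longrightarrow>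
      T x y (T u v z) - T u v (T x y z) = T (T x y u) v z - T u (T' y x v) z"
begin

lemma A_diff: "x \<in> A \<Longrightarrow> x' \<in> A \<Longrightarrow> x - x' \<in> A"
  using A_add A_uminus by (metis diff_conv_add_uminus)

lemma cancel2:
  assumes "x \<in> A" "x' \<in> A" "x + x = x' + x'" shows "x = x'"
  using tor2[of "x - x'"] assms A_diff by (simp add: algebra_simps)

end

locale five_linear = five_linear_half T T' A A' + dual: five_linear_half T' T A' A
  for T T' A A'
begin

text \<open>With all outer arguments equal to \<open>x\<close>, the five-linear identity relates
  \<open>{x y {x z x}}\<close>, \<open>{x z {x y x}}\<close> and \<open>{x {y x z} x}\<close>.
  Exchanging \<open>y\<close> and \<open>z\<close> gives a second relation in which the last term is
  unchanged; cancelling 3 finishes.\<close>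

lemma T_T_T:
  assumes "x \<in> A" "y \<in> A'" "z \<in> A'"
  shows "T x y (T x z x) = T x (T' y x z) x"
proof -
  let ?a = "T x y (T x z x)" and ?b = "T x z (T x y x)" and ?c = "T x (T' y x z) x"
  have "?a - ?b = ?b - ?c"
    using five[of x y x z x] T_sym[of "T x y x" z x] assms T_closed by simp
  moreover have "?b - ?a = ?a - ?c"
    using five[of x z x y x] T_sym[of "T x z x" y x] dual.T_sym[of z x y] assms T_closed by simp
  ultimately have "(?a - ?c) + (?a - ?c) + (?a - ?c) = 0"
    by (rule sub_three_eq_zero)
  moreover have "?a - ?c \<in> A"
    using assms by (intro A_diff T_closed dual.T_closed)
  ultimately show ?thesis
    using tor3 by fastforce
qed

text \<open>\<open>q\<close> and \<open>p\<close> stand for \<open>Q_x z\<close> and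
  \<open>Q_x {y x z}\<close>. In a scalar extension the quadratic maps are accessible through their
  doubles, so the identities concern arbitrary elements with the right double and are proved after
  doubling.\<close>

lemma jp1:
  assumes "x \<in> A" "y \<in> A'" "z \<in> A'"
    and q: "q \<in> A" "q + q = T x z x" and p: "p \<in> A" "p + p = T x (T' y x z) x"
  shows "T x y q = p"
proof (rule cancel2)
  show "T x y q + T x y q = p + p"
    using T_T_T[of x y z] assms by (simp flip: T_add3)
qed (use assms in \<open>auto intro: T_closed\<close>)

text \<open>Take \<open>u = x\<close> and \<open>v = y\<close> in the five-linear identity: its left
  side is the commutator of an operator with itself.\<close>

lemma jp2:
  assumes "x \<in> A" "y \<in> A'" "z \<in> A"
    and q: "q \<in> A" "q + q = T x y x" and p: "p \<in> A'" "p + p = T' y x y"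
  shows "T q y z = T x p z"
proof (rule cancel2)
  show "T q y z + T q y z = T x p z + T x p z"
    unfolding T_add1[of q q y z, symmetric] T_add2[of x p p z, symmetric] q(2) p(2)
    using five[of x y x y z] assms by simp
qed (use assms in \<open>auto intro: T_closed\<close>)

text \<open>The letters abbreviate \<open>X = Q_x y\<close>, \<open>L = Q_X z\<close>,
  \<open>a = Q_x z\<close>, \<open>b = Q_y a\<close>, \<open>c = Q_x b\<close>. The five-linear
  identity on both sides, with \<open>T_T_T\<close>, yields eight times the claim, and 2 is
  cancelled three times.\<close>

lemma jp3:
  assumes x: "x \<in> A" and y: "y \<in> A'" and z: "z \<in> A'"
    and X: "X \<in> A" "X + X = T x y x"
    and L: "L \<in> A" "L + L = T X z X"
    and a: "a \<in> A" "a + a = T x z x"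
    and b: "b \<in> A'" "b + b = T' y a y"
    and c: "c \<in> A" "c + c = T x b x"
  shows "L = c"
proof -
  note cl = T_closed dual.T_closed assms
  have two: "T x (w + w) x = T x w x + T x w x" for w by (rule T_add2)
  have JP1: "T x w X + T x w X = T x (T' w x y) x" if "w \<in> A'" for w
    using T_T_T[of x w y] that x y by (simp add: X flip: T_add3)
  have "T x y (T x z X) - T x z (T x y X) = T (T x y x) z X - T x (T' y x z) X"
    using five[of x y x z X] cl by simp
  then have "T X z X + T X z X = T x y (T x z X) - T x z (T x y X) + T x (T' y x z) X"
    unfolding X(2)[symmetric] T_add1 by (simp add: algebra_simps)
  then have "(T X z X + T X z X) + (T X z X + T X z X)
      = T x y (T x z X + T x z X) - T x z (T x y X + T x y X) + (T x (T' y x z) X + T x (T' y x z) X)"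
    by (simp add: T_add3)
  also have "\<dots> = T x (T' y x (T' z x y)) x - T x (T' z x (T' y x y)) x + T x (T' (T' y x z) x y) x"
    using JP1 T_T_T cl by simp
  also have "\<dots> = T x (T' y x (T' y x z) - T' z x (T' y x y) + T' y x (T' y x z)) x"
    using dual.T_sym[of z x y] dual.T_sym[of "T' y x z" x y] cl by (simp add: T_add2 T_diff)
  also have "T' y x (T' y x z) - T' z x (T' y x y) + T' y x (T' y x z) = T' y (T x z x) y"
    using dual.five[of z x y x y] dual.T_sym[of z x y] dual.T_sym[of "T' y x z" x y] cl
    by (simp add: algebra_simps)
  also have "T x (T' y (T x z x) y) x = (c + c + (c + c)) + (c + c + (c + c))"
    by (simp add: dual.T_add2 T_add2 a(2)[symmetric] b(2)[symmetric] c(2)[symmetric])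
  finally have "(L + L) + (L + L) = (c + c) + (c + c)"
    using cancel2[of "(L + L) + (L + L)" "(c + c) + (c + c)"] L(1) c(1)
    by (simp add: L(2)[symmetric] A_add)
  then have "L + L = c + c"
    using cancel2[of "L + L" "c + c"] L(1) c(1) by (simp add: A_add)
  then show ?thesis
    using cancel2 L(1) c(1) by blast
qed

end

section \<open>Scalar extensions\<close>

definition psum :: "('a \<Rightarrow> 'r \<Rightarrow> 'c::ab_group_add) \<Rightarrow> ('a \<times> 'r) list \<Rightarrow> 'c" where
  "psum g xs = sum_list (map (\<lambda>(x, r). g x r) xs)"

lemma psum_Nil [simp]: "psum g [] = 0"
  and psum_Cons [simp]: "psum g ((x, r) # xs) = g x r + psum g xs"
  and psum_append [simp]: "psum g (xs @ ys) = psum g xs + psum g ys"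
  by (simp_all add: psum_def)

lemma psum_cong: "set (map fst xs) \<subseteq> C \<Longrightarrow> (\<And>x r. x \<in> C \<Longrightarrow> g x r = h x r) \<Longrightarrow> psum g xs = psum h xs"
  by (induction xs) auto

lemma psum_add: "psum (\<lambda>x r. g x r + h x r) xs = psum g xs + psum h xs"
  by (induction xs) (auto simp: algebra_simps)

lemma psum_concat: "psum g (concat (map f xs)) = sum_list (map (\<lambda>x. psum g (f x)) xs)"
  by (induction xs) auto

lemma psum_map: "psum g (map (\<lambda>(x, r). (f x r, k x r)) xs) = psum (\<lambda>x r. g (f x r) (k x r)) xs"
  by (induction xs) auto

lemma psum_additive: 
  assumes "\<And>u v. f (u + v) = f u + f v"
  shows "f (psum g xs) = psum (\<lambda>x r. f (g x r)) xs"
  by (induction xs) (auto simp: assms additive_zero[of f, OF assms])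

text \<open>These are the biadditive maps of the universal property of the tensor product;
  \<open>psum g\<close> is the induced homomorphism, evaluated on formal sums.\<close>

definition balanced :: "('a, 'm) monoid_scheme \<Rightarrow> ('a \<Rightarrow> 'r::comm_ring_1 \<Rightarrow> 'c::ab_group_add) \<Rightarrow> bool" where
  "balanced G g \<longleftrightarrow> (\<forall>v\<in>carrier G. \<forall>w\<in>carrier G. \<forall>r. g (v \<otimes>\<^bsub>G\<^esub> w) r = g v r + g w r)
     \<and> (\<forall>v\<in>carrier G. \<forall>r s. g v (r + s) = g v r + g v s)"

lemma balancedI:
  assumes "\<And>v w r. v \<in> carrier G \<Longrightarrow> w \<in> carrier G \<Longrightarrow> g (v \<otimes>\<^bsub>G\<^esub> w) r = g v r + g w r"
    and "\<And>v r s. v \<in> carrier G \<Longrightarrow> g v (r + s) = g v r + g v s"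
  shows "balanced G g"
  using assms by (simp add: balanced_def)

text \<open>Well-definedness of the homomorphism induced by a balanced map. Only the zero relation
  needs an argument: it follows from additivity at the identity.\<close>

lemma tensor_eq_psum:
  assumes "monoid G" and g: "balanced G g" and "tensor_eq G xs ys"
  shows "psum g xs = psum g ys"
  using assms(3)
proof induction
  case (te_zero r)
  interpret monoid G by fact
  have "g (\<one>\<^bsub>G\<^esub> \<otimes>\<^bsub>G\<^esub> \<one>\<^bsub>G\<^esub>) r = g \<one>\<^bsub>G\<^esub> r + g \<one>\<^bsub>G\<^esub> r"
    using g one_closed unfolding balanced_def by blast
  then show ?case by simp
qed (use g in \<open>auto simp: balanced_def algebra_simps\<close>)

definition tensor_class :: "('a, 'm) monoid_scheme \<Rightarrow> ('a \<times> 'r::comm_ring_1) list \<Rightarrow> ('a \<times> 'r) list set" where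
  "tensor_class G xs = Collect (tensor_eq G xs)"

lemma tensor_class_eq: "tensor_class G xs = tensor_class G ys \<longleftrightarrow> tensor_eq G xs ys"
  unfolding tensor_class_def by (blast intro: te_refl te_sym te_trans)

definition formal_sums :: "('a, 'm) monoid_scheme \<Rightarrow> ('a \<times> 'r::comm_ring_1) list set" where
  "formal_sums G = {xs. set (map fst xs) \<subseteq> carrier G}"

lemma formal_sums_Nil [simp]: "[] \<in> formal_sums G"
  and formal_sums_Cons [simp]: "(x, r) # xs \<in> formal_sums G \<longleftrightarrow> x \<in> carrier G \<and> xs \<in> formal_sums G"
  and formal_sums_append [simp]: "xs @ ys \<in> formal_sums G \<longleftrightarrow> xs \<in> formal_sums G \<and> ys \<in> formal_sums G"
  by (auto simp: formal_sums_def)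

text \<open>Classes are formed among all lists, also those with entries outside the carrier; a
  representative inside \<open>formal_sums\<close> is chosen before classes are added by
  concatenation.\<close>

definition class_rep :: "('a, 'm) monoid_scheme \<Rightarrow> ('a \<times> 'r::comm_ring_1) list set \<Rightarrow> ('a \<times> 'r) list" where
  "class_rep G X = (SOME xs. xs \<in> formal_sums G \<and> tensor_class G xs = X)"

definition tensor_group :: "('a, 'm) monoid_scheme \<Rightarrow> ('a \<times> 'r::comm_ring_1) list set monoid" where
  "tensor_group G = \<lparr> carrier = tensor_class G ` formal_sums G, mult = (\<lambda>X Y. tensor_class G (class_rep G X @ class_rep G Y)), one = tensor_class G [] \<rparr>"

lemma class_rep:
  assumes "X \<in> tensor_class G ` formal_sums G"
  shows "class_rep G X \<in> formal_sums G" and "tensor_class G (class_rep G X) = X"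
proof -
  have "\<exists>xs. xs \<in> formal_sums G \<and> tensor_class G xs = X" using assms by auto
  then have "class_rep G X \<in> formal_sums G \<and> tensor_class G (class_rep G X) = X"
    unfolding class_rep_def by (rule someI_ex)
  then show "class_rep G X \<in> formal_sums G" "tensor_class G (class_rep G X) = X" by auto
qed

lemma class_rep_tensor_class: "xs \<in> formal_sums G \<Longrightarrow> tensor_eq G (class_rep G (tensor_class G xs)) xs"
  unfolding tensor_class_eq[symmetric] by (rule class_rep(2)[OF imageI])

lemma tmult: "xs \<in> formal_sums G \<Longrightarrow> ys \<in> formal_sums G \<Longrightarrow> tensor_class G xs \<otimes>\<^bsub>tensor_group G\<^esub> tensor_class G ys = tensor_class G (xs @ ys)"
  by (simp add: tensor_group_def tensor_class_eq te_app class_rep_tensor_class)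

locale tensor = comm_group V for V :: "'a monoid"
begin

lemma ex_tinv: "xs \<in> formal_sums V \<Longrightarrow> \<exists>ys\<in>formal_sums V. tensor_eq V (ys @ xs) []"
proof (induction xs)
  case Nil
  then show ?case by (intro bexI[of _ "[]"]) (simp_all add: te_refl)
next
  case (Cons p xs)
  obtain x r where p: "p = (x, r)" by (cases p)
  then have x: "x \<in> carrier V" "xs \<in> formal_sums V" using Cons by auto
  obtain ys where ys: "ys \<in> formal_sums V" "tensor_eq V (ys @ xs) []" using Cons x by auto
  \<comment> \<open>The inverse of the new head is put at the end of \<open>ys\<close>, hence
    directly in front of that head, so that the two cancel inside the concatenation.\<close>
  have "tensor_eq V [(inv\<^bsub>V\<^esub> x, r), (x, r)] [(inv\<^bsub>V\<^esub> x \<otimes>\<^bsub>V\<^esub> x, r)]"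
    by (rule te_sym, rule te_addl) (use x in auto)
  then have "tensor_eq V [(inv\<^bsub>V\<^esub> x, r), (x, r)] []"
    using te_zero[of V r] te_trans x by fastforce
  then have "tensor_eq V (ys @ [(inv\<^bsub>V\<^esub> x, r), (x, r)] @ xs) (ys @ [] @ xs)"
    by (intro te_app te_refl)
  then have "tensor_eq V ((ys @ [(inv\<^bsub>V\<^esub> x, r)]) @ p # xs) []"
    using te_trans ys(2) by (fastforce simp: p)
  then show ?case
    using ys x by (intro bexI[of _ "ys @ [(inv\<^bsub>V\<^esub> x, r)]"]) auto
qed

lemma comm_tensor_group: "comm_group (tensor_group V :: ('a \<times> 'r::comm_ring_1) list set monoid)"
proof (rule comm_groupI)
  let ?G = "tensor_group V :: ('a \<times> 'r::comm_ring_1) list set monoid"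
  have carr: "carrier ?G = tensor_class V ` formal_sums V" "\<one>\<^bsub>?G\<^esub> = tensor_class V []" by (simp_all add: tensor_group_def)
  show "\<one>\<^bsub>?G\<^esub> \<in> carrier ?G" by (simp add: carr)
  fix X assume X: "X \<in> carrier ?G"
  then obtain xs where xs: "xs \<in> formal_sums V" "X = tensor_class V xs" by (auto simp: carr)
  show "\<one>\<^bsub>?G\<^esub> \<otimes>\<^bsub>?G\<^esub> X = X" by (simp add: carr xs tmult)
  obtain ys where "ys \<in> formal_sums V" "tensor_eq V (ys @ xs) []" using ex_tinv xs by blast
  then show "\<exists>Y\<in>carrier ?G. Y \<otimes>\<^bsub>?G\<^esub> X = \<one>\<^bsub>?G\<^esub>"
    by (intro bexI[of _ "tensor_class V ys"]) (simp_all add: carr xs tmult tensor_class_eq imageI)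
  fix Y assume "Y \<in> carrier ?G"
  then obtain ys where ys: "ys \<in> formal_sums V" "Y = tensor_class V ys" by (auto simp: carr)
  show "X \<otimes>\<^bsub>?G\<^esub> Y \<in> carrier ?G" by (simp add: carr xs ys tmult)
  show "X \<otimes>\<^bsub>?G\<^esub> Y = Y \<otimes>\<^bsub>?G\<^esub> X" by (simp add: xs ys tmult tensor_class_eq te_swap)
  fix Z assume "Z \<in> carrier ?G"
  then obtain zs where zs: "zs \<in> formal_sums V" "Z = tensor_class V zs" by (auto simp: carr)
  show "X \<otimes>\<^bsub>?G\<^esub> Y \<otimes>\<^bsub>?G\<^esub> Z = X \<otimes>\<^bsub>?G\<^esub> (Y \<otimes>\<^bsub>?G\<^esub> Z)"
    by (simp add: xs ys zs tmult)
qed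

definition pure :: "'a \<Rightarrow> 'r::comm_ring_1 \<Rightarrow> ('a \<times> 'r) list set group_product" where
  "pure x r = embed (tensor_group V) (tensor_class V [(x, r)])"

definition tensors :: "('a \<times> 'r::comm_ring_1) list set group_product set" where
  "tensors = embedded (tensor_group V)"

lemma tensor_class_carrier: "xs \<in> formal_sums V \<Longrightarrow> tensor_class V xs \<in> carrier (tensor_group V)"
  by (simp add: tensor_group_def)

lemma embed_tensor_class: "xs \<in> formal_sums V \<Longrightarrow> embed (tensor_group V) (tensor_class V xs) = psum pure xs"
proof (induction xs)
  case Nil
  then show ?case using embed_one[OF comm_tensor_group] by (simp add: tensor_group_def)
next
  case (Cons p xs)
  obtain x r where p: "p = (x, r)" by (cases p)
  have "tensor_class V (p # xs) = tensor_class V [p] \<otimes>\<^bsub>tensor_group V\<^esub> tensor_class V xs"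
    using Cons p by (subst tmult) auto
  then show ?case
    using Cons p by (simp add: embed_mult[OF comm_tensor_group] tensor_class_carrier pure_def)
qed

lemma psum_pure_eq: "xs \<in> formal_sums V \<Longrightarrow> ys \<in> formal_sums V \<Longrightarrow> psum pure xs = psum pure ys \<longleftrightarrow> tensor_eq V xs ys"
  by (simp flip: embed_tensor_class add: embed_inj[OF comm_tensor_group] tensor_class_carrier tensor_class_eq)

lemma tensorsE:
  assumes "u \<in> tensors" obtains xs where "xs \<in> formal_sums V" "u = psum pure xs"
proof -
  from assms obtain xs where "xs \<in> formal_sums V" "u = embed (tensor_group V) (tensor_class V xs)"
    by (auto simp: tensors_def embedded_def tensor_group_def)
  then show ?thesis using that by (simp add: embed_tensor_class)
qed

lemma psum_pure_tensors: "xs \<in> formal_sums V \<Longrightarrow> psum pure xs \<in> tensors"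
  unfolding tensors_def by (simp flip: embed_tensor_class add: embed_in_embedded tensor_class_carrier)

lemma pure_tensors: "x \<in> carrier V \<Longrightarrow> pure x r \<in> tensors"
  using psum_pure_tensors[of "[(x, r)]"] by simp

lemma balanced_pure: "balanced V pure"
proof (rule balancedI)
  fix v w r assume "v \<in> carrier V" "w \<in> carrier V"
  then show "pure (v \<otimes>\<^bsub>V\<^esub> w) r = pure v r + pure w r"
    using psum_pure_eq[of "[(v \<otimes>\<^bsub>V\<^esub> w, r)]" "[(v, r), (w, r)]"] te_addl[of v V w r] by simp
next
  fix v r s assume "v \<in> carrier V"
  then show "pure v (r + s) = pure v r + pure v s"
    using psum_pure_eq[of "[(v, r + s)]" "[(v, r), (v, s)]"] te_addr[of v V r s] by simp
qed

lemma pure_add: "v \<in> carrier V \<Longrightarrow> w \<in> carrier V \<Longrightarrow> pure (v \<otimes>\<^bsub>V\<^esub> w) r = pure v r + pure w r"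
  using balanced_pure unfolding balanced_def by blast

lemma pure_add_scalar: "v \<in> carrier V \<Longrightarrow> pure v (r + s) = pure v r + pure v s"
  using balanced_pure unfolding balanced_def by blast

lemma tensors_add: "u \<in> tensors \<Longrightarrow> v \<in> tensors \<Longrightarrow> u + v \<in> tensors"
  and tensors_uminus: "u \<in> tensors \<Longrightarrow> - u \<in> tensors"
  and tensors_zero: "0 \<in> tensors"
  unfolding tensors_def by (rule embedded_add[OF comm_tensor_group] embedded_uminus[OF comm_tensor_group] embedded_zero[OF comm_tensor_group]; assumption?)+

lemma psum_tensors: "set (map fst xs) \<subseteq> C \<Longrightarrow> (\<And>x r. x \<in> C \<Longrightarrow> g x r \<in> tensors) \<Longrightarrow> psum g xs \<in> tensors"
  by (induction xs) (auto simp: tensors_add tensors_zero)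

definition rep :: "('a \<times> 'r::comm_ring_1) list set group_product \<Rightarrow> ('a \<times> 'r) list" where
  "rep u = class_rep V (proj (tensor_group V) u)"

lemma rep: "rep u \<in> formal_sums V" "tensor_class V (rep u) = proj (tensor_group V) u"
  using class_rep[of "proj (tensor_group V) u" V] proj_closed[OF comm_tensor_group, of u]
  by (auto simp: rep_def tensor_group_def)

lemma rep_set: "set (map fst (rep u)) \<subseteq> carrier V"
  using rep(1)[of u] by (simp add: formal_sums_def)

text \<open>Summing a balanced map over a chosen representative is the induced homomorphism. Since
  \<open>rep\<close> first projects, it is additive on the whole host type, which makes the extended
  triple product total and trilinear.\<close>

lemma lsum_add: "balanced V g \<Longrightarrow> psum g (rep (u + v)) = psum g (rep u) + psum g (rep v)"
proof -
  assume g: "balanced V g"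
  have "tensor_class V (rep (u + v)) = tensor_class V (rep u @ rep v)"
    by (simp add: rep proj_add[OF comm_tensor_group] flip: tmult)
  then have "psum g (rep (u + v)) = psum g (rep u @ rep v)"
    using tensor_eq_psum[OF is_monoid g] by (simp add: tensor_class_eq)
  then show ?thesis by simp
qed

lemma lsum_pure: "balanced V g \<Longrightarrow> xs \<in> formal_sums V \<Longrightarrow> psum g (rep (psum pure xs)) = psum g xs"
proof -
  assume g: "balanced V g" and xs: "xs \<in> formal_sums V"
  have "tensor_class V (rep (psum pure xs)) = tensor_class V xs"
    by (simp add: rep proj_embed[OF comm_tensor_group] tensor_class_carrier xs flip: embed_tensor_class)
  then show ?thesis
    using tensor_eq_psum[OF is_monoid g] by (simp add: tensor_class_eq)
qed

lemma additive_zero_tensors: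
  assumes "\<And>u v. f (u + v) = f u + (f v :: 'c::ab_group_add)" and "\<And>x r. x \<in> carrier V \<Longrightarrow> f (pure x r) = 0"
    and "u \<in> tensors"
  shows "f u = 0"
proof -
  obtain xs where xs: "xs \<in> formal_sums V" "u = psum pure xs" using assms(3) by (rule tensorsE)
  have "f u = psum (\<lambda>x r. f (pure x r)) xs" unfolding xs(2) by (rule psum_additive[of f, OF assms(1)])
  also have "\<dots> = psum (\<lambda>x r. 0) xs"
    by (rule psum_cong[of _ "carrier V"]) (use assms(2) xs in \<open>auto simp: formal_sums_def\<close>)
  also have "\<dots> = 0" by (induction xs) auto
  finally show ?thesis .
qed

text \<open>Absence of 2-torsion in \<open>V\<close> need not survive tensoring, for instance with a
  ring of characteristic 2. A halving homomorphism \<open>h\<close> does survive: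
  \<open>pure (h x) r\<close> induces a map inverse to doubling.\<close>

lemma tensors_tor2:
  assumes h: "\<And>x. x \<in> carrier V \<Longrightarrow> h x \<in> carrier V"
      "\<And>x y. x \<in> carrier V \<Longrightarrow> y \<in> carrier V \<Longrightarrow> h (x \<otimes>\<^bsub>V\<^esub> y) = h x \<otimes>\<^bsub>V\<^esub> h y"
      "\<And>x. x \<in> carrier V \<Longrightarrow> h x \<otimes>\<^bsub>V\<^esub> h x = x"
    and u: "u \<in> tensors" "u + u = 0"
  shows "u = 0"
proof -
  let ?g = "\<lambda>x r. pure (h x) r"
  have g: "balanced V ?g" by (rule balancedI) (simp_all add: h pure_add pure_add_scalar)
  obtain xs where xs: "xs \<in> formal_sums V" "u = psum pure xs" using u(1) by (rule tensorsE)
  have "psum pure (xs @ xs) = psum pure []" using u(2) xs by simp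
  then have "tensor_eq V (xs @ xs) []" using psum_pure_eq[of "xs @ xs" "[]"] xs(1) by simp
  then have "psum ?g (xs @ xs) = 0" using tensor_eq_psum[OF is_monoid g] by fastforce
  then have "psum (\<lambda>x r. ?g x r + ?g x r) xs = 0" by (simp add: psum_add)
  moreover have "psum (\<lambda>x r. ?g x r + ?g x r) xs = psum pure xs"
    by (rule psum_cong[of _ "carrier V"]) (use xs h in \<open>auto simp: formal_sums_def simp flip: pure_add\<close>)
  ultimately show ?thesis using xs by simp
qed

lemma tensors_tor3:
  assumes h: "\<And>x. x \<in> carrier V \<Longrightarrow> h x \<in> carrier V"
      "\<And>x y. x \<in> carrier V \<Longrightarrow> y \<in> carrier V \<Longrightarrow> h (x \<otimes>\<^bsub>V\<^esub> y) = h x \<otimes>\<^bsub>V\<^esub> h y"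
      "\<And>x. x \<in> carrier V \<Longrightarrow> h x \<otimes>\<^bsub>V\<^esub> h x \<otimes>\<^bsub>V\<^esub> h x = x"
    and u: "u \<in> tensors" "u + u + u = 0"
  shows "u = 0"
proof -
  let ?g = "\<lambda>x r. pure (h x) r"
  have g: "balanced V ?g" by (rule balancedI) (simp_all add: h pure_add pure_add_scalar)
  obtain xs where xs: "xs \<in> formal_sums V" "u = psum pure xs" using u(1) by (rule tensorsE)
  have "psum pure (xs @ xs @ xs) = psum pure []" using u(2) xs by (simp add: add.assoc)
  then have "tensor_eq V (xs @ xs @ xs) []" using psum_pure_eq[of "xs @ xs @ xs" "[]"] xs(1) by simp
  then have "psum ?g (xs @ xs @ xs) = 0" using tensor_eq_psum[OF is_monoid g] by fastforce
  then have "psum (\<lambda>x r. ?g x r + ?g x r + ?g x r) xs = 0" by (simp add: psum_add add.assoc)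
  moreover have "psum (\<lambda>x r. ?g x r + ?g x r + ?g x r) xs = psum pure xs"
    by (rule psum_cong[of _ "carrier V"]) (use xs h in \<open>auto simp: formal_sums_def simp flip: pure_add\<close>)
  ultimately show ?thesis using xs by simp
qed

end

locale tensor_triple = V: tensor V + W: tensor W for V W :: "'a monoid" +
  fixes t :: "'a \<Rightarrow> 'a \<Rightarrow> 'a \<Rightarrow> 'a" and Q :: "'a \<Rightarrow> 'a \<Rightarrow> 'a"
  assumes t_closed: "x \<in> carrier V \<Longrightarrow> y \<in> carrier W \<Longrightarrow> z \<in> carrier V \<Longrightarrow> t x y z \<in> carrier V"
    and t_add1: "x \<in> carrier V \<Longrightarrow> x' \<in> carrier V \<Longrightarrow> y \<in> carrier W \<Longrightarrow> z \<in> carrier V \<Longrightarrow>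
      t (x \<otimes>\<^bsub>V\<^esub> x') y z = t x y z \<otimes>\<^bsub>V\<^esub> t x' y z"
    and t_add2: "x \<in> carrier V \<Longrightarrow> y \<in> carrier W \<Longrightarrow> y' \<in> carrier W \<Longrightarrow> z \<in> carrier V \<Longrightarrow>
      t x (y \<otimes>\<^bsub>W\<^esub> y') z = t x y z \<otimes>\<^bsub>V\<^esub> t x y' z"
    and t_add3: "x \<in> carrier V \<Longrightarrow> y \<in> carrier W \<Longrightarrow> z \<in> carrier V \<Longrightarrow> z' \<in> carrier V \<Longrightarrow>
      t x y (z \<otimes>\<^bsub>V\<^esub> z') = t x y z \<otimes>\<^bsub>V\<^esub> t x y z'"
    and t_sym: "x \<in> carrier V \<Longrightarrow> y \<in> carrier W \<Longrightarrow> z \<in> carrier V \<Longrightarrow> t x y z = t z y x"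
    and Q_closed: "x \<in> carrier V \<Longrightarrow> y \<in> carrier W \<Longrightarrow> Q x y \<in> carrier V"
    and Q_double: "x \<in> carrier V \<Longrightarrow> y \<in> carrier W \<Longrightarrow> Q x y \<otimes>\<^bsub>V\<^esub> Q x y = t x y x"
    and t_Q: "x \<in> carrier V \<Longrightarrow> y \<in> carrier W \<Longrightarrow> z \<in> carrier V \<Longrightarrow> trip V Q x y z = t x y z"
begin

definition triple_ext :: "('a \<times> 'r::comm_ring_1) list set group_product \<Rightarrow> ('a \<times> 'r) list set group_product
    \<Rightarrow> ('a \<times> 'r) list set group_product \<Rightarrow> ('a \<times> 'r) list set group_product" where
  "triple_ext u v w = psum (\<lambda>x r. psum (\<lambda>y s. psum (\<lambda>z q. V.pure (t x y z) (r * s * q)) (V.rep w)) (W.rep v)) (V.rep u)"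

text \<open>The triple product is extended one argument at a time, innermost first; the other
  arguments are frozen as elements or formal sums.\<close>

lemma balanced3: "x \<in> carrier V \<Longrightarrow> y \<in> carrier W \<Longrightarrow> balanced V (\<lambda>z q. V.pure (t x y z) (r * s * q))"
  by (rule balancedI) (simp_all add: t_add3 t_closed V.pure_add V.pure_add_scalar distrib_left)

lemma balanced2: "x \<in> carrier V \<Longrightarrow> set (map fst zs) \<subseteq> carrier V \<Longrightarrow>
    balanced W (\<lambda>y s. psum (\<lambda>z q. V.pure (t x y z) (r * s * q)) zs)"
  by (rule balancedI; subst psum_add[symmetric], rule psum_cong[of _ "carrier V"])
    (simp_all add: t_add2 t_closed V.pure_add V.pure_add_scalar distrib_left distrib_right)

lemma balanced1: "set (map fst ys) \<subseteq> carrier W \<Longrightarrow> set (map fst zs) \<subseteq> carrier V \<Longrightarrow>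
    balanced V (\<lambda>x r. psum (\<lambda>y s. psum (\<lambda>z q. V.pure (t x y z) (r * s * q)) zs) ys)"
  by (rule balancedI; subst psum_add[symmetric], rule psum_cong[of _ "carrier W"], assumption,
      subst psum_add[symmetric], rule psum_cong[of _ "carrier V"])
    (simp_all add: t_add1 t_closed V.pure_add V.pure_add_scalar distrib_left distrib_right)

lemma trilinear_triple_ext: "trilinear triple_ext"
proof
  fix x x' z z' y y' :: "('a \<times> 'r::comm_ring_1) list set group_product"
  show "triple_ext (x + x') y z = triple_ext x y z + triple_ext x' y z"
    unfolding triple_ext_def by (rule V.lsum_add[OF balanced1[OF W.rep_set V.rep_set]])
  show "triple_ext x (y + y') z = triple_ext x y z + triple_ext x y' z"
    unfolding triple_ext_def psum_add[symmetric]
    by (rule psum_cong[OF V.rep_set], rule W.lsum_add[OF balanced2[OF _ V.rep_set]])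
  show "triple_ext x y (z + z') = triple_ext x y z + triple_ext x y z'"
    unfolding triple_ext_def psum_add[symmetric]
    by (rule psum_cong[OF V.rep_set], rule psum_cong[OF W.rep_set], rule V.lsum_add[OF balanced3])
qed

lemma triple_ext_psum:
  assumes xs: "xs \<in> formal_sums V" and ys: "ys \<in> formal_sums W" and zs: "zs \<in> formal_sums V"
  shows "triple_ext (psum V.pure xs) (psum W.pure ys) (psum V.pure zs) =
    psum (\<lambda>x r. psum (\<lambda>y s. psum (\<lambda>z q. V.pure (t x y z) (r * s * q)) zs) ys) xs"
proof -
  have set: "set (map fst xs) \<subseteq> carrier V" "set (map fst ys) \<subseteq> carrier W"
    using xs ys by (simp_all add: formal_sums_def)
  have "triple_ext (psum V.pure xs) (psum W.pure ys) (psum V.pure zs) =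
      psum (\<lambda>x r. psum (\<lambda>y s. psum (\<lambda>z q. V.pure (t x y z) (r * s * q)) (V.rep (psum V.pure zs))) (W.rep (psum W.pure ys))) xs"
    unfolding triple_ext_def by (rule V.lsum_pure[OF balanced1[OF W.rep_set V.rep_set] xs])
  also have "\<dots> = psum (\<lambda>x r. psum (\<lambda>y s. psum (\<lambda>z q. V.pure (t x y z) (r * s * q)) (V.rep (psum V.pure zs))) ys) xs"
    by (rule psum_cong[OF set(1)], rule W.lsum_pure[OF balanced2[OF _ V.rep_set] ys])
  also have "\<dots> = psum (\<lambda>x r. psum (\<lambda>y s. psum (\<lambda>z q. V.pure (t x y z) (r * s * q)) zs) ys) xs"
    by (rule psum_cong[OF set(1)], rule psum_cong[OF set(2)], rule V.lsum_pure[OF balanced3 zs])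
  finally show ?thesis .
qed

lemma triple_ext_pure: "x \<in> carrier V \<Longrightarrow> y \<in> carrier W \<Longrightarrow> z \<in> carrier V \<Longrightarrow>
    triple_ext (V.pure x r) (W.pure y s) (V.pure z q) = V.pure (t x y z) (r * s * q)"
  using triple_ext_psum[of "[(x, r)]" "[(y, s)]" "[(z, q)]"] by simp

lemma triple_ext_closed: "triple_ext u v w \<in> V.tensors"
  unfolding triple_ext_def
  by (rule V.psum_tensors[OF V.rep_set], rule V.psum_tensors[OF W.rep_set], rule V.psum_tensors[OF V.rep_set],
      rule V.pure_tensors, rule t_closed)

lemma triple_ext_sym:
  assumes "u \<in> V.tensors" "v \<in> W.tensors" "w \<in> V.tensors"
  shows "triple_ext u v w = triple_ext w v u"
proof -
  interpret trilinear triple_ext by (rule trilinear_triple_ext)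
  have "triple_ext u v w - triple_ext w v u = 0"
  proof (rule V.additive_zero_tensors[where f = "\<lambda>u. triple_ext u v w - triple_ext w v u", OF _ _ assms(1)])
    fix x r assume x: "x \<in> carrier V"
    show "triple_ext (V.pure x r) v w - triple_ext w v (V.pure x r) = 0"
    proof (rule W.additive_zero_tensors[where f = "\<lambda>v. triple_ext (V.pure x r) v w - triple_ext w v (V.pure x r)", OF _ _ assms(2)])
      fix y s assume y: "y \<in> carrier W"
      show "triple_ext (V.pure x r) (W.pure y s) w - triple_ext w (W.pure y s) (V.pure x r) = 0"
        by (rule V.additive_zero_tensors[where f = "\<lambda>w. triple_ext (V.pure x r) (W.pure y s) w - triple_ext w (W.pure y s) (V.pure x r)", OF _ _ assms(3)])
          (simp_all add: triple_ext_pure x y t_sym[of x y] T_lin algebra_simps)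
    qed (simp add: T_lin algebra_simps)
  qed (simp add: T_lin algebra_simps)
  then show ?thesis by simp
qed

lemma text_ext_eq:
  assumes xs: "xs \<in> formal_sums V" and ys: "ys \<in> formal_sums W" and zs: "zs \<in> formal_sums V"
  shows "text_ext V Q xs ys zs \<in> formal_sums V"
    and "psum V.pure (text_ext V Q xs ys zs) = triple_ext (psum V.pure xs) (psum W.pure ys) (psum V.pure zs)"
proof -
  have set: "set (map fst xs) \<subseteq> carrier V" "set (map fst ys) \<subseteq> carrier W" "set (map fst zs) \<subseteq> carrier V"
    using xs ys zs by (simp_all add: formal_sums_def)
  then have mem: "p \<in> set xs \<Longrightarrow> fst p \<in> carrier V" "p \<in> set ys \<Longrightarrow> fst p \<in> carrier W"
    "p \<in> set zs \<Longrightarrow> fst p \<in> carrier V" for p by auto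
  show "text_ext V Q xs ys zs \<in> formal_sums V"
    unfolding text_ext_def formal_sums_def
    by (auto simp: t_Q dest!: mem intro!: t_closed)
  have "psum V.pure (text_ext V Q xs ys zs) =
    psum (\<lambda>x r. psum (\<lambda>y s. psum (\<lambda>z q. V.pure (trip V Q x y z) (r * s * q)) zs) ys) xs"
    unfolding text_ext_def psum_concat case_prod_unfold
    by (simp add: case_prod_unfold psum_def o_def)
  also have "\<dots> = psum (\<lambda>x r. psum (\<lambda>y s. psum (\<lambda>z q. V.pure (t x y z) (r * s * q)) zs) ys) xs"
    by (rule psum_cong[OF set(1)], rule psum_cong[OF set(2)], rule psum_cong[OF set(3)]) (simp add: t_Q)
  also have "\<dots> = triple_ext (psum V.pure xs) (psum W.pure ys) (psum V.pure zs)"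
    by (rule triple_ext_psum[OF xs ys zs, symmetric])
  finally show "psum V.pure (text_ext V Q xs ys zs) = triple_ext (psum V.pure xs) (psum W.pure ys) (psum V.pure zs)" .
qed

text \<open>Separates the diagonal from the pairs \<open>i < k\<close>, the shape in which
  \<open>qext\<close> lists its terms.\<close>

lemma sum_square:
  fixes F :: "nat \<Rightarrow> nat \<Rightarrow> 'c::ab_group_add"
  shows "(\<Sum>i<n. \<Sum>k<n. F i k) = (\<Sum>i<n. F i i) + (\<Sum>i<n. \<Sum>k\<in>{Suc i..<n}. F i k + F k i)"
proof (induction n)
  case (Suc n)
  have "(\<Sum>i<Suc n. \<Sum>k\<in>{Suc i..<Suc n}. F i k + F k i)
      = (\<Sum>i<n. (\<Sum>k\<in>{Suc i..<n}. F i k + F k i) + (F i n + F n i))"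
    by simp
  then show ?case
    using Suc by (simp add: sum.distrib algebra_simps)
qed simp

lemma psum_nth: "psum g xs = (\<Sum>i<length xs. g (fst (xs ! i)) (snd (xs ! i)))"
proof -
  have "psum g xs = sum_list (map (\<lambda>i. g (fst (xs ! i)) (snd (xs ! i))) [0..<length xs])"
    unfolding psum_def by (rule arg_cong[of _ _ sum_list], rule nth_equalityI) (simp_all add: case_prod_unfold)
  then show ?thesis by (simp add: interv_sum_list_conv_sum_set_nat atLeast0LessThan)
qed

text \<open>Doubling turns the diagonal terms into \<open>{x_i y x_i}\<close> and, by symmetry, the
  terms with \<open>i < k\<close> into all mixed terms, which together form the full trilinear
  sum.\<close>

lemma qext_eq:
  assumes xs: "xs \<in> formal_sums V" and ys: "ys \<in> formal_sums W"
  shows "qext V Q xs ys \<in> formal_sums V"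
    and "psum V.pure (qext V Q xs ys) + psum V.pure (qext V Q xs ys) = triple_ext (psum V.pure xs) (psum W.pure ys) (psum V.pure xs)"
proof -
  let ?n = "length xs" and ?x = "\<lambda>i. fst (xs ! i)" and ?r = "\<lambda>i. snd (xs ! i)"
  have x: "?x i \<in> carrier V" if "i < ?n" for i
    using xs that by (auto simp: formal_sums_def)
  have set: "set (map fst ys) \<subseteq> carrier W" using ys by (simp add: formal_sums_def)
  then have mem: "p \<in> set ys \<Longrightarrow> fst p \<in> carrier W" for p by auto
  have qq: "qq V Q x z y = t x y z" if "x \<in> carrier V" "y \<in> carrier W" "z \<in> carrier V" for x y z
    using t_Q[OF that] by (simp add: trip_def)
  show "qext V Q xs ys \<in> formal_sums V"
    unfolding qext_def formal_sums_def
    by (auto simp: qq x dest!: mem intro!: t_closed Q_closed)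
  define D where "D i = psum (\<lambda>y s. V.pure (Q (?x i) y) (?r i * ?r i * s)) ys" for i
  define F where "F i k = psum (\<lambda>y s. V.pure (t (?x i) y (?x k)) (?r i * s * ?r k)) ys" for i k
  have DF: "D i + D i = F i i" if "i < ?n" for i
    unfolding D_def F_def psum_add[symmetric]
    by (rule psum_cong[OF set]) (simp add: Q_closed x that Q_double mult_ac flip: V.pure_add)
  have FF: "F i k = F k i" if "i < ?n" "k < ?n" for i k
    unfolding F_def
  proof (rule psum_cong[OF set])
    fix y s assume y: "y \<in> carrier W"
    show "V.pure (t (?x i) y (?x k)) (?r i * s * ?r k) = V.pure (t (?x k) y (?x i)) (?r k * s * ?r i)"
      using t_sym[OF x[OF that(1)] y x[OF that(2)]] by (simp add: mult_ac)
  qed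
  have "psum V.pure (qext V Q xs ys) = (\<Sum>i<?n. D i) +
      (\<Sum>i<?n. \<Sum>k\<in>{Suc i..<?n}. psum (\<lambda>y s. V.pure (qq V Q (?x i) (?x k) y) (?r i * ?r k * s)) ys)"
    unfolding qext_def psum_append psum_concat D_def
    by (simp add: psum_map interv_sum_list_conv_sum_set_nat atLeast0LessThan)
  also have "\<dots> = (\<Sum>i<?n. D i) + (\<Sum>i<?n. \<Sum>k\<in>{Suc i..<?n}. F i k)"
    unfolding F_def
    by (intro arg_cong2[of _ _ _ _ "(+)"] refl sum.cong psum_cong[OF set]) (simp add: qq x mult_ac)
  finally have q: "psum V.pure (qext V Q xs ys) = (\<Sum>i<?n. D i) + (\<Sum>i<?n. \<Sum>k\<in>{Suc i..<?n}. F i k)" .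
  have "triple_ext (psum V.pure xs) (psum W.pure ys) (psum V.pure xs) = (\<Sum>i<?n. \<Sum>k<?n. F i k)"
  proof -
    have "triple_ext (psum V.pure xs) (psum W.pure ys) (psum V.pure xs) =
      (\<Sum>i<?n. \<Sum>m<length ys. \<Sum>k<?n. V.pure (t (?x i) (fst (ys ! m)) (?x k)) (?r i * snd (ys ! m) * ?r k))"
      unfolding triple_ext_psum[OF xs ys xs] by (simp only: psum_nth)
    also have "\<dots> = (\<Sum>i<?n. \<Sum>k<?n. F i k)"
      unfolding F_def by (subst sum.swap) (simp only: psum_nth)
    finally show ?thesis .
  qed
  also have "\<dots> = (\<Sum>i<?n. F i i) + (\<Sum>i<?n. \<Sum>k\<in>{Suc i..<?n}. F i k + F k i)"
    by (rule sum_square)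
  also have "\<dots> = (\<Sum>i<?n. D i + D i) + (\<Sum>i<?n. \<Sum>k\<in>{Suc i..<?n}. F i k + F i k)"
    using DF FF by simp
  also have "\<dots> = psum V.pure (qext V Q xs ys) + psum V.pure (qext V Q xs ys)"
    unfolding q by (simp add: sum.distrib algebra_simps)
  finally show "psum V.pure (qext V Q xs ys) + psum V.pure (qext V Q xs ys) = triple_ext (psum V.pure xs) (psum W.pure ys) (psum V.pure xs)" ..
qed

end

text \<open>The negative terms of \<open>five\<close> are moved across, so that it can be carried to
  pure tensors by \<open>pure_add\<close> alone. \<open>h2\<close> and \<open>h3\<close> are halving
  and division by three.\<close>

locale tensor_pair_half = VW: tensor_triple V W t Q + WV: tensor_triple W V t' Q'
  for V W :: "'a monoid" and t Q t' Q' +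
  fixes h2 h3 :: "'a \<Rightarrow> 'a"
  assumes h2: "x \<in> carrier V \<Longrightarrow> h2 x \<in> carrier V"
      "x \<in> carrier V \<Longrightarrow> y \<in> carrier V \<Longrightarrow> h2 (x \<otimes>\<^bsub>V\<^esub> y) = h2 x \<otimes>\<^bsub>V\<^esub> h2 y"
      "x \<in> carrier V \<Longrightarrow> h2 x \<otimes>\<^bsub>V\<^esub> h2 x = x"
    and h3: "x \<in> carrier V \<Longrightarrow> h3 x \<in> carrier V"
      "x \<in> carrier V \<Longrightarrow> y \<in> carrier V \<Longrightarrow> h3 (x \<otimes>\<^bsub>V\<^esub> y) = h3 x \<otimes>\<^bsub>V\<^esub> h3 y"
      "x \<in> carrier V \<Longrightarrow> h3 x \<otimes>\<^bsub>V\<^esub> h3 x \<otimes>\<^bsub>V\<^esub> h3 x = x"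
    and five: "x \<in> carrier V \<Longrightarrow> y \<in> carrier W \<Longrightarrow> u \<in> carrier V \<Longrightarrow> v \<in> carrier W \<Longrightarrow> z \<in> carrier V \<Longrightarrow>
      t x y (t u v z) \<otimes>\<^bsub>V\<^esub> t u (t' y x v) z = t (t x y u) v z \<otimes>\<^bsub>V\<^esub> t u v (t x y z)"
begin

lemma five_linear_half:
  "five_linear_half VW.triple_ext WV.triple_ext (VW.V.tensors :: ('a \<times> 'r::comm_ring_1) list set group_product set) VW.W.tensors"
proof -
  interpret T: trilinear "VW.triple_ext :: ('a \<times> 'r) list set group_product \<Rightarrow> _" by (rule VW.trilinear_triple_ext)
  interpret T': trilinear "WV.triple_ext :: ('a \<times> 'r) list set group_product \<Rightarrow> _" by (rule WV.trilinear_triple_ext)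
  let ?T = "VW.triple_ext :: ('a \<times> 'r) list set group_product \<Rightarrow> _" and ?T' = "WV.triple_ext :: ('a \<times> 'r) list set group_product \<Rightarrow> _"
  \<comment> \<open>The defect of the five-linear identity is additive in each of its arguments, so
    it suffices to let it vanish on pure tensors.\<close>
  define f where "f x y u v z = ?T x y (?T u v z) - ?T u v (?T x y z) - (?T (?T x y u) v z - ?T u (?T' y x v) z)"
    for x y u v z
  have f_add: "f (x + x') y u v z = f x y u v z + f x' y u v z"
    "f x (y + y') u v z = f x y u v z + f x y' u v z"
    "f x y (u + u') v z = f x y u v z + f x y u' v z"
    "f x y u (v + v') z = f x y u v z + f x y u v' z"
    "f x y u v (z + z') = f x y u v z + f x y u v z'" for x x' y y' u u' v v' z z'
    by (simp_all add: f_def T.T_lin T'.T_lin algebra_simps)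
  have gen: "f (VW.V.pure x a) (VW.W.pure y b) (VW.V.pure u c) (VW.W.pure v d) (VW.V.pure z e) = 0"
    if "x \<in> carrier V" "y \<in> carrier W" "u \<in> carrier V" "v \<in> carrier W" "z \<in> carrier V" for x a y b u c v d z e
  proof -
    note cl = that VW.t_closed WV.t_closed
    let ?p = "a * b * c * d * e"
    have "VW.V.pure (t x y (t u v z) \<otimes>\<^bsub>V\<^esub> t u (t' y x v) z) ?p = VW.V.pure (t (t x y u) v z \<otimes>\<^bsub>V\<^esub> t u v (t x y z)) ?p"
      using five[OF that] by simp
    then have "VW.V.pure (t x y (t u v z)) ?p + VW.V.pure (t u (t' y x v) z) ?p
        = VW.V.pure (t (t x y u) v z) ?p + VW.V.pure (t u v (t x y z)) ?p"
      using cl by (simp add: VW.V.pure_add)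
    then show ?thesis
      using cl by (simp add: f_def VW.triple_ext_pure WV.triple_ext_pure mult_ac) (simp add: algebra_simps)
  qed
  have f_zero: "f x y u v z = 0"
    if "x \<in> VW.V.tensors" "y \<in> VW.W.tensors" "u \<in> VW.V.tensors" "v \<in> VW.W.tensors" "z \<in> VW.V.tensors" for x y u v z
    by (rule VW.V.additive_zero_tensors[where f = "\<lambda>x. f x y u v z", OF f_add(1) _ that(1)],
        rule VW.W.additive_zero_tensors[where f = "\<lambda>y. f _ y u v z", OF f_add(2) _ that(2)],
        rule VW.V.additive_zero_tensors[where f = "\<lambda>u. f _ _ u v z", OF f_add(3) _ that(3)],
        rule VW.W.additive_zero_tensors[where f = "\<lambda>v. f _ _ _ v z", OF f_add(4) _ that(4)],
        rule VW.V.additive_zero_tensors[where f = "\<lambda>z. f _ _ _ _ z", OF f_add(5) _ that(5)],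
        rule gen)
  show ?thesis
  proof
    fix x y z :: "('a \<times> 'r) list set group_product"
    show "x \<in> VW.V.tensors \<Longrightarrow> y \<in> VW.V.tensors \<Longrightarrow> x + y \<in> VW.V.tensors" by (rule VW.V.tensors_add)
    show "x \<in> VW.V.tensors \<Longrightarrow> - x \<in> VW.V.tensors" by (rule VW.V.tensors_uminus)
    show "?T x y z \<in> VW.V.tensors" by (rule VW.triple_ext_closed)
    show "x \<in> VW.V.tensors \<Longrightarrow> y \<in> VW.W.tensors \<Longrightarrow> z \<in> VW.V.tensors \<Longrightarrow> ?T x y z = ?T z y x" by (rule VW.triple_ext_sym)
    show "x \<in> VW.V.tensors \<Longrightarrow> x + x = 0 \<Longrightarrow> x = 0" by (rule VW.V.tensors_tor2[of h2]) (use h2 in auto)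
    show "x \<in> VW.V.tensors \<Longrightarrow> x + x + x = 0 \<Longrightarrow> x = 0" by (rule VW.V.tensors_tor3[of h3]) (use h3 in auto)
    fix u v
    show "x \<in> VW.V.tensors \<Longrightarrow> y \<in> VW.W.tensors \<Longrightarrow> u \<in> VW.V.tensors \<Longrightarrow> v \<in> VW.W.tensors \<Longrightarrow> z \<in> VW.V.tensors \<Longrightarrow>
      ?T x y (?T u v z) - ?T u v (?T x y z) = ?T (?T x y u) v z - ?T u (?T' y x v) z"
      using f_zero[of x y u v z] by (simp add: f_def)
  qed
qed

end

lemma jp_identities_tensor:
  assumes "tensor_pair_half V W t Q t' Q' h2 h3" and "tensor_pair_half W V t' Q' t Q h2' h3'"
  shows "jp_identities TYPE('r::comm_ring_1) V W Q Q'"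
proof -
  interpret a: tensor_pair_half V W t Q t' Q' h2 h3 by fact
  interpret b: tensor_pair_half W V t' Q' t Q h2' h3' by fact
  interpret five_linear "a.VW.triple_ext :: ('a \<times> 'r) list set group_product \<Rightarrow> _" a.WV.triple_ext a.VW.V.tensors a.VW.W.tensors
    by (rule five_linear.intro[OF a.five_linear_half b.five_linear_half])
  have ext: "ext_elems G TYPE('r) = formal_sums G" for G :: "'a monoid"
    by (simp add: ext_elems_def formal_sums_def)
  note mem = a.VW.text_ext_eq(1) a.WV.text_ext_eq(1) a.VW.qext_eq(1) a.WV.qext_eq(1)
  note val = a.VW.text_ext_eq(2) a.WV.text_ext_eq(2)
  note q = a.VW.qext_eq(2) a.WV.qext_eq(2)
  note tensors = a.VW.V.psum_pure_tensors a.VW.W.psum_pure_tensors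
  show ?thesis
    unfolding jp_identities_def ext
  proof (intro ballI conjI)
    fix xs ys zs :: "('a \<times> 'r) list"
    assume xs: "xs \<in> formal_sums V" and ys: "ys \<in> formal_sums W" and zs: "zs \<in> formal_sums W"
    show "tensor_eq V (text_ext V Q xs ys (qext V Q xs zs)) (qext V Q xs (text_ext W Q' ys xs zs))"
    proof (subst a.VW.V.psum_pure_eq[symmetric])
      show "psum a.VW.V.pure (text_ext V Q xs ys (qext V Q xs zs)) = psum a.VW.V.pure (qext V Q xs (text_ext W Q' ys xs zs))"
        using jp1[of "psum a.VW.V.pure xs" "psum a.VW.W.pure ys" "psum a.VW.W.pure zs"
            "psum a.VW.V.pure (qext V Q xs zs)" "psum a.VW.V.pure (qext V Q xs (text_ext W Q' ys xs zs))"]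
        by (simp add: xs ys zs mem val q tensors)
    qed (simp_all add: xs ys zs mem)
    show "tensor_eq V (qext V Q (qext V Q xs ys) zs) (qext V Q xs (qext W Q' ys (qext V Q xs zs)))"
    proof (subst a.VW.V.psum_pure_eq[symmetric])
      show "psum a.VW.V.pure (qext V Q (qext V Q xs ys) zs) = psum a.VW.V.pure (qext V Q xs (qext W Q' ys (qext V Q xs zs)))"
        by (rule jp3[of "psum a.VW.V.pure xs" "psum a.VW.W.pure ys" "psum a.VW.W.pure zs" "psum a.VW.V.pure (qext V Q xs ys)" _
              "psum a.VW.V.pure (qext V Q xs zs)" "psum a.VW.W.pure (qext W Q' ys (qext V Q xs zs))"])
          (simp_all add: xs ys zs mem q tensors)
    qed (simp_all add: xs ys zs mem)
  next
    fix xs ys zs :: "('a \<times> 'r) list"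
    assume xs: "xs \<in> formal_sums V" and ys: "ys \<in> formal_sums W" and zs: "zs \<in> formal_sums V"
    show "tensor_eq V (text_ext V Q (qext V Q xs ys) ys zs) (text_ext V Q xs (qext W Q' ys xs) zs)"
    proof (subst a.VW.V.psum_pure_eq[symmetric])
      show "psum a.VW.V.pure (text_ext V Q (qext V Q xs ys) ys zs) = psum a.VW.V.pure (text_ext V Q xs (qext W Q' ys xs) zs)"
        using jp2[of "psum a.VW.V.pure xs" "psum a.VW.W.pure ys" "psum a.VW.V.pure zs"
            "psum a.VW.V.pure (qext V Q xs ys)" "psum a.VW.W.pure (qext W Q' ys xs)"]
        by (simp add: xs ys zs mem val q tensors)
    qed (simp_all add: xs ys zs mem)
  qed
qed

section \<open>Abstract pairs with units\<close>

text \<open>\<open>B\<close> is the set of units, \<open>i\<close> and \<open>j\<close> are its inclusions into \<open>V\<^sup>+\<close> and \<open>V\<^sup>-\<close>, here the subgroups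
  \<open>A\<close> and \<open>A'\<close> of ambient groups; \<open>M b\<close> and \<open>M' b\<close> are the two restrictions of the \<open>\<mu>\<close>-map of \<open>b\<close>.\<close>
locale unit_pair =
  fixes B :: "'b set" and neg :: "'b \<Rightarrow> 'b"
    and i :: "'b \<Rightarrow> 'f::ab_group_add" and j :: "'b \<Rightarrow> 'g::ab_group_add"
    and M :: "'b \<Rightarrow> 'g \<Rightarrow> 'f" and M' :: "'b \<Rightarrow> 'f \<Rightarrow> 'g"
    and A :: "'f set" and A' :: "'g set"
  assumes A_zero: "0 \<in> A"
    and A_add: "x \<in> A \<Longrightarrow> x' \<in> A \<Longrightarrow> x + x' \<in> A"
    and A_uminus: "x \<in> A \<Longrightarrow> - x \<in> A"
    and B_ne: "B \<noteq> {}"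
    and neg_B: "b \<in> B \<Longrightarrow> neg b \<in> B"
    and neg_neg: "b \<in> B \<Longrightarrow> neg (neg b) = b"
    and i_A: "b \<in> B \<Longrightarrow> i b \<in> A"
    and i_inj: "inj_on i B"
    and i_neg: "b \<in> B \<Longrightarrow> i (neg b) = - i b"
    and i_nz: "0 \<notin> i ` B"
    and nonunit_add: "x \<in> A \<Longrightarrow> x' \<in> A \<Longrightarrow> x \<notin> i ` B \<Longrightarrow> x' \<notin> i ` B \<Longrightarrow> x + x' \<notin> i ` B"
    and i_2: "b \<in> B \<Longrightarrow> i b + i b \<in> i ` B"
    and i_3: "b \<in> B \<Longrightarrow> i b + i b + i b \<in> i ` B"
    and M_closed: "b \<in> B \<Longrightarrow> y \<in> A' \<Longrightarrow> M b y \<in> A"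
    and M_add: "M b (y + y') = M b y + M b y'"
    and M_M'_neg: "b \<in> B \<Longrightarrow> x \<in> A \<Longrightarrow> M b (M' (neg b) x) = x"
    and M_j: "b \<in> B \<Longrightarrow> M b (j b) = - i b"
    and conj: "a \<in> B \<Longrightarrow> b \<in> B \<Longrightarrow> \<exists>c\<in>B. i c = M a (j b) \<and> j c = M' a (i b) \<and>
       (\<forall>y\<in>A'. M c y = M a (M' (neg b) (M (neg a) y)))"
    and hua: "a \<in> B \<Longrightarrow> b \<in> B \<Longrightarrow> d \<in> B \<Longrightarrow> i d = i a - i b \<Longrightarrow>
       \<exists>c\<in>B. j c = j a - j b \<and> i c = M b (j d) - i b \<and>
         (\<forall>x\<in>A. M' c x = M' a (M (neg d) (M' (neg b) x)))"
    and M_cong: "a \<in> B \<Longrightarrow> b \<in> B \<Longrightarrow> i a - i b \<notin> i ` B \<Longrightarrow> y \<in> A' \<Longrightarrow> M a y - M b y \<notin> i ` B"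
begin

lemma A_diff: "x \<in> A \<Longrightarrow> x' \<in> A \<Longrightarrow> x - x' \<in> A"
  using A_add A_uminus by (metis diff_conv_add_uminus)

lemmas M_lin = M_add additive_zero[of "M b" for b, OF M_add]
  additive_uminus[of "M b" for b, OF M_add] additive_diff[of "M b" for b, OF M_add]

lemma i_eq: "a \<in> B \<Longrightarrow> b \<in> B \<Longrightarrow> i a = i b \<longleftrightarrow> a = b"
  using i_inj by (auto dest: inj_onD)

lemma unit_uminus: "x \<in> i ` B \<Longrightarrow> - x \<in> i ` B"
  using i_neg neg_B by (auto simp flip: i_neg)

lemma unit_uminus_iff: "- x \<in> i ` B \<longleftrightarrow> x \<in> i ` B"
  using unit_uminus[of x] unit_uminus[of "- x"] by auto

lemma nonunit_diff:
  "x \<in> A \<Longrightarrow> x' \<in> A \<Longrightarrow> x \<notin> i ` B \<Longrightarrow> x' \<notin> i ` B \<Longrightarrow> x - x' \<notin> i ` B"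
  using nonunit_add[of x "- x'"] A_uminus unit_uminus_iff by simp

lemma unit_add_nonunit: "b \<in> B \<Longrightarrow> x \<in> A \<Longrightarrow> x \<notin> i ` B \<Longrightarrow> i b + x \<in> i ` B"
  using nonunit_diff[of "i b + x" x] A_add i_A by auto

text \<open>If \<open>b + c\<close> is not a unit, then \<open>2b + c\<close> is one, being the unit
  \<open>b\<close> plus a non-unit; so \<open>f\<close> vanishes at \<open>2b\<close>, and torsion
  gives \<open>b\<close>. A non-unit \<open>x\<close> is the difference of the units
  \<open>c + x\<close> and \<open>c\<close>. This serves to use (J4), which requires the sum to be a
  unit.\<close>

lemma additive_zero_on:
  fixes f :: "'f \<Rightarrow> 'h::ab_group_add"
  assumes add: "\<And>x x'. x \<in> A \<Longrightarrow> x' \<in> A \<Longrightarrow> f (x + x') = f x + f x'"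
    and tor: "\<And>x. x \<in> A \<Longrightarrow> f x + f x = 0 \<Longrightarrow> f x = 0"
    and c: "c \<in> B"
    and unit: "\<And>a b. a \<in> B \<Longrightarrow> b \<in> B \<Longrightarrow> i b + i c = i a \<Longrightarrow> f (i b) = 0"
    and x: "x \<in> A"
  shows "f x = 0"
proof -
  have *: "f (i b) = 0" if b: "b \<in> B" for b
  proof (cases "i b + i c \<in> i ` B")
    case True
    then show ?thesis using unit b by auto
  next
    case False
    obtain d where d: "d \<in> B" "i d = i b + i b" using i_2[OF b] by auto
    have "i d + i c = i b + (i b + i c)" by (simp add: d add.assoc)
    also have "\<dots> \<in> i ` B" using False b c by (intro unit_add_nonunit A_add i_A)
    finally obtain a where "a \<in> B" "i d + i c = i a" by auto
    then have "f (i d) = 0" using d by (intro unit[of a d])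
    then show ?thesis using tor[of "i b"] add b i_A d by simp
  qed
  show ?thesis
  proof (cases "x \<in> i ` B")
    case True
    then show ?thesis using * by auto
  next
    case False
    then obtain a where "a \<in> B" "i a = i c + x" using unit_add_nonunit[OF c x] by auto
    then show ?thesis using *[of a] *[OF c] add[OF i_A[OF c] x] by simp
  qed
qed

lemma additive_zero_on_units:
  fixes f :: "'f \<Rightarrow> 'h::ab_group_add"
  assumes add: "\<And>x x'. x \<in> A \<Longrightarrow> x' \<in> A \<Longrightarrow> f (x + x') = f x + f x'"
    and unit: "\<And>b. b \<in> B \<Longrightarrow> f (i b) = 0"
    and x: "x \<in> A"
  shows "f x = 0"
proof -
  obtain c where c: "c \<in> B" using B_ne by auto
  show ?thesis
  proof (cases "x \<in> i ` B")
    case False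
    then obtain a where "a \<in> B" "i a = i c + x" using unit_add_nonunit[OF c x] by auto
    then show ?thesis using unit[of a] unit[OF c] add[OF i_A[OF c] x] by simp
  qed (use unit in auto)
qed

lemma biadditive_zero_on:
  fixes f :: "'f \<Rightarrow> 'f \<Rightarrow> 'h::ab_group_add"
  assumes add1: "\<And>x x' z. x \<in> A \<Longrightarrow> x' \<in> A \<Longrightarrow> z \<in> A \<Longrightarrow> f (x + x') z = f x z + f x' z"
    and add2: "\<And>x z z'. x \<in> A \<Longrightarrow> z \<in> A \<Longrightarrow> z' \<in> A \<Longrightarrow> f x (z + z') = f x z + f x z'"
    and tor: "\<And>x z. x \<in> A \<Longrightarrow> z \<in> A \<Longrightarrow> f x z + f x z = 0 \<Longrightarrow> f x z = 0"
    and unit: "\<And>a b c. a \<in> B \<Longrightarrow> b \<in> B \<Longrightarrow> c \<in> B \<Longrightarrow> i b + i c = i a \<Longrightarrow> f (i b) (i c) = 0"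
    and x: "x \<in> A" and z: "z \<in> A"
  shows "f x z = 0"
proof (rule additive_zero_on_units[where f = "f x"])
  fix c assume c: "c \<in> B"
  show "f x (i c) = 0"
    by (rule additive_zero_on[where f = "\<lambda>x. f x (i c)", OF _ _ c])
      (use add1 i_A tor unit c x in auto)
qed (use add2 x z in auto)

end

text \<open>Exchanging \<open>0\<close> and \<open>\<infinity>\<close> inverts the \<open>\<mu>\<close>-maps, whence the sign in the opposite pair; it is only
  after the proof that \<open>\<mu>\<close>-maps are involutions that it can be dropped.\<close>
locale two_sided_unit_pair = unit_pair B neg i j M M' A A' + dual: unit_pair B neg j i "\<lambda>b. M' (neg b)" "\<lambda>b. M (neg b)" A' A
  for B neg i j M M' A A'
begin

lemma dual_M'_closed: "b \<in> B \<Longrightarrow> x \<in> A \<Longrightarrow> M' b x \<in> A'"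
  using dual.M_closed[of "neg b"] by (simp add: neg_B neg_neg)

text \<open>The Hua relation at \<open>2b\<close> and \<open>b\<close>, whose difference is
  \<open>b\<close>, yields an element with first coordinate \<open>-2b\<close>, hence
  \<open>neg a\<close>. Its other coordinate is \<open>j a - j b\<close>.\<close>

lemma double_halves:
  assumes b: "b \<in> B" and a: "a \<in> B" "i a = i b + i b"
  shows "j a + j a = j b"
proof -
  obtain c where c: "c \<in> B" "j c = j a - j b" "i c = M b (j b) - i b"
    using hua[OF a(1) b b] a by auto
  then have "i c = i (neg a)" using M_j[OF b] i_neg[OF a(1)] a by simp
  then have "c = neg a" using i_eq[of c "neg a"] c a neg_B by blast
  then have "- j a = j a - j b" using c(2) dual.i_neg a by simp
  then show ?thesis by (simp add: algebra_simps)
qed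

text \<open>The Hua relation at \<open>3b\<close> and \<open>b\<close> has difference
  \<open>2b\<close>. By \<open>double_halves\<close>, twice the resulting \<open>c\<close> is
  \<open>neg a\<close>; applying that lemma to \<open>c\<close> compares the coordinates in the
  opposite group.\<close>

lemma triple_thirds:
  assumes b: "b \<in> B" and a: "a \<in> B" "i a = i b + i b + i b"
  shows "j a + j a + j a = j b"
proof -
  obtain d where d: "d \<in> B" "i d = i b + i b" using i_2[OF b] by auto
  obtain c where c: "c \<in> B" "j c = j a - j b" "i c = M b (j d) - i b"
    using hua[OF a(1) b d(1)] a d by auto
  have "M b (j d) + M b (j d) = - i b"
    using double_halves[OF b d] M_j[OF b] by (simp flip: M_add)
  moreover have "i c + i c = (M b (j d) + M b (j d)) - (i b + i b)"
    by (simp add: c)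
  ultimately have "i c + i c = i (neg a)"
    using a by (simp add: i_neg)
  then have "j (neg a) + j (neg a) = j c"
    using double_halves[of c "neg a"] c a neg_B by simp
  then show ?thesis
    using a by (simp add: dual.i_neg c(2) algebra_simps)
qed

text \<open>Used for a non-unit torsion element \<open>x\<close>: then \<open>b\<close> and
  \<open>b + x\<close> have the same double or triple, which determines \<open>j\<close> of both, so
  they coincide.\<close>

lemma tor_aux:
  assumes b: "b \<in> B" and x: "x \<in> A" "x \<notin> i ` B"
    and eq: "\<And>b'. b' \<in> B \<Longrightarrow> i b' = i b + x \<Longrightarrow> j b' = j b"
  shows "x = 0"
proof -
  obtain b' where b': "b' \<in> B" "i b' = i b + x"
    using unit_add_nonunit[OF b x] by auto
  then have "b' = b" using dual.i_eq[of b' b] eq b by simp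
  then show ?thesis using b' by simp
qed

lemma tor2:
  assumes x: "x \<in> A" "x + x = 0"
  shows "x = 0"
proof (cases "x \<in> i ` B")
  case True
  then have "x + x \<in> i ` B" using i_2 by auto
  then show ?thesis using i_nz assms by simp
next
  case False
  obtain b where b: "b \<in> B" using B_ne by auto
  obtain a where a: "a \<in> B" "i a = i b + i b" using i_2[OF b] by auto
  show ?thesis
  proof (rule tor_aux[OF b x(1) False])
    fix b' assume b': "b' \<in> B" "i b' = i b + x"
    have "i b' + i b' = i a + (x + x)" by (simp add: a b' algebra_simps)
    then show "j b' = j b"
      using double_halves[OF b a] double_halves[OF b'(1) a(1)] x by simp
  qed
qed

lemma tor3:
  assumes x: "x \<in> A" "x + x + x = 0"
  shows "x = 0"
proof (cases "x \<in> i ` B")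
  case True
  then have "x + x + x \<in> i ` B" using i_3 by auto
  then show ?thesis using i_nz assms by simp
next
  case False
  obtain b where b: "b \<in> B" using B_ne by auto
  obtain a where a: "a \<in> B" "i a = i b + i b + i b" using i_3[OF b] by auto
  show ?thesis
  proof (rule tor_aux[OF b x(1) False])
    fix b' assume b': "b' \<in> B" "i b' = i b + x"
    have "i b' + i b' + i b' = i a + (x + x + x)" by (simp add: a b' algebra_simps)
    then show "j b' = j b"
      using triple_thirds[OF b a] triple_thirds[OF b'(1) a(1)] x by simp
  qed
qed

text \<open>Division is obtained on the opposite side, where a multiple of a unit \<open>b\<close>
  becomes a quotient of \<open>b\<close>. A non-unit is a difference of two units.\<close>

lemma divisible_dual:
  assumes add: "\<And>u v. n (u - v) = n u - n v"
    and unit: "\<And>b. b \<in> B \<Longrightarrow> \<exists>a\<in>B. n (j a) = j b"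
    and y: "y \<in> A'"
  shows "\<exists>h\<in>A'. n h = y"
proof (cases "y \<in> j ` B")
  case True
  then show ?thesis using unit dual.i_A by auto
next
  case False
  obtain b where b: "b \<in> B" using B_ne by auto
  obtain b' where b': "b' \<in> B" "j b' = j b + y"
    using dual.unit_add_nonunit[OF b y False] by auto
  obtain a a' where a: "a \<in> B" "n (j a) = j b" "a' \<in> B" "n (j a') = j b'"
    using unit b b'(1) by meson
  then have "n (j a' - j a) = y" by (simp add: add b')
  then show ?thesis using dual.A_diff[OF dual.i_A[OF a(3)] dual.i_A[OF a(1)]] by blast
qed

lemma div2_dual: "y \<in> A' \<Longrightarrow> \<exists>h\<in>A'. h + h = y"
  by (rule divisible_dual[where n = "\<lambda>h. h + h"]) (use i_2 double_halves in fastforce)+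

lemma div3_dual: "y \<in> A' \<Longrightarrow> \<exists>h\<in>A'. h + h + h = y"
  by (rule divisible_dual[where n = "\<lambda>h. h + h + h"]) (use i_3 triple_thirds in fastforce)+

end

lemma (in two_sided_unit_pair) swap: "two_sided_unit_pair B neg j i (\<lambda>b. M' (neg b)) (\<lambda>b. M (neg b)) A' A"
proof -
  have "unit_pair B neg i j (\<lambda>b. M (neg (neg b))) (\<lambda>b. M' (neg (neg b))) A A'"
    using unit_pair_axioms unfolding unit_pair_def by (simp add: neg_neg neg_B Ball_def)
  then show ?thesis
    by (intro two_sided_unit_pair.intro dual.unit_pair_axioms)
qed

text \<open>\<open>T x y z\<close> is the value at \<open>y\<close> of the extension of \<open>\<mu>\<^bsub>x,z\<^esub>\<close>.\<close>
locale triple_pair = two_sided_unit_pair B neg i j M M' A A' + trilinear T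
  for B neg i j M M' A A' T +
  assumes T_closed: "x \<in> A \<Longrightarrow> y \<in> A' \<Longrightarrow> z \<in> A \<Longrightarrow> T x y z \<in> A"
    and T_ext: "a \<in> B \<Longrightarrow> b \<in> B \<Longrightarrow> c \<in> B \<Longrightarrow> i a + i b = i c \<Longrightarrow> y \<in> A' \<Longrightarrow>
      T (i a) y (i b) = M c y - M a y - M b y"
begin

lemma T_self:
  assumes c: "c \<in> B" and x: "x \<in> A"
  shows "T x (j c) (i c) = - (x + x)"
proof -
  have "T x (j c) (i c) + (x + x) = 0"
  proof (rule additive_zero_on[where f = "\<lambda>x. T x (j c) (i c) + (x + x)", OF _ _ c _ x])
    fix a b assume a: "a \<in> B" and b: "b \<in> B" and eq: "i b + i c = i a"
    \<comment> \<open>The Hua relation for \<open>(a, b)\<close> and for \<open>(b, a)\<close> gives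
      elements that are negatives of each other in \<open>V^-\<close>, hence in \<open>V^+\<close>
      too; comparing them evaluates \<open>M a (j c) - M b (j c)\<close>.\<close>
    obtain c1 where c1: "c1 \<in> B" "j c1 = j a - j b" "i c1 = M b (j c) - i b"
      using hua[OF a b c] eq by (auto simp: algebra_simps)
    obtain c2 where c2: "c2 \<in> B" "j c2 = j b - j a" "i c2 = M a (j (neg c)) - i a"
      using hua[OF b a neg_B[OF c]] eq i_neg[OF c] by (auto simp: algebra_simps)
    have "j c2 = j (neg c1)" using c1 c2 by (simp add: dual.i_neg)
    then have "c2 = neg c1" using dual.i_eq c1 c2 neg_B by blast
    then have "- M a (j c) - i a = - (M b (j c) - i b)"
      using c1 c2 by (simp add: i_neg dual.i_neg c M_lin)
    then have *: "M a (j c) - M b (j c) = - i a - i b"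
      by (simp add: algebra_simps)
    have "T (i b) (j c) (i c) = M a (j c) - M b (j c) - M c (j c)"
      by (rule T_ext) (use a b c eq dual.i_A in auto)
    also have "\<dots> = - (i b + i b)"
      by (simp add: * M_j[OF c] eq[symmetric])
    finally show "T (i b) (j c) (i c) + (i b + i b) = 0" by (rule eq_neg_iff_add_eq_0[THEN iffD1])
  next
    fix x assume x: "x \<in> A" and eq: "T x (j c) (i c) + (x + x) + (T x (j c) (i c) + (x + x)) = 0"
    show "T x (j c) (i c) + (x + x) = 0"
      by (rule tor2[OF _ eq]) (intro A_add T_closed i_A dual.i_A c x)
  qed (simp add: T_add1 algebra_simps)
  then show ?thesis by (simp only: eq_neg_iff_add_eq_0)
qed

lemma T_sym:
  assumes "x \<in> A" "y \<in> A'" "z \<in> A"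
  shows "T x y z = T z y x"
proof -
  have "T x y z - T z y x = 0"
  proof (rule biadditive_zero_on[where f = "\<lambda>x z. T x y z - T z y x", OF _ _ _ _ assms(1,3)])
    fix a b c assume abc: "a \<in> B" "b \<in> B" "c \<in> B" and eq: "i b + i c = i a"
    then have eq': "i c + i b = i a" by (simp add: add.commute)
    show "T (i b) y (i c) - T (i c) y (i b) = 0"
      using T_ext[OF abc(2,3,1) eq assms(2)] T_ext[OF abc(3,2,1) eq' assms(2)] by simp
  next
    fix x z assume "x \<in> A" "z \<in> A" "T x y z - T z y x + (T x y z - T z y x) = 0"
    then show "T x y z - T z y x = 0"
      using tor2[of "T x y z - T z y x"] T_closed A_diff assms by simp
  qed (simp_all add: T_add algebra_simps)
  then show ?thesis by simp
qed

text \<open>Each map from \<open>A\<close> to \<open>A'\<close> becomes a conjugate, under one fixed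
  unit \<open>e\<close>, of a map from \<open>A'\<close> to \<open>A\<close>. Thus the triple
  product \<open>T\<close> of one side suffices in \<open>involution\<close>.\<close>

lemma conj_inv:
  assumes e: "e \<in> B" and b: "b \<in> B"
  shows "\<exists>c\<in>B. i c = M (neg e) (j b) \<and> (\<forall>x\<in>A. M' b x = M' e (M (neg c) (M' (neg e) x)))"
proof -
  obtain c where c: "c \<in> B" "i c = M (neg e) (j b)"
    using dual.conj[OF e b] by auto
  obtain b' where b': "b' \<in> B" "j b' = M' e (i (neg c))"
    "\<forall>x\<in>A. M' (neg b') x = M' e (M (neg c) (M' (neg e) x))"
    using dual.conj[OF neg_B[OF e] neg_B[OF c(1)]] e c by (auto simp: neg_neg)
  have "j b' = - M' e (M (neg e) (j b))"
    using b'(2) c i_neg dual.M_lin[of "neg e"] e by (simp add: neg_neg)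
  also have "\<dots> = j (neg b)"
    using dual.M_M'_neg[OF neg_B[OF e] dual.i_A[OF b]] e b by (simp add: neg_neg dual.i_neg)
  finally have "b' = neg b" using dual.i_eq b' b neg_B by blast
  then show ?thesis using b' c b by (auto simp: neg_neg)
qed

theorem involution:
  assumes a: "a \<in> B" and x: "x \<in> A"
  shows "M' (neg a) x = M' a x"
proof -
  obtain e where e: "e \<in> B" using B_ne by auto
  \<comment> \<open>\<open>T\<close> transported to the opposite side by \<open>e\<close>; by
    \<open>conj_inv\<close> it extends the differences of the maps \<open>M'\<close>.\<close>
  define S where "S y x w = M' e (T (M (neg e) y) (M' (neg e) x) (M (neg e) w))" for y x w
  have M'e: "M' e (u + v) = M' e u + M' e v" "M' e (- u) = - M' e u"  "M' e (u - v) = M' e u - M' e v" for u v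
    using dual.M_lin[of "neg e"] e by (simp_all add: neg_neg)
  have M'a: "M' a (u + v) = M' a u + M' a v" "M' a (- u) = - M' a u"  "M' a (u - v) = M' a u - M' a v" if "a \<in> B" for a u v
    using dual.M_lin[of "neg a"] that by (simp_all add: neg_neg)
  have S_ext: "S (j a) x (j b) = M' c x - M' a x - M' b x"
    if abc: "a \<in> B" "b \<in> B" "c \<in> B" "j a + j b = j c" and x: "x \<in> A" for a b c x
  proof -
    obtain a0 where a0: "a0 \<in> B" "i a0 = M (neg e) (j a)" "M' a x = M' e (M (neg a0) (M' (neg e) x))"
      using conj_inv[OF e abc(1)] x by auto
    obtain b0 where b0: "b0 \<in> B" "i b0 = M (neg e) (j b)" "M' b x = M' e (M (neg b0) (M' (neg e) x))"
      using conj_inv[OF e abc(2)] x by auto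
    obtain c0 where c0: "c0 \<in> B" "i c0 = M (neg e) (j c)" "M' c x = M' e (M (neg c0) (M' (neg e) x))"
      using conj_inv[OF e abc(3)] x by auto
    have "i c0 = i a0 + i b0"
      by (simp only: a0(2) b0(2) c0(2) M_add abc(4)[symmetric])
    then have "i (neg a0) + i (neg b0) = i (neg c0)"
      using a0(1) b0(1) c0(1) by (simp add: i_neg)
    then have "T (i (neg a0)) (M' (neg e) x) (i (neg b0))
       = M (neg c0) (M' (neg e) x) - M (neg a0) (M' (neg e) x) - M (neg b0) (M' (neg e) x)"
      using a0 b0 c0 neg_B dual.M_closed[OF e x] by (intro T_ext) auto
    then show ?thesis
      unfolding S_def a0(2)[symmetric] b0(2)[symmetric] a0(3) b0(3) c0(3)
      using a0(1) b0(1) by (simp add: i_neg T_lin M'e)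
  qed
  \<comment> \<open>The Hua relation expresses \<open>M' c\<close> through \<open>M (neg d)\<close>,
    and \<open>-d = b - a\<close> lets \<open>T_ext\<close> expand the latter.\<close>
  have E: "S (j a) x (j b) = M' a (T (i b) (M' (neg b) x) (i a))"
    if abd: "a \<in> B" "b \<in> B" "i a - i b \<in> i ` B" and x: "x \<in> A" for a b x
  proof -
    obtain d where d: "d \<in> B" "i d = i a - i b" using abd by auto
    obtain c where c: "c \<in> B" "j c = j a - j b" "M' c x = M' a (M (neg d) (M' (neg b) x))"
      using hua[OF abd(1,2) d] x by auto
    let ?y = "M' (neg b) x"
    have y: "?y \<in> A'" using dual.M_closed abd x by auto
    have "T (i b) ?y (i (neg a)) = M (neg d) ?y - M b ?y - M (neg a) ?y"
      by (rule T_ext) (use abd d y in \<open>auto simp: neg_B i_neg\<close>)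
    then have "M (neg d) ?y = x + M (neg a) ?y - T (i b) ?y (i a)"
      using abd(1) M_M'_neg[OF abd(2) x] by (simp add: i_neg T_lin algebra_simps)
    then have "M' c x = M' a x + M' a (M (neg a) ?y) - M' a (T (i b) ?y (i a))"
      using c M'a abd(1) by simp
    also have "M' a (M (neg a) ?y) = ?y"
      using dual.M_M'_neg[OF neg_B[OF abd(1)] y] by (simp add: neg_neg abd)
    finally have *: "M' c x - M' a x - M' (neg b) x = - M' a (T (i b) ?y (i a))"
      by simp
    have "S (j a) x (j (neg b)) = - M' a (T (i b) ?y (i a))"
      unfolding *[symmetric] by (rule S_ext) (use abd c x neg_B dual.i_neg in auto)
    then show ?thesis
      by (simp add: S_def dual.i_neg abd M_lin T_lin M'e)
  qed
  \<comment> \<open>Compare \<open>E\<close> at \<open>a\<close> and at \<open>neg a\<close>: both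
    \<open>S\<close> and \<open>T\<close> are odd in this entry, so what remains is
    \<open>M' a\<close> against \<open>M' (neg a)\<close>.\<close>
  have Z: "M' a (T z y (i a)) - M' (neg a) (T z y (i a)) = 0" if y: "y \<in> A'" and z: "z \<in> A" for y z
  proof -
    note M'n = dual.M_lin[of a]
    have both: "M' a (T (i b) y (i a)) - M' (neg a) (T (i b) y (i a)) = 0"
      if b: "b \<in> B" "i b + i a \<in> i ` B" "i b - i a \<in> i ` B" for b
    proof -
      define x where "x = M b y"
      have x: "x \<in> A" "M' (neg b) x = y"
        using dual.M_M'_neg[OF b(1) y] M_closed b y by (simp_all add: x_def neg_neg)
      have "i a - i b \<in> i ` B" using unit_uminus[OF b(3)] by simp
      then have 1: "S (j a) x (j b) = M' a (T (i b) y (i a))"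
        using E[OF a b(1) _ x(1)] x by simp
      have "i (neg a) - i b \<in> i ` B" using unit_uminus[OF b(2)] a by (simp add: i_neg algebra_simps)
      then have "S (j (neg a)) x (j b) = M' (neg a) (T (i b) y (i (neg a)))"
        using E[OF neg_B[OF a] b(1) _ x(1)] x by simp
      then have "S (j a) x (j b) = M' (neg a) (T (i b) y (i a))"
        by (simp add: S_def dual.i_neg i_neg a M_lin T_lin M'e M'n)
      then show ?thesis using 1 by simp
    qed
    have tor: "M' a (T z y (i a)) - M' (neg a) (T z y (i a)) = 0"
      if "z \<in> A" "M' a (T z y (i a)) - M' (neg a) (T z y (i a)) +
          (M' a (T z y (i a)) - M' (neg a) (T z y (i a))) = 0" for z
    proof -
      interpret sw: two_sided_unit_pair B neg j i "\<lambda>b. M' (neg b)" "\<lambda>b. M (neg b)" A' A by (rule swap)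
      show ?thesis
        by (rule sw.tor2[OF _ that(2)])
          (intro dual.A_diff dual_M'_closed T_closed a neg_B i_A y that(1))
    qed
    show ?thesis
    proof (rule additive_zero_on[where f = "\<lambda>z. M' a (T z y (i a)) - M' (neg a) (T z y (i a))", OF _ tor a _ z])
      fix b d assume b: "b \<in> B" and "d \<in> B" "i b + i a = i d"
      then have plus: "i b + i a \<in> i ` B" by auto
      show "M' a (T (i b) y (i a)) - M' (neg a) (T (i b) y (i a)) = 0"
      proof (cases "i b - i a \<in> i ` B")
        case False
        \<comment> \<open>Here \<open>b = a + n\<close> with a non-unit \<open>n\<close>. Doubling
          \<open>b\<close> helps: \<open>2b + a = 3a + 2n\<close> and \<open>2b - a = a + 2n\<close>
          are units, and torsion leads back to \<open>b\<close>.\<close>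
        let ?n = "i b - i a"
        have nA: "?n \<in> A" by (intro A_diff i_A a b)
        have n: "?n + ?n \<in> A" "?n + ?n \<notin> i ` B"
          by (rule A_add[OF nA nA], rule nonunit_add[OF nA nA False False])
        obtain d where d: "d \<in> B" "i d = i b + i b" using i_2[OF b] by auto
        obtain a3 where a3: "a3 \<in> B" "i a3 = i a + i a + i a" using i_3[OF a] by auto
        have "i d + i a = i a3 + (?n + ?n)" "i d - i a = i a + (?n + ?n)"
          by (simp_all add: a3 d algebra_simps)
        then have "i d + i a \<in> i ` B" "i d - i a \<in> i ` B"
          using unit_add_nonunit[OF a n] unit_add_nonunit[OF a3(1) n] by (simp_all only:)
        then show ?thesis
          using both[OF d(1)] d
          by (intro tor[OF i_A[OF b]]) (simp add: T_lin M'a[OF a] M'n algebra_simps)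
      qed (use both b plus in blast)
    qed (simp add: T_lin M'a[OF a] M'n algebra_simps)
  qed
  \<comment> \<open>As \<open>{x a a} = -2x\<close>, the case \<open>y = j a\<close> of
    \<open>Z\<close> says that the two maps agree on \<open>2x\<close>.\<close>
  have "M' a (T x (j a) (i a)) = M' (neg a) (T x (j a) (i a))"
    using Z[OF dual.i_A[OF a] x] by simp
  then have *: "(M' a x - M' (neg a) x) + (M' a x - M' (neg a) x) = 0"
    using dual.M_lin[of a] by (simp add: T_self[OF a x] M'a[OF a] algebra_simps)
  interpret sw: two_sided_unit_pair B neg j i "\<lambda>b. M' (neg b)" "\<lambda>b. M (neg b)" A' A by (rule swap)
  have "M' a x - M' (neg a) x = 0"
    by (rule sw.tor2[OF _ *]) (intro dual.A_diff dual_M'_closed a neg_B x)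
  then show ?thesis by simp
qed

end

section \<open>Halving and separation of degrees\<close>

definition halve :: "'x::ab_group_add set \<Rightarrow> 'x \<Rightarrow> 'x" where
  "halve A a = (SOME h. h \<in> A \<and> h + h = a)"

lemma tor2_eq:
  fixes A :: "'x::ab_group_add set"
  assumes "\<And>x. x \<in> A \<Longrightarrow> x + x = 0 \<Longrightarrow> x = 0" and "h - h' \<in> A" and "h + h = h' + h'"
  shows "h = h'"
proof -
  have "(h - h') + (h - h') = 0" using assms(3) by (simp add: algebra_simps)
  then have "h - h' = 0" using assms by blast
  then show ?thesis by simp
qed

text \<open>The equations are the values at 1, -1, 2, -2 of a quartic with coefficients
  \<open>a0\<close> to \<open>a4\<close>. Differences leave the odd part: \<open>a1 + a3 = 0\<close>
  and \<open>a1 + 4 a3 = 0\<close> after cancelling 2, hence \<open>3 a3 = 0\<close>. The even terms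
  cancel whatever they are, so at 2 they are just called \<open>b0\<close>, \<open>b2\<close>,
  \<open>b4\<close>.\<close>

lemma quartic_linear_coeff:
  fixes A :: "'x::ab_group_add set"
  assumes tor2: "\<And>x. x \<in> A \<Longrightarrow> x + x = 0 \<Longrightarrow> x = 0"
    and tor3: "\<And>x. x \<in> A \<Longrightarrow> x + x + x = 0 \<Longrightarrow> x = 0"
    and add: "\<And>x y. x \<in> A \<Longrightarrow> y \<in> A \<Longrightarrow> x + y \<in> A"
    and a1: "a1 \<in> A" and a3: "a3 \<in> A"
    and e1: "a0 + a1 + a2 + a3 + a4 = 0"
    and e2: "a0 - a1 + a2 - a3 + a4 = 0"
    and e3: "b0 + (a1 + a1) + b2 + ((a3 + a3 + (a3 + a3)) + (a3 + a3 + (a3 + a3))) + b4 = 0"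
    and e4: "b0 - (a1 + a1) + b2 - ((a3 + a3 + (a3 + a3)) + (a3 + a3 + (a3 + a3))) + b4 = 0"
  shows "a1 = 0"
proof -
  have "(a1 + a3) + (a1 + a3) = (a0 + a1 + a2 + a3 + a4) - (a0 - a1 + a2 - a3 + a4)"
    by (simp add: algebra_simps)
  then have 13: "a1 + a3 = 0"
    using tor2[of "a1 + a3"] add a1 a3 e1 e2 by simp
  let ?s = "(a1 + a3) + (a3 + a3 + a3)"
  have s: "?s \<in> A" using add a1 a3 by simp
  have "(?s + ?s) + (?s + ?s)
      = (b0 + (a1 + a1) + b2 + ((a3 + a3 + (a3 + a3)) + (a3 + a3 + (a3 + a3))) + b4)
      - (b0 - (a1 + a1) + b2 - ((a3 + a3 + (a3 + a3)) + (a3 + a3 + (a3 + a3))) + b4)"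
    by (simp add: algebra_simps)
  also have "\<dots> = 0"
    unfolding e3 e4 by simp
  finally have "?s + ?s = 0"
    using tor2[of "?s + ?s"] add s by simp
  then have "?s = 0"
    using tor2[of ?s] s by simp
  then have "a3 + a3 + a3 = 0" using 13 by simp
  then show ?thesis using tor3[OF a3] 13 by simp
qed

section \<open>Involutive pairs and the fundamental formula\<close>

locale involutive_pair = triple_pair B neg i j M M' A A' T + op: triple_pair B neg j i M' M A' A T'
  for B neg i j M M' A A'
    and T :: "'f::ab_group_add \<Rightarrow> 'g::ab_group_add \<Rightarrow> 'f \<Rightarrow> 'f" and T' +
  assumes M_neg: "b \<in> B \<Longrightarrow> M (neg b) = M b" and M'_neg: "b \<in> B \<Longrightarrow> M' (neg b) = M' b"

text \<open>From here on every fact has a mirror image: \<open>flip\<close> refers to it, while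
  \<open>op\<close> gives access to the facts of the weaker locale
  \<open>triple_pair\<close>.\<close>

sublocale involutive_pair \<subseteq> flip: involutive_pair B neg j i M' M A' A T' T
  by unfold_locales (simp_all add: M_neg M'_neg)

context involutive_pair
begin

lemma M_M': "b \<in> B \<Longrightarrow> x \<in> A \<Longrightarrow> M b (M' b x) = x"
  using M_M'_neg[of b x] by (simp add: M'_neg)

lemma halve_ex: "a \<in> A \<Longrightarrow> \<exists>h. h \<in> A \<and> h + h = a"
  using op.div2_dual by blast

lemma halve_A: "a \<in> A \<Longrightarrow> halve A a \<in> A"
  and halve_double: "a \<in> A \<Longrightarrow> halve A a + halve A a = a"
  using someI_ex[OF halve_ex] unfolding halve_def by auto

lemma cancel2: "h \<in> A \<Longrightarrow> h' \<in> A \<Longrightarrow> h + h = h' + h' \<Longrightarrow> h = h'"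
  by (rule tor2_eq[OF tor2 A_diff])

lemma halve_eq: "h \<in> A \<Longrightarrow> h + h = a \<Longrightarrow> halve A a = h"
  using cancel2[of "halve A a" h] halve_A[of a] halve_double[of a] A_add by metis

lemma halve_add: "a \<in> A \<Longrightarrow> a' \<in> A \<Longrightarrow> halve A (a + a') = halve A a + halve A a'"
  by (rule halve_eq) (simp_all add: A_add halve_A algebra_simps, simp add: halve_double flip: add.assoc)

text \<open>\<open>T_ext\<close> covers both \<open>{b y b}\<close> and \<open>{b y (-2b)}\<close>.
  As \<open>\<mu>\<close>-maps are even, the second says that \<open>M\<close> at \<open>2b\<close>
  is twice \<open>{b y b}\<close>, and the first becomes an equation for \<open>{b y b}\<close>
  alone.\<close>

lemma T_unit:
  assumes b: "b \<in> B" and y: "y \<in> A'"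
  shows "T (i b) y (i b) = M b y + M b y"
proof -
  obtain a where a: "a \<in> B" "i a = i b + i b" using i_2[OF b] by auto
  have "T (i b) y (i (neg a)) = M (neg b) y - M b y - M (neg a) y"
    using a b y by (intro T_ext) (auto simp: neg_B i_neg)
  then have 1: "M a y = T (i b) y (i b) + T (i b) y (i b)"
    using a b by (simp add: i_neg T_lin M_neg algebra_simps)
  have "T (i b) y (i b) = M a y - M b y - M b y"
    using a b y by (intro T_ext) auto
  then have "T (i b) y (i b) = T (i b) y (i b) + T (i b) y (i b) - M b y - M b y"
    by (simp only: 1)
  then have "T (i b) y (i b) + 0 = T (i b) y (i b) + (T (i b) y (i b) - (M b y + M b y))"
    by (simp only: diff_diff_add add_diff_eq add_0_right)
  then show ?thesis by (simp only: add_left_cancel) simp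
qed

text \<open>Follows by comparing \<open>T_unit\<close> at the two units. Unlike
  \<open>T_ext\<close>, this second-order expansion allows a non-unit increment
  \<open>z\<close>.\<close>

lemma M_shift:
  assumes b: "b \<in> B" "b' \<in> B" "i b' = i b + z" and z: "z \<in> A" and y: "y \<in> A'"
  shows "M b' y = M b y + T (i b) y z + halve A (T z y z)"
proof (rule cancel2)
  have "M b' y + M b' y = (M b y + M b y) + (T (i b) y z + T z y (i b)) + T z y z"
    using T_unit[OF b(1) y] T_unit[OF b(2) y] b(3) by (simp add: T_lin algebra_simps)
  also have "\<dots> = (M b y + M b y) + (T (i b) y z + T (i b) y z) + (halve A (T z y z) + halve A (T z y z))"
    using T_sym[OF z y i_A[OF b(1)]] halve_double[OF T_closed[OF z y z]] by simp
  finally show "M b' y + M b' y = (M b y + T (i b) y z + halve A (T z y z))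
      + (M b y + T (i b) y z + halve A (T z y z))"
    by (simp add: algebra_simps)
qed (intro A_add M_closed T_closed halve_A i_A b z y)+

text \<open>The conjugation rule, by which \<open>M\<close> at the unit \<open>M b (j a)\<close> is
  \<open>M b\<close> after \<open>M' a\<close> after \<open>M b\<close>, polarized in
  \<open>a\<close>.\<close>

lemma T_M_M:
  assumes b: "b \<in> B" and y: "y \<in> A'" and w: "w \<in> A'" and u: "u \<in> A'"
  shows "T (M b y) u (M b w) = M b (T' y (M b u) w)"
proof -
  have "T (M b y) u (M b w) - M b (T' y (M b u) w) = 0"
  proof (rule op.biadditive_zero_on[where f = "\<lambda>y w. T (M b y) u (M b w) - M b (T' y (M b u) w)",
        OF _ _ _ _ y w])
    fix a c d assume acd: "d \<in> B" "a \<in> B" "c \<in> B" and eq: "j a + j c = j d"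
    obtain a' where a': "a' \<in> B" "i a' = M b (j a)" "M a' u = M b (M' a (M b u))"
      using conj[OF b acd(2)] u b acd(2) by (auto simp: M_neg M'_neg)
    obtain c' where c': "c' \<in> B" "i c' = M b (j c)" "M c' u = M b (M' c (M b u))"
      using conj[OF b acd(3)] u b acd(3) by (auto simp: M_neg M'_neg)
    obtain d' where d': "d' \<in> B" "i d' = M b (j d)" "M d' u = M b (M' d (M b u))"
      using conj[OF b acd(1)] u b acd(1) by (auto simp: M_neg M'_neg)
    have "i a' + i c' = i d'"
      unfolding a'(2) c'(2) d'(2) eq[symmetric] M_add ..
    then have "T (i a') u (i c') = M d' u - M a' u - M c' u"
      using a' c' d' u by (intro T_ext) auto
    moreover have "T' (j a) (M b u) (j c) = M' d (M b u) - M' a (M b u) - M' c (M b u)"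
      by (intro op.T_ext acd eq M_closed b u)
    ultimately show "T (M b (j a)) u (M b (j c)) - M b (T' (j a) (M b u) (j c)) = 0"
      unfolding a'(2)[symmetric] c'(2)[symmetric] by (simp add: a' c' d' M_lin)
  next
    fix x z assume x: "x \<in> A'" "z \<in> A'"
      and eq: "T (M b x) u (M b z) - M b (T' x (M b u) z) + (T (M b x) u (M b z) - M b (T' x (M b u) z)) = 0"
    show "T (M b x) u (M b z) - M b (T' x (M b u) z) = 0"
      by (rule tor2[OF _ eq]) (intro A_diff T_closed op.T_closed M_closed b x u)
  qed (simp_all add: M_lin T_lin op.T_lin algebra_simps)
  then show ?thesis by simp
qed

lemma T_shift_aux:
  assumes b: "b \<in> B" and y: "y \<in> A'" and w: "w \<in> A'" and u: "u \<in> A'" and z: "z \<in> A"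
    and units: "i b + z \<in> i ` B" "i b - z \<in> i ` B" "i b + (z + z) \<in> i ` B" "i b - (z + z) \<in> i ` B"
  shows "T (M b y) u (T (i b) w z) + T (T (i b) y z) u (M b w)
    - M b (T' y (T (i b) u z) w) - T (i b) (T' y (M b u) w) z = 0"
proof -
  define q where "q v = halve A (T z v z)" for v
  define p where "p v = T (i b) v z" for v
  have p_add: "p (v + v') = p v + p v'" "p (- v) = - p v" "p (v - v') = p v - p v'" for v v'
    by (simp_all add: p_def T_lin)
  have q_A: "q v \<in> A" if "v \<in> A'" for v unfolding q_def by (intro halve_A T_closed that z)
  have p_A: "p v \<in> A" if "v \<in> A'" for v unfolding p_def by (intro T_closed that z i_A b)
  have q_add: "q (v + v') = q v + q v'" if "v \<in> A'" "v' \<in> A'" for v v'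
    unfolding q_def using that by (simp add: T_add2 halve_add T_closed z)
  have q_uminus: "q (- v) = - q v" if "v \<in> A'" for v
    using q_add[OF that op.A_uminus[OF that]] halve_eq[OF A_zero, of 0]
    by (simp add: eq_neg_iff_add_eq_0 add.commute q_def T_lin)
  have q_double: "halve A (T (z + z) v (z + z)) = q v + q v + (q v + q v)" if "v \<in> A'" for v
  proof (rule halve_eq)
    have "T (z + z) v (z + z) = T z v z + T z v z + (T z v z + T z v z)" by (simp add: T_lin)
    then show "q v + q v + (q v + q v) + (q v + q v + (q v + q v)) = T (z + z) v (z + z)"
      using halve_double[OF T_closed[OF z that z]] by (simp add: q_def algebra_simps)
  qed (intro A_add q_A that)
  \<comment> \<open>\<open>T_M_M\<close> at the unit \<open>b + x\<close>, with \<open>M\<close>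
    there replaced by its expansion in \<open>x\<close>.\<close>
  have main: "T (m y) u (m w) - m (T' y (m u) w) = 0"
    if "c \<in> B" "i c = i b + x" "x \<in> A" "\<And>v. v \<in> A' \<Longrightarrow> m v = M b v + T (i b) v x + halve A (T x v x)" for c x m
  proof -
    have "m v = M c v" if "v \<in> A'" for v
      using M_shift[OF b \<open>c \<in> B\<close> \<open>i c = i b + x\<close> \<open>x \<in> A\<close> that] that \<open>\<And>v. v \<in> A' \<Longrightarrow> m v = _\<close> by simp
    moreover have "T (M c y) u (M c w) = M c (T' y (M c u) w)"
      by (rule T_M_M[OF that(1) y w u])
    ultimately show ?thesis
      using y u w that(1) by (simp add: op.T_closed M_closed)
  qed
  note cl = y w u M_closed[OF b] p_A q_A op.T_closed op.A_add op.A_uminus op.A_diff A_add A_uminus A_diff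
  define t where "t m1 m2 = T (m1 y) u (m2 w) - m1 (T' y (m2 u) w)" for m1 m2 :: "'g \<Rightarrow> 'f"
  have t_A: "t m1 m2 \<in> A" if "\<And>v. v \<in> A' \<Longrightarrow> m1 v \<in> A" "\<And>v. v \<in> A' \<Longrightarrow> m2 v \<in> A" for m1 m2
    unfolding t_def by (intro A_diff T_closed op.T_closed that y w u)
  \<comment> \<open>The components of degree 0 to 4 in \<open>z\<close>: \<open>M b\<close>,
    \<open>p\<close> and \<open>q\<close> have degrees 0, 1 and 2.\<close>
  define a0 a1 a2 a3 a4 where a: "a0 = t (M b) (M b)" "a1 = t (M b) p + t p (M b)"
    "a2 = t (M b) q + t p p + t q (M b)" "a3 = t p q + t q p" "a4 = t q q"
  obtain c1 where c1: "c1 \<in> B" "i c1 = i b + z" using units(1) by auto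
  have e1: "T (M b y + p y + q y) u (M b w + p w + q w)
       - (\<lambda>v. M b v + p v + q v) (T' y (M b u + p u + q u) w) = 0"
    using main[OF c1 z, of "\<lambda>v. M b v + p v + q v"] by (simp add: p_def q_def)
  obtain c2 where c2: "c2 \<in> B" "i c2 = i b + - z" using units(2) by auto
  have e2: "T (M b y - p y + q y) u (M b w - p w + q w)
       - (\<lambda>v. M b v - p v + q v) (T' y (M b u - p u + q u) w) = 0"
    using main[OF c2 A_uminus[OF z], of "\<lambda>v. M b v - p v + q v"] by (simp add: p_def q_def T_lin)
  obtain c3 where c3: "c3 \<in> B" "i c3 = i b + (z + z)" using units(3) by auto
  let ?q4 = "\<lambda>v. q v + q v + (q v + q v)"
  have e3: "T (M b y + (p y + p y) + ?q4 y) u (M b w + (p w + p w) + ?q4 w)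
       - (\<lambda>v. M b v + (p v + p v) + ?q4 v) (T' y (M b u + (p u + p u) + ?q4 u) w) = 0"
    using main[OF c3 A_add[OF z z], of "\<lambda>v. M b v + (p v + p v) + ?q4 v"]
    by (simp add: q_double) (simp add: p_def T_lin)
  obtain c4 where c4: "c4 \<in> B" "i c4 = i b + - (z + z)"
    using units(4) unfolding diff_conv_add_uminus by (elim imageE) auto
  have e4: "T (M b y - (p y + p y) + ?q4 y) u (M b w - (p w + p w) + ?q4 w)
       - (\<lambda>v. M b v - (p v + p v) + ?q4 v) (T' y (M b u - (p u + p u) + ?q4 u) w) = 0"
  proof (rule main[OF c4 A_uminus[OF A_add[OF z z]], of "\<lambda>v. M b v - (p v + p v) + ?q4 v"])
    fix v assume "v \<in> A'"
    moreover have "T (- (z + z)) v (- (z + z)) = T (z + z) v (z + z)" by (simp add: T_lin)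
    ultimately show "M b v - (p v + p v) + ?q4 v = M b v + T (i b) v (- (z + z)) + halve A (T (- (z + z)) v (- (z + z)))"
      by (simp add: q_double) (simp add: p_def T_lin)
  qed
  have q_diff: "q (v - v') = q v - q v'" if "v \<in> A'" "v' \<in> A'" for v v'
    using q_add[of v "- v'"] q_uminus that op.A_uminus by simp
  note lin = T_lin op.T_lin M_lin p_add q_add q_diff q_uminus
  have "a1 = 0"
  \<comment> \<open>Passing from \<open>z\<close> to \<open>2z\<close> multiplies the components by
    1, 2, 4, 8, 16; the last three arguments spell out \<open>a0\<close>, \<open>4 a2\<close> and
    \<open>16 a4\<close>.\<close>
  proof (rule quartic_linear_coeff[of A a1 a3 a0 a2 a4 a0 "a2 + a2 + (a2 + a2)"
        "((a4 + a4 + (a4 + a4)) + (a4 + a4 + (a4 + a4))) + ((a4 + a4 + (a4 + a4)) + (a4 + a4 + (a4 + a4)))"])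
    show "a1 \<in> A" "a3 \<in> A"
      unfolding a by (intro A_add t_A; simp add: cl)+
    show "a0 + a1 + a2 + a3 + a4 = 0"
      using e1 by (simp add: a t_def lin cl algebra_simps)
    show "a0 - a1 + a2 - a3 + a4 = 0"
      using e2 by (simp add: a t_def lin cl algebra_simps)
    show "a0 + (a1 + a1) + (a2 + a2 + (a2 + a2)) + ((a3 + a3 + (a3 + a3)) + (a3 + a3 + (a3 + a3)))
       + (((a4 + a4 + (a4 + a4)) + (a4 + a4 + (a4 + a4))) + ((a4 + a4 + (a4 + a4)) + (a4 + a4 + (a4 + a4)))) = 0"
      using e3 by (simp add: a t_def lin cl algebra_simps)
    show "a0 - (a1 + a1) + (a2 + a2 + (a2 + a2)) - ((a3 + a3 + (a3 + a3)) + (a3 + a3 + (a3 + a3)))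
       + (((a4 + a4 + (a4 + a4)) + (a4 + a4 + (a4 + a4))) + ((a4 + a4 + (a4 + a4)) + (a4 + a4 + (a4 + a4)))) = 0"
      using e4 by (simp add: a t_def lin cl algebra_simps)
  qed (rule tor2 tor3 A_add; assumption)+
  then show ?thesis
    by (simp add: a t_def p_def algebra_simps)
qed

end

section \<open>Linearization of the fundamental formula at a unit\<close>

context involutive_pair
begin

lemma nonunit_double: "x \<in> A \<Longrightarrow> x \<notin> i ` B \<Longrightarrow> x + x \<notin> i ` B"
  by (rule nonunit_add)

lemma unit_diff_nonunit: "b \<in> B \<Longrightarrow> x \<in> A \<Longrightarrow> x \<notin> i ` B \<Longrightarrow> i b - x \<in> i ` B"
  using unit_add_nonunit[of b "- x"] A_uminus unit_uminus_iff by simp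

text \<open>The component linear in \<open>z\<close> of the fundamental formula at \<open>i b + z\<close>, isolated by comparing its
  values at \<open>i b \<plusminus> z\<close> and \<open>i b \<plusminus> 2z\<close>. If one of these is a non-unit, then \<open>z\<close>, \<open>-z\<close>, \<open>2z\<close> or \<open>-2z\<close> is
  \<open>-i b\<close> plus a non-unit, and additivity in \<open>z\<close> reduces the claim to the cases of
  non-units and of \<open>z = i b\<close>.\<close>
lemma T_shift:
  assumes b: "b \<in> B" and y: "y \<in> A'" and w: "w \<in> A'" and u: "u \<in> A'" and z: "z \<in> A"
  shows "T (M b y) u (T (i b) w z) + T (T (i b) y z) u (M b w)
    - M b (T' y (T (i b) u z) w) - T (i b) (T' y (M b u) w) z = 0"
proof -
  define f where "f z = T (M b y) u (T (i b) w z) + T (T (i b) y z) u (M b w)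
    - M b (T' y (T (i b) u z) w) - T (i b) (T' y (M b u) w) z" for z
  have f_add: "f (z + z') = f z + f z'" for z z'
    by (simp add: f_def T_lin op.T_lin M_lin algebra_simps)
  note f_lin = f_add additive_uminus[of f, OF f_add]
  have f_A: "f z \<in> A" if "z \<in> A" for z
    unfolding f_def by (intro A_diff A_add T_closed op.T_closed M_closed b y w u that i_A)
  have f_nonunit: "f n = 0" if n: "n \<in> A" "n \<notin> i ` B" for n
  proof -
    have nn: "n + n \<in> A" "n + n \<notin> i ` B" using A_add nonunit_double n by auto
    have "f n = T (M b y) u (T (i b) w n) + T (T (i b) y n) u (M b w)
      - M b (T' y (T (i b) u n) w) - T (i b) (T' y (M b u) w) n"
      by (rule f_def)
    also have "\<dots> = 0"
      by (rule T_shift_aux[OF b y w u n(1)])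
        (intro unit_add_nonunit unit_diff_nonunit b n nn)+
    finally show ?thesis .
  qed
  have f_b: "f (i b) = 0"
    using T_M_M[OF b y w u]
    by (simp add: f_def T_unit[OF b] y w u op.T_closed M_closed b T_lin op.T_lin M_lin)
  have shift: "f s = 0" if s: "s \<in> A" "i b + s \<notin> i ` B" for s
    using f_nonunit[OF A_add[OF i_A[OF b] s(1)] s(2)] f_b by (simp add: f_add)
  have "f z = 0"
  proof (rule ccontr)
    assume nz: "f z \<noteq> 0"
    have "f z + f z \<noteq> 0" using tor2[OF f_A[OF z]] nz by blast
    then have "f (- z) \<noteq> 0" "f (z + z) \<noteq> 0" "f (- (z + z)) \<noteq> 0"
      using nz by (simp_all only: f_lin neg_equal_0_iff_equal not_False_eq_True)
    then have "i b + z \<in> i ` B" "i b - z \<in> i ` B" "i b + (z + z) \<in> i ` B" "i b - (z + z) \<in> i ` B"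
      using shift[of z] shift[of "- z"] shift[of "z + z"] shift[of "- (z + z)"] nz z A_add[OF z z]
        A_uminus[OF z] A_uminus[OF A_add[OF z z]]
      unfolding diff_conv_add_uminus by blast+
    then have "f z = 0"
      unfolding f_def by (rule T_shift_aux[OF b y w u z])
    then show False using nz by simp
  qed
  then show ?thesis by (simp add: f_def)
qed

lemma T_self': "c \<in> B \<Longrightarrow> x \<in> A \<Longrightarrow> T (i c) (j c) x = - (x + x)"
  using T_self T_sym[OF i_A op.i_A] by metis

text \<open>Put \<open>w\<close> and \<open>u\<close> equal to \<open>j b\<close> in
  \<open>T_shift\<close>: the inner products collapse by \<open>{b b z} = -2z\<close>, and the two
  multiples of \<open>{b y z}\<close> cancel.\<close>

lemma T_M:
  assumes b: "b \<in> B" and y: "y \<in> A'" and z: "z \<in> A"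
  shows "T (M b y) (j b) z = M b (T' y z (j b))"
proof (rule cancel2)
  have "T (M b y) (j b) (T (i b) (j b) z) + T (T (i b) y z) (j b) (M b (j b))
    - M b (T' y (T (i b) (j b) z) (j b)) - T (i b) (T' y (M b (j b)) (j b)) z = 0"
    by (rule T_shift[OF b y _ _ z]) (rule op.i_A[OF b])+
  moreover have "T (T (i b) y z) (j b) (M b (j b)) = T (i b) y z + T (i b) y z"
    using T_self[OF b T_closed[OF i_A[OF b] y z]] by (simp add: M_j[OF b] T_lin)
  moreover have "T (i b) (T' y (M b (j b)) (j b)) z = T (i b) y z + T (i b) y z"
    using op.T_self[OF b y] by (simp add: M_j[OF b] T_lin op.T_lin)
  ultimately show "T (M b y) (j b) z + T (M b y) (j b) z = M b (T' y z (j b)) + M b (T' y z (j b))"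
    using T_self'[OF b z] by (simp add: T_lin op.T_lin M_lin algebra_simps)
qed (intro M_closed T_closed op.T_closed op.i_A b y z)+

text \<open>\<open>T_M\<close> combined with \<open>T_M_M\<close>. It trades a unit in the middle
  position for the same unit in an outer one, which converts identities around \<open>i b\<close>
  into identities with middle argument \<open>j b\<close>.\<close>

lemma T_swap:
  assumes b: "b \<in> B" and v: "v \<in> A" and z: "z \<in> A"
  shows "T v (j b) z = - T v (M' b z) (i b)"
proof -
  let ?y = "M' b v" and ?u = "M' b z"
  have y: "?y \<in> A'" "?u \<in> A'" using op.M_closed b v z by auto
  have "T (M b ?y) (j b) z = M b (T' ?y z (j b))"
    by (rule T_M[OF b y(1) z])
  also have "\<dots> = M b (T' ?y (M b ?u) (j b))"
    by (simp add: M_M'[OF b z])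
  also have "\<dots> = T (M b ?y) ?u (M b (j b))"
    by (rule T_M_M[symmetric]) (use b y op.i_A in auto)
  finally show ?thesis
    by (simp add: M_M'[OF b v] M_j[OF b] T_lin)
qed

end

section \<open>The five-linear identity and the ideal of non-units\<close>

context involutive_pair
begin

lemma M'_T:
  assumes b: "b \<in> B" and u: "u \<in> A'" and z: "z \<in> A"
  shows "M' b (T (i b) u z) = - T' u z (j b)"
proof -
  have m: "M' b z \<in> A'" by (rule op.M_closed[OF b z])
  have "M' b (T z u (i b)) = T' (M' b z) (i b) u"
    by (rule flip.T_M[OF b z u, symmetric])
  also have "\<dots> = T' u (i b) (M' b z)"
    by (rule op.T_sym[OF m i_A[OF b] u])
  also have "\<dots> = - T' u z (j b)"
    using flip.T_swap[OF b u m] M_M'[OF b z] by simp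
  finally show ?thesis using T_sym[OF z u i_A[OF b]] by simp
qed

text \<open>This is \<open>T_shift\<close> at \<open>y = M' b v\<close> and
  \<open>w = M' b v'\<close>: \<open>T_swap\<close> turns each outer \<open>i b\<close> into a
  middle \<open>j b\<close>, while \<open>T_M_M\<close> and \<open>M'_T\<close> remove the remaining
  maps \<open>M b\<close>.\<close>

lemma five_unit:
  assumes b: "b \<in> B" and v: "v \<in> A" and v': "v' \<in> A" and u: "u \<in> A'" and z: "z \<in> A"
  shows "T z (j b) (T v u v') - T v u (T z (j b) v') = T (T z (j b) v) u v' - T v (T' (j b) z u) v'"
proof -
  let ?y = "M' b v" and ?w = "M' b v'"
  have y: "?y \<in> A'" and w: "?w \<in> A'" using op.M_closed b v v' by auto
  note cl = y w v v' u z i_A[OF b] op.i_A[OF b]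
  have eq: "T v u (T (i b) ?w z) + T (T (i b) ?y z) u v'
    - M b (T' ?y (T (i b) u z) ?w) - T (i b) (T' ?y (M b u) ?w) z = 0"
    using T_shift[OF b y w u z] by (simp add: M_M' b v v')
  have ibw: "T (i b) (M' b x) z = - T z (j b) x" if "x \<in> A" for x
    using T_swap[OF b z that] T_sym[OF i_A[OF b] op.M_closed[OF b that] z] by simp
  have t1: "M b (T' ?y (T (i b) u z) ?w) = - T v (T' (j b) z u) v'"
  proof -
    let ?q = "T (i b) u z"
    have q: "?q \<in> A" by (rule T_closed[OF i_A[OF b] u z])
    have "T (M b ?y) (M' b ?q) (M b ?w) = M b (T' ?y (M b (M' b ?q)) ?w)"
      by (rule T_M_M[OF b y w op.M_closed[OF b q]])
    then have "M b (T' ?y ?q ?w) = T v (M' b ?q) v'"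
      by (simp only: M_M'[OF b v] M_M'[OF b v'] M_M'[OF b q])
    then show ?thesis
      unfolding M'_T[OF b u z] op.T_sym[OF u z op.i_A[OF b]] by (simp add: T_lin)
  qed
  have t2: "T' ?y (M b u) ?w = M' b (T v u v')"
  proof -
    have "T (M b ?y) u (M b ?w) = M b (T' ?y (M b u) ?w)"
      by (rule T_M_M[OF b y w u])
    then have "M' b (T v u v') = M' b (M b (T' ?y (M b u) ?w))"
      by (simp add: M_M' b v v')
    then show ?thesis
      by (simp add: flip.M_M' b op.T_closed M_closed y w u)
  qed
  show ?thesis
    using eq unfolding t1 t2 ibw[OF v] ibw[OF v'] ibw[OF T_closed[OF v u v']]
    by (simp add: T_lin algebra_simps)
qed

lemma five:
  assumes x: "x \<in> A" and y: "y \<in> A'" and u: "u \<in> A" and v: "v \<in> A'" and z: "z \<in> A"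
  shows "T x y (T u v z) - T u v (T x y z) = T (T x y u) v z - T u (T' y x v) z"
proof -
  have "T x y (T u v z) - T u v (T x y z) - (T (T x y u) v z - T u (T' y x v) z) = 0"
    by (rule op.additive_zero_on_units[where f = "\<lambda>y. T x y (T u v z) - T u v (T x y z)
        - (T (T x y u) v z - T u (T' y x v) z)", OF _ _ y])
      (simp_all add: T_lin op.T_lin five_unit x u v z algebra_simps)
  then show ?thesis by simp
qed

lemma M'_eq_unit: "b \<in> B \<Longrightarrow> a \<in> B \<Longrightarrow> M' b (i a) \<in> j ` B"
  using op.conj[of b a] by (metis imageI)

lemma M_nonunit:
  assumes b: "b \<in> B" and y: "y \<in> A'" "y \<notin> j ` B"
  shows "M b y \<notin> i ` B"
proof
  assume "M b y \<in> i ` B"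
  then obtain a where "a \<in> B" "M b y = i a" by auto
  then have "M' b (M b y) \<in> j ` B" using M'_eq_unit b by simp
  then show False using y flip.M_M'[OF b y(1)] by simp
qed

lemma M_bij: "b \<in> B \<Longrightarrow> bij_betw (M b) A' A"
  by (rule bij_betw_byWitness[where f' = "M' b"]) (auto simp: M_closed op.M_closed M_M' flip.M_M')

abbreviation Q :: "'f \<Rightarrow> 'g \<Rightarrow> 'f" where "Q x y \<equiv> halve A (T x y x)"
abbreviation Q' :: "'g \<Rightarrow> 'f \<Rightarrow> 'g" where "Q' y x \<equiv> halve A' (T' y x y)"

lemma Q_closed: "x \<in> A \<Longrightarrow> y \<in> A' \<Longrightarrow> Q x y \<in> A"
  by (simp add: halve_A T_closed)

lemma Q_add: "x \<in> A \<Longrightarrow> z \<in> A \<Longrightarrow> y \<in> A' \<Longrightarrow> Q (x + z) y = Q x y + Q z y + T x y z"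
proof (rule halve_eq)
  assume *: "x \<in> A" "z \<in> A" "y \<in> A'"
  then show "Q x y + Q z y + T x y z \<in> A" by (intro A_add Q_closed T_closed)
  have "Q x y + Q z y + T x y z + (Q x y + Q z y + T x y z)
    = (Q x y + Q x y) + (Q z y + Q z y) + (T x y z + T x y z)" by (simp add: algebra_simps)
  also have "\<dots> = T (x + z) y (x + z)"
    using * T_sym[of x y z] by (simp add: halve_double T_closed T_add algebra_simps)
  finally show "Q x y + Q z y + T x y z + (Q x y + Q z y + T x y z) = T (x + z) y (x + z)" .
qed

lemma Q_add2: "x \<in> A \<Longrightarrow> y \<in> A' \<Longrightarrow> y' \<in> A' \<Longrightarrow> Q x (y + y') = Q x y + Q x y'"
  by (simp add: T_add2 halve_add T_closed)

lemma Q_uminus: "Q (- x) y = Q x y"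
  by (simp add: T_lin)

lemma Q_unit: "b \<in> B \<Longrightarrow> y \<in> A' \<Longrightarrow> Q (i b) y = M b y"
  by (rule halve_eq) (simp_all add: M_closed T_unit)

text \<open>By \<open>M_cong\<close> the maps at \<open>b\<close> and \<open>b + x\<close> agree
  modulo non-units, so \<open>{b y x} + Q x y\<close> is a non-unit for every unit \<open>b\<close>.
  Subtracting this at \<open>b\<close> from the same at \<open>2b\<close> isolates
  \<open>{b y x}\<close>.\<close>

lemma nonunit_ideal1:
  assumes x: "x \<in> A" "x \<notin> i ` B" and y: "y \<in> A'"
  shows "Q x y \<notin> i ` B" and "z \<in> A \<Longrightarrow> T x y z \<notin> i ` B"
proof -
  have step: "T (i b) y x + Q x y \<notin> i ` B" if b: "b \<in> B" for b
  proof -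
    obtain b' where b': "b' \<in> B" "i b' = i b + x" using unit_add_nonunit[OF b x] by auto
    have "M b' y - M b y \<notin> i ` B" by (rule M_cong[OF b'(1) b _ y]) (simp add: b' x)
    then show ?thesis using M_shift[OF b b' x(1) y] by (simp add: algebra_simps)
  qed
  have sA: "T (i b) y x + Q x y \<in> A" if "b \<in> B" for b
    by (intro A_add T_closed Q_closed i_A x y that)
  have unit: "T (i b) y x \<notin> i ` B" if b: "b \<in> B" for b
  proof -
    obtain a where a: "a \<in> B" "i a = i b + i b" using i_2[OF b] by auto
    have "(T (i a) y x + Q x y) - (T (i b) y x + Q x y) \<notin> i ` B"
      using nonunit_diff[OF sA[OF a(1)] sA[OF b] step[OF a(1)] step[OF b]] .
    then show ?thesis by (simp add: a T_lin)
  qed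
  obtain b where b: "b \<in> B" using B_ne by auto
  have TA: "T (i a) y x \<in> A" if "a \<in> B" for a
    by (intro T_closed i_A x y that)
  show "Q x y \<notin> i ` B"
    using nonunit_diff[OF sA[OF b] TA[OF b] step[OF b] unit[OF b]] by simp
  assume z: "z \<in> A"
  have "T z y x \<notin> i ` B"
  proof (cases "z \<in> i ` B")
    case False
    then obtain a where a: "a \<in> B" "i a = i b + z" using unit_add_nonunit[OF b z] by auto
    have "T (i a) y x - T (i b) y x \<notin> i ` B"
      by (rule nonunit_diff[OF TA[OF a(1)] TA[OF b] unit[OF a(1)] unit[OF b]])
    then show ?thesis by (simp add: a T_lin)
  qed (use unit in auto)
  then show "T x y z \<notin> i ` B" using T_sym x y z by simp
qed

text \<open>For a unit \<open>x\<close> the map is \<open>M\<close>, which preserves non-units; for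
  a non-unit \<open>x\<close> the previous lemma applies. The triple product follows by
  polarization.\<close>

lemma nonunit_ideal2:
  assumes y: "y \<in> A'" "y \<notin> j ` B" and x: "x \<in> A"
  shows "Q x y \<notin> i ` B" and "z \<in> A \<Longrightarrow> T x y z \<notin> i ` B"
proof -
  have Q: "Q x y \<notin> i ` B" if "x \<in> A" for x
  proof (cases "x \<in> i ` B")
    case True
    then obtain a where "a \<in> B" "x = i a" by auto
    then show ?thesis using M_nonunit[of a y] y Q_unit[of a y] by simp
  qed (use nonunit_ideal1 that y in blast)
  then show "Q x y \<notin> i ` B" using x by blast
  assume z: "z \<in> A"
  have "Q (x + z) y - Q x y - Q z y \<notin> i ` B"
    by (intro nonunit_diff A_diff Q A_add Q_closed x z y)
  then show "T x y z \<notin> i ` B" using Q_add[OF x z y(1)] by simp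
qed

end

section \<open>Bergman operators\<close>

context involutive_pair
begin

text \<open>\<open>T_swap\<close> moves \<open>w\<close> out of the middle position; the left side
  is then the expansion \<open>M_shift\<close> of \<open>M c\<close> at the point
  \<open>M' w z\<close>.\<close>

lemma bergman_unit:
  assumes w: "w \<in> B" and c: "c \<in> B" "i c = i w + x" and x: "x \<in> A" and z: "z \<in> A"
  shows "z - T x (j w) z + Q x (Q' (j w) z) = M c (M' w z)"
proof -
  have m: "M' w z \<in> A'" by (rule op.M_closed[OF w z])
  have "M c (M' w z) = z + T (i w) (M' w z) x + Q x (M' w z)"
    using M_shift[OF w c x m] M_M'[OF w z] by simp
  then show ?thesis
    using T_swap[OF w x z] T_sym[OF x m i_A[OF w]] flip.Q_unit[OF w z] by simp
qed

text \<open>Up to scaling, \<open>r\<close> is the product of the Jordan algebra attached to the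
  unit \<open>w\<close>, with \<open>M' w\<close> identifying the two spaces. There the claim is the
  standard identity \<open>{x v z} + {v z x} = r x (r z v)\<close>, and \<open>dbl\<close> writes
  triple products through \<open>r\<close>.\<close>

lemma circ_identity:
  assumes w: "w \<in> B" and x: "x \<in> A" and z: "z \<in> A" and v: "v \<in> A'"
  shows "T x v z + T (i w) (T' (j w) z v) x + T (M w v) (M' w z) x = 0"
proof -
  define r where "r a b = T a (j w) b" for a b
  let ?v = "M w v" and ?g = "T' (j w) z v"
  have v': "?v \<in> A" by (rule M_closed[OF w v])
  have wi: "i w \<in> A" "j w \<in> A'" using i_A op.i_A w by auto
  have r_A: "r a b \<in> A" if "a \<in> A" "b \<in> A" for a b
    unfolding r_def by (intro T_closed that wi)
  have r_sym: "r a b = r b a" if "a \<in> A" "b \<in> A" for a b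
    unfolding r_def by (rule T_sym) (use that wi in auto)
  have dbl: "T u (M' w a) b + T u (M' w a) b = r (r a u) b - r a (r u b) + r u (r a b)"
    if "a \<in> A" "u \<in> A" "b \<in> A" for a u b
  proof -
    have "T' (j w) a (j w) = M' w a + M' w a" by (rule flip.T_unit[OF w that(1)])
    then show ?thesis
      using five[OF that(1) wi(2) that(2) wi(2) that(3)] by (simp add: r_def T_lin algebra_simps)
  qed
  have g: "T (i w) ?g x = - r x (r z ?v)"
  proof -
    have gA: "?g \<in> A'" by (rule op.T_closed[OF wi(2) z v])
    have wvz: "T (i w) v z = - r z ?v"
      using T_swap[OF w z v'] flip.M_M'[OF w v] T_sym[OF wi(1) v z] by (simp add: r_def)
    have "M' w (T (i w) v z) = - ?g"
      using M'_T[OF w v z] op.T_sym[OF wi(2) z v] by simp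
    then have "?g = M' w (r z ?v)"
      unfolding wvz op.M_lin by simp
    then have "T x ?g (i w) = - r x (r z ?v)"
      using T_swap[OF w x r_A[OF z v']] by (simp add: r_def)
    then show ?thesis using T_sym[OF wi(1) gA x] by simp
  qed
  have "T x v z + T ?v (M' w z) x = r x (r z ?v)"
  proof (rule cancel2)
    have "T x v z + T ?v (M' w z) x + (T x v z + T ?v (M' w z) x)
      = (T x (M' w ?v) z + T x (M' w ?v) z) + (T ?v (M' w z) x + T ?v (M' w z) x)"
      by (simp add: flip.M_M'[OF w v] algebra_simps)
    also have "\<dots> = r x (r z ?v) + r x (r z ?v)"
      using r_sym[OF v' z] r_sym[OF v' x] r_sym[OF z x] r_sym[OF r_A[OF v' x] z] r_sym[OF r_A[OF z v'] x]
        r_sym[OF r_A[OF x v'] z]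
      by (simp add: dbl v' x z algebra_simps)
    finally show "T x v z + T ?v (M' w z) x + (T x v z + T ?v (M' w z) x)
      = r x (r z ?v) + r x (r z ?v)" .
  qed (intro A_add T_closed r_A op.M_closed w x z v v')+
  then show ?thesis using g by (simp add: algebra_simps)
qed

text \<open>The classical formula \<open>B(x, w + v) = B(x, w) B(x^w, v)\<close> with the
  quasi-inverse \<open>x^w\<close>, here \<open>xw\<close>; by \<open>bergman_unit\<close>,
  \<open>B(x, w)\<close> is \<open>M w\<close>'s inverse followed by \<open>M c\<close>. The facts
  \<open>q\<close> and \<open>l\<close> treat the quadratic and the linear part of the second
  factor.\<close>

lemma bergman_compose:
  assumes w: "w \<in> B" and c: "c \<in> B" "i c = i w + x" and x: "x \<in> A" and z: "z \<in> A" and v: "v \<in> A'"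
  defines "xw \<equiv> i w + M w (j c)"
  shows "z - T x (j w + v) z + Q x (Q' (j w + v) z) = M c (M' w (z - T xw v z + Q xw (Q' v z)))"
proof -
  let ?g = "T' (j w) z v" and ?u = "Q' v z"
  have wA: "i w \<in> A" "j w \<in> A'" "i c \<in> A" "j c \<in> A'"
    using i_A[OF w] op.i_A[OF w] i_A[OF c(1)] op.i_A[OF c(1)] by auto
  have u: "?u \<in> A'" using flip.Q_closed v z by blast
  have g: "?g \<in> A'" by (rule op.T_closed[OF wA(2) z v])
  have Mw: "M w y \<in> A" if "y \<in> A'" for y by (rule M_closed[OF w that])
  have q: "M c (M' w (Q xw u)) = Q x u" if u: "u \<in> A'" for u
  proof -
    obtain d where d: "d \<in> B" "i d = M w (j c)" "M d u = M w (M' c (M w u))"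
      using conj[OF w c(1)] u w c(1) by (auto simp: M_neg M'_neg)
    have "T (M w (j w)) u (M w (j c)) = M w (T' (j w) (M w u) (j c))"
      by (rule T_M_M[OF w wA(2,4) u])
    then have eq: "T (i w) u (M w (j c)) = - M w (T' (j w) (M w u) (j c))"
      unfolding M_j[OF w] T_uminus by (metis minus_minus)
    have "Q xw u = M w u + M w (M' c (M w u)) - M w (T' (j w) (M w u) (j c))"
      unfolding xw_def d(2)[symmetric] Q_add[OF wA(1) i_A[OF d(1)] u] Q_unit[OF w u] Q_unit[OF d(1) u] d(3)
      by (simp add: d(2) eq)
    then have "M' w (Q xw u) = u + M' c (M w u) - T' (j w) (M w u) (j c)"
      using flip.M_M'[OF w] by (simp add: op.M_lin u op.M_closed op.T_closed c Mw wA)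
    then have "M c (M' w (Q xw u)) = M c u + M w u - M c (T' (j w) (M w u) (j c))"
      using M_M'[OF c(1)] by (simp add: M_lin Mw u)
    also have "M c (T' (j w) (M w u) (j c)) = T (i c) u (i w)"
      using flip.M'_T[OF c(1) Mw[OF u] wA(2)] op.T_sym[OF wA(2) Mw[OF u] wA(4)]
        T_swap[OF w wA(3) Mw[OF u]] T_sym[OF Mw[OF u] wA(2,3)] flip.M_M'[OF w u] by simp
    also have "M c u + M w u - T (i c) u (i w) = Q x u"
      using M_shift[OF w c x u] T_unit[OF w u] T_sym[OF wA(1) u x]
      by (simp add: c(2) T_lin algebra_simps)
    finally show ?thesis .
  qed
  have l: "M c (M' w (T xw v z)) = T x v z - Q x ?g"
  proof -
    have m: "M' w z \<in> A'" by (rule op.M_closed[OF w z])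
    have 1: "M' w (T (i w) v z) = - ?g"
      using M'_T[OF w v z] op.T_sym[OF wA(2) z v] by simp
    have "T (M w (j c)) v (M w (M' w z)) = M w (T' (j c) (M w v) (M' w z))"
      by (rule T_M_M[OF w wA(4) m v])
    then have 2: "M' w (T (M w (j c)) v z) = T' (j c) (M w v) (M' w z)"
      using flip.M_M'[OF w] M_M'[OF w z] by (simp add: op.T_closed wA Mw v m)
    have 3: "M c (T' (j c) (M w v) (M' w z)) = - T (M w v) (M' w z) (i c)"
      by (rule flip.M'_T[OF c(1) Mw[OF v] m])
    have 4: "M w ?g = - T z v (i w)"
      by (rule flip.M'_T[OF w z v])
    have 5: "T (M w v) (M' w z) (i w) = T z v (i w)"
      using T_swap[OF w Mw[OF v] z] T_swap[OF w z Mw[OF v]] flip.M_M'[OF w v]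
        T_sym[OF z wA(2) Mw[OF v]] by simp
    have "M c (M' w (T xw v z)) = - M c ?g - T (M w v) (M' w z) (i c)"
      unfolding xw_def by (simp add: T_lin op.M_lin M_lin 1 2 3)
    also have "\<dots> = - T (i w) ?g x - Q x ?g - T (M w v) (M' w z) x"
      unfolding c(2) T_add3 5 M_shift[OF w c x g] 4 by (simp add: algebra_simps)
    also have "\<dots> = T x v z - Q x ?g - (T x v z + T (i w) ?g x + T (M w v) (M' w z) x)"
      by (simp add: algebra_simps)
    also have "\<dots> = T x v z - Q x ?g"
      unfolding circ_identity[OF w x z v] by simp
    finally show ?thesis .
  qed
  have Qy: "Q' (j w + v) z = Q' (j w) z + ?u + ?g"
    by (rule flip.Q_add[OF wA(2) v z])
  have "Q x (Q' (j w + v) z) = Q x (Q' (j w) z) + Q x ?u + Q x ?g"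
    unfolding Qy using flip.Q_closed[OF wA(2) z] u g x by (simp only: Q_add2 op.A_add)
  then have "z - T x (j w + v) z + Q x (Q' (j w + v) z)
      = (z - T x (j w) z + Q x (Q' (j w) z)) - (T x v z - Q x ?g) + Q x ?u"
    by (simp only: T_add2) (simp add: algebra_simps)
  also have "\<dots> = M c (M' w z) - M c (M' w (T xw v z)) + M c (M' w (Q xw ?u))"
    using bergman_unit[OF w c x z] q[OF u] l by simp
  finally show ?thesis by (simp add: M_lin op.M_lin)
qed

lemma bergman_bij_unit:
  assumes x: "x \<in> A" "x \<notin> i ` B" and w: "w \<in> B"
  shows "bij_betw (\<lambda>z. z - T x (j w) z + Q x (Q' (j w) z)) A A"
proof -
  obtain c where c: "c \<in> B" "i c = i w + x" using unit_add_nonunit[OF w x] by auto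
  have "bij_betw (M c \<circ> M' w) A A"
    by (rule bij_betw_trans[OF flip.M_bij[OF w] M_bij[OF c(1)]])
  then show ?thesis
    by (subst bij_betw_cong[of _ _ "M c \<circ> M' w"]) (use bergman_unit[OF w c x(1)] in auto)
qed

theorem bergman_bij:
  assumes x: "x \<in> A" "x \<notin> i ` B" and y: "y \<in> A'"
  shows "bij_betw (\<lambda>z. z - T x y z + Q x (Q' y z)) A A"
proof (cases "y \<in> j ` B")
  case True
  then show ?thesis using bergman_bij_unit[OF x] by auto
next
  case False
  obtain w where w: "w \<in> B" using B_ne by auto
  obtain c where c: "c \<in> B" "i c = i w + x" using unit_add_nonunit[OF w x] by auto
  \<comment> \<open>\<open>v = y - w\<close> is a unit because \<open>y\<close> is not, so both
    factors are Bergman operators at units.\<close>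
  obtain v where v: "v \<in> B" "j v = j (neg w) + y"
    using op.unit_add_nonunit[OF neg_B[OF w] y False] by auto
  define xw where "xw = i w + M w (j c)"
  \<comment> \<open>In this form \<open>xw\<close> is seen to be a non-unit:
    \<open>x - Q x (j w)\<close> is one, and \<open>M' c\<close> and \<open>M w\<close> preserve
    non-units.\<close>
  have xw: "xw = M w (M' c (x - Q x (j w)))"
  proof -
    have "M c (j w) = - i w - (x + x) + Q x (j w)"
      using M_shift[OF w c x(1) op.i_A[OF w]] M_j[OF w] T_self'[OF w x(1)] by simp
    then have "x - Q x (j w) = - M c (j w) - i c"
      by (simp add: c(2) algebra_simps)
    then show ?thesis
      using flip.M_M'[OF c(1) op.i_A[OF w]]
      by (simp add: op.M_lin M_lin M_j w op.M_j c(1) xw_def)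
  qed
  have Qx: "Q x (j w) \<in> A" "Q x (j w) \<notin> i ` B"
    using Q_closed[OF x(1) op.i_A[OF w]] nonunit_ideal1(1)[OF x op.i_A[OF w]] by auto
  have "x - Q x (j w) \<in> A" "x - Q x (j w) \<notin> i ` B"
    using A_diff[OF x(1) Qx(1)] nonunit_diff[OF x(1) Qx(1) x(2) Qx(2)] by auto
  then have xwA: "xw \<in> A" "xw \<notin> i ` B"
    unfolding xw using M_closed[OF w op.M_closed[OF c(1)]]
      M_nonunit[OF w op.M_closed[OF c(1)] flip.M_nonunit[OF c(1)]] by auto
  have "bij_betw (M c \<circ> M' w) A A"
    by (rule bij_betw_trans[OF flip.M_bij[OF w] M_bij[OF c(1)]])
  from bij_betw_trans[OF bergman_bij_unit[OF xwA v(1)] this]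
  have *: "bij_betw ((M c \<circ> M' w) \<circ> (\<lambda>z. z - T xw (j v) z + Q xw (Q' (j v) z))) A A" .
  have y': "j w + j v = y" using v w by (simp add: op.i_neg)
  show ?thesis
    by (rule bij_betw_cong[THEN iffD1, OF _ *])
      (use bergman_compose[OF w c x(1) _ op.i_A[OF v(1)]] in \<open>simp add: y' flip: xw_def\<close>)
qed

text \<open>The Jordan inverse of \<open>i b\<close> is \<open>- j b\<close>, so the three terms are
  \<open>z\<close>, \<open>-2z\<close> and \<open>z\<close>. This keeps units out of the
  radical.\<close>

lemma bergman_unit_inverse:
  assumes b: "b \<in> B" and z: "z \<in> A"
  shows "z - T (i b) (j (neg b)) z + Q (i b) (Q' (j (neg b)) z) = 0"
proof -
  have "Q' (j (neg b)) z = M' b z"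
    using flip.Q_unit[OF neg_B[OF b] z] M'_neg[OF b] by simp
  then show ?thesis
    using Q_unit[OF b op.M_closed[OF b z]] M_M'[OF b z] T_self'[OF b z]
    by (simp add: op.i_neg b T_lin)
qed

end

sublocale involutive_pair \<subseteq> five_linear T T' A A'
  by unfold_locales
    (fact A_add A_uminus T_closed T_sym tor2 tor3 five op.A_add op.A_uminus op.T_closed op.T_sym op.tor2 op.tor3 flip.five)+

section \<open>Local Moufang sets\<close>

locale based_moufang =
  fixes sim :: "'a \<Rightarrow> 'a \<Rightarrow> bool" and U :: "'a \<Rightarrow> ('a \<Rightarrow> 'a) set" and p0 pinf :: 'a
  assumes LM: "local_moufang_set sim U" and basis: "\<not> sim p0 pinf"
begin

lemma LM_equivp: "equivp sim"
  and LM_three: "\<exists>a b c. \<not> sim a b \<and> \<not> sim b c \<and> \<not> sim a c"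
  and LM_subgroup: "perm_subgroup sim (U x)"
  and LM1: "(\<forall>g\<in>U x. g x = x) \<and>
    (\<forall>z w. \<not> sim x z \<longrightarrow> \<not> sim x w \<longrightarrow> (\<exists>!g. g \<in> U x \<and> g z = w))"
  and LM1': "\<forall>C\<in>eqclasses sim. \<forall>D\<in>eqclasses sim. C \<noteq> cls sim x \<longrightarrow> D \<noteq> cls sim x \<longrightarrow>
    (\<exists>!h. h \<in> induced sim (U x) \<and> h C = D)"
  and LM2: "g \<in> little_group U \<Longrightarrow> (\<lambda>u. g \<circ> u \<circ> inv_into UNIV g) ` U x = U (g x)"
  using LM unfolding local_moufang_set_def by simp_all

lemma sim_refl: "sim x x"
  using LM_equivp by (rule equivp_reflp)

lemma sim_sym: "sim x y \<Longrightarrow> sim y x"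
  using LM_equivp by (rule equivp_symp)

lemma sim_trans: "sim x y \<Longrightarrow> sim y z \<Longrightarrow> sim x z"
  using LM_equivp by (rule equivp_transp)

lemma basis': "\<not> sim pinf p0"
  using basis sim_sym by blast

lemma U_pres: "g \<in> U x \<Longrightarrow> equiv_pres sim g"
  using LM_subgroup[of x] unfolding perm_subgroup_def by simp

lemma U_bij: "g \<in> U x \<Longrightarrow> bij g"
  and U_sim: "g \<in> U x \<Longrightarrow> sim (g a) (g b) \<longleftrightarrow> sim a b"
  using U_pres unfolding equiv_pres_def by simp_all

lemma U_id: "id \<in> U x"
  and U_comp: "g \<in> U x \<Longrightarrow> h \<in> U x \<Longrightarrow> g \<circ> h \<in> U x"
  and U_inv: "g \<in> U x \<Longrightarrow> inv_into UNIV g \<in> U x"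
  using LM_subgroup[of x] unfolding perm_subgroup_def by simp_all

lemma U_fix: "g \<in> U x \<Longrightarrow> g x = x"
  using LM1[of x] by simp

lemma U_sharp: "\<not> sim x z \<Longrightarrow> \<not> sim x w \<Longrightarrow> \<exists>!g. g \<in> U x \<and> g z = w"
  using LM1[of x] by simp

lemma U_uniq: "g \<in> U x \<Longrightarrow> h \<in> U x \<Longrightarrow> \<not> sim x z \<Longrightarrow> g z = h z \<Longrightarrow> g = h"
  using U_sharp[of x z "g z"] U_sim[of g x x z] U_fix[of g x] by auto

lemma inv_f: "g \<in> U x \<Longrightarrow> inv_into UNIV g (g y) = y" "g \<in> U x \<Longrightarrow> g (inv_into UNIV g y) = y"
  using U_bij by (auto simp: bij_is_inj bij_is_surj surj_f_inv_f)

text \<open>By sharp transitivity in (LM1') the permutations of classes induced by \<open>g\<close>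
  and by the identity coincide, as they agree on the class of \<open>z\<close>.\<close>

lemma U_sim_fixed:
  assumes g: "g \<in> U x" and z: "\<not> sim x z" "sim (g z) z"
  shows "sim (g y) y"
proof -
  define r where "r h = restrict (image h) (eqclasses sim)" for h :: "'a \<Rightarrow> 'a"
  have im: "g ` cls sim a = cls sim (g a)" for a
  proof (intro Set.set_eqI iffI)
    fix b assume "b \<in> cls sim (g a)"
    then have "sim a (inv_into UNIV g b)"
      using U_sim[OF g, of a "inv_into UNIV g b"] inv_f[OF g] by (simp add: cls_def)
    then show "b \<in> g ` cls sim a"
      using inv_f(2)[OF g, of b] by (metis cls_def imageI mem_Collect_eq)
  qed (use U_sim[OF g] in \<open>auto simp: cls_def\<close>)
  have eq: "cls sim a = cls sim b \<longleftrightarrow> sim a b" for a b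
    unfolding cls_def using sim_refl sim_sym sim_trans by blast
  have E: "cls sim z \<in> eqclasses sim" "cls sim y \<in> eqclasses sim" "cls sim z \<noteq> cls sim x"
    using z eq sim_sym by (auto simp: eqclasses_def)
  have "\<exists>!h. h \<in> induced sim (U x) \<and> h (cls sim z) = cls sim z"
    using LM1'[of x] E by simp
  moreover have "r g \<in> induced sim (U x)" "r id \<in> induced sim (U x)"
    unfolding induced_def r_def by (rule imageI[OF g], rule imageI[OF U_id])
  moreover have "r g (cls sim z) = cls sim z" "r id (cls sim z) = cls sim z"
    using E z im eq by (auto simp: r_def)
  ultimately have "r g = r id" by blast
  then have "r g (cls sim y) = r id (cls sim y)" by simp
  then show ?thesis using E im eq by (simp add: r_def)
qed

lemma U_cong:
  assumes g: "g \<in> U x" and h: "h \<in> U x" and z: "\<not> sim x z" "sim (g z) (h z)" and y: "sim y y'"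
  shows "sim (g y) (h y')"
proof -
  have "sim ((inv_into UNIV h \<circ> g) z) z"
    using U_sim[OF h, of "inv_into UNIV h (g z)" z] inv_f[OF h] z by simp
  then have "sim ((inv_into UNIV h \<circ> g) y) y"
    by (rule U_sim_fixed[OF U_comp[OF U_inv[OF h] g] z(1)])
  then have "sim (h (inv_into UNIV h (g y))) (h y)"
    using U_sim[OF h] by simp
  then show ?thesis
    using inv_f[OF h] U_sim[OF h, of y y'] y sim_trans by metis
qed

lemma lg_pres: "g \<in> little_group U \<Longrightarrow> equiv_pres sim g"
proof (induction rule: little_group.induct)
  case (lg_comp g h)
  then show ?case
    using bij_comp[of g h] unfolding equiv_pres_def by simp
next
  case (lg_inv g)
  then have g: "bij g" "\<And>x y. sim (g x) (g y) \<longleftrightarrow> sim x y"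
    by (auto simp: equiv_pres_def)
  have "sim (inv_into UNIV g x) (inv_into UNIV g y) \<longleftrightarrow> sim x y" for x y
    using g(2)[of "inv_into UNIV g x" "inv_into UNIV g y"] surj_f_inv_f[OF bij_is_surj[OF g(1)]] by simp
  then show ?case
    using bij_imp_bij_inv[OF g(1)] unfolding equiv_pres_def by simp
next
  case lg_id
  then show ?case using bij_id unfolding equiv_pres_def id_def by blast
next
  case (lg_gen g y)
  then show ?case by (rule U_pres)
qed

lemma lg_bij: "g \<in> little_group U \<Longrightarrow> bij g"
  and lg_sim: "g \<in> little_group U \<Longrightarrow> sim (g a) (g b) \<longleftrightarrow> sim a b"
  using lg_pres unfolding equiv_pres_def by blast+

lemma lg_inv_f: "g \<in> little_group U \<Longrightarrow> inv_into UNIV g (g y) = y" "g \<in> little_group U \<Longrightarrow> g (inv_into UNIV g y) = y"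
  using lg_bij by (auto simp: bij_is_inj bij_is_surj surj_f_inv_f)

lemma lg_conj: "g \<in> little_group U \<Longrightarrow> u \<in> U x \<Longrightarrow> g \<circ> u \<circ> inv_into UNIV g \<in> U (g x)"
  using LM2[of g x] by blast

abbreviation "al \<equiv> alpha U p0 pinf"
abbreviation "be \<equiv> alpha U pinf p0"
abbreviation "unit \<equiv> unit_el sim p0 pinf"
abbreviation "ng \<equiv> negp U p0 pinf"
abbreviation "\<mu> \<equiv> mu U p0 pinf"

lemma al_props: "\<not> sim x pinf \<Longrightarrow> al x \<in> U pinf \<and> al x p0 = x"
  unfolding alpha_def
  by (rule theI'[of "\<lambda>g. g \<in> U pinf \<and> g p0 = x"])
    (use U_sharp[of pinf p0 x] basis' sim_sym in blast)

lemma al_U: "\<not> sim x pinf \<Longrightarrow> al x \<in> U pinf"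
  and al_0: "\<not> sim x pinf \<Longrightarrow> al x p0 = x"
  using al_props by auto

lemma al_eq: "g \<in> U pinf \<Longrightarrow> al (g p0) = g"
proof -
  assume g: "g \<in> U pinf"
  have "\<not> sim (g p0) pinf"
    using U_sim[OF g, of p0 pinf] U_fix[OF g] basis by simp
  then show ?thesis
    using U_uniq[OF al_U g basis'] al_0 by simp
qed

lemma al_sim: "\<not> sim x pinf \<Longrightarrow> sim (al x a) (al x b) \<longleftrightarrow> sim a b"
  using U_sim al_U by blast

lemma al_pinf: "\<not> sim x pinf \<Longrightarrow> al x pinf = pinf"
  using U_fix al_U by blast

lemma al_inj: "\<not> sim x pinf \<Longrightarrow> al x a = al x b \<longleftrightarrow> a = b"
  using U_bij[OF al_U] by (metis bij_pointE)

lemma al_closed: "\<not> sim x pinf \<Longrightarrow> \<not> sim y pinf \<Longrightarrow> \<not> sim (al x y) pinf"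
  using al_sim[of x y pinf] al_pinf by simp

lemma al_add: "\<not> sim x pinf \<Longrightarrow> \<not> sim y pinf \<Longrightarrow> al (al x y) t = al x (al y t)"
  using al_eq[OF U_comp[OF al_U al_U], of x y] al_0 by (metis comp_apply)

lemma al_ng: "\<not> sim x pinf \<Longrightarrow> al (ng x) = inv_into UNIV (al x)"
  using al_eq[OF U_inv[OF al_U]] by (simp add: negp_def)

lemma ng_closed: "\<not> sim x pinf \<Longrightarrow> \<not> sim (ng x) pinf"
  using U_sim[OF U_inv[OF al_U], of x p0 pinf] U_fix[OF U_inv[OF al_U]] basis
  by (simp add: negp_def)

lemma al_ng_al: "\<not> sim x pinf \<Longrightarrow> al (ng x) (al x t) = t" "\<not> sim x pinf \<Longrightarrow> al x (al (ng x) t) = t"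
  using inv_f[OF al_U] by (auto simp: al_ng)

lemma al_x_ng: "\<not> sim x pinf \<Longrightarrow> al x (ng x) = p0"
  using inv_f[OF al_U] by (simp add: negp_def)

lemma ng_ng: "\<not> sim x pinf \<Longrightarrow> ng (ng x) = x"
  unfolding negp_def[of U p0 pinf "ng x"] using al_ng[of x] inv_inv_eq[OF U_bij[OF al_U]] al_0 by simp

lemma al_cong: "\<not> sim x pinf \<Longrightarrow> \<not> sim x' pinf \<Longrightarrow> sim x x' \<Longrightarrow> sim t t' \<Longrightarrow> sim (al x t) (al x' t')"
  by (rule U_cong[OF al_U al_U basis']) (simp_all add: al_0)

lemma ng_cong: "\<not> sim x pinf \<Longrightarrow> \<not> sim x' pinf \<Longrightarrow> sim x x' \<Longrightarrow> sim (ng x) (ng x')"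
proof -
  assume *: "\<not> sim x pinf" "\<not> sim x' pinf" "sim x x'"
  have "sim (al x (ng x')) (al x' (ng x'))"
    using al_cong * sim_refl by blast
  then have "sim (al x (ng x')) (al x (ng x))"
    using * by (simp add: al_x_ng)
  then show ?thesis using * sim_sym by (simp add: al_sim)
qed

lemma unit_ng: "unit x \<Longrightarrow> unit (ng x)"
  using al_sim[of x "ng x" p0] al_x_ng[of x] al_0[of x] ng_closed[of x] sim_sym
  by (auto simp: unit_el_def)

lemma ex_unit: "\<exists>x. unit x"
proof -
  obtain a b c where abc: "\<not> sim a b" "\<not> sim b c" "\<not> sim a c" using LM_three by blast
  have two: "\<not> (sim x z \<and> sim y z)" if "\<not> sim x y" for x y z
    using that sim_sym sim_trans by blast
  have "(\<not> sim a p0 \<and> \<not> sim a pinf) \<or> (\<not> sim b p0 \<and> \<not> sim b pinf) \<or> (\<not> sim c p0 \<and> \<not> sim c pinf)"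
    using two[OF abc(1), of p0] two[OF abc(2), of p0] two[OF abc(3), of p0]
      two[OF abc(1), of pinf] two[OF abc(2), of pinf] two[OF abc(3), of pinf] by argo
  then show ?thesis unfolding unit_el_def by blast
qed

lemma lg_al: "\<not> sim x pinf \<Longrightarrow> al x \<in> little_group U"
  using lg_gen al_U by fast

end

text \<open>The axioms treat all points alike, so the basis points may be exchanged and each fact
  has a mirror image; \<open>be\<close> is the mirror image of \<open>al\<close>.\<close>

sublocale based_moufang \<subseteq> flip: based_moufang sim U pinf p0
  by unfold_locales (use LM basis' in auto)

section \<open>\<open>\<mu>\<close>-maps and the exchange of the basis points\<close>

context based_moufang
begin

lemma flip_unit: "unit_el sim pinf p0 x \<longleftrightarrow> unit x"
  by (auto simp: unit_el_def)

lemma swap_al: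
  assumes g: "g \<in> little_group U" "g p0 = pinf" "g pinf = p0" and x: "\<not> sim x pinf"
  shows "g (al x t) = be (g x) (g t)"
proof -
  have u: "g \<circ> al x \<circ> inv_into UNIV g \<in> U p0"
    using lg_conj[OF g(1) al_U[OF x]] g by simp
  have "(g \<circ> al x \<circ> inv_into UNIV g) pinf = g x"
    using lg_inv_f[OF g(1), of p0] g al_0[OF x] by simp
  then have "be (g x) = g \<circ> al x \<circ> inv_into UNIV g"
    using flip.al_eq[OF u] by simp
  then show ?thesis using lg_inv_f[OF g(1)] by simp
qed

end

context based_moufang
begin

text \<open>The swap determines both outer factors: the one applied last must send \<open>x\<close>
  to \<open>pinf\<close>, and the one applied first must send \<open>pinf\<close> to
  \<open>ng x\<close>.\<close>

lemma mu_eq: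
  assumes x: "unit x"
  shows "\<mu> x = inv_into UNIV (be x) \<circ> al x \<circ> be (ng x)"
proof -
  let ?m = "inv_into UNIV (be x) \<circ> al x \<circ> be (ng x)"
  have x': "\<not> sim x p0" "\<not> sim x pinf" "\<not> sim (ng x) p0" "\<not> sim (ng x) pinf"
    using x unit_ng by (auto simp: unit_el_def)
  note b = flip.al_U[OF x'(1)]
  have sw: "?m p0 = pinf" "?m pinf = p0"
    using flip.al_pinf[OF x'(3)] al_0[OF x'(2)] flip.al_0[OF x'(3)] al_x_ng[OF x'(2)]
      inv_f(1)[OF b, of pinf] flip.al_0[OF x'(1)] U_fix[OF U_inv[OF b]]
    by simp_all
  show ?thesis
    unfolding mu_def
  proof (rule the_equality)
    show "(\<exists>a\<in>U p0. \<exists>b\<in>U p0. ?m = b \<circ> al x \<circ> a) \<and> ?m p0 = pinf \<and> ?m pinf = p0"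
      using sw U_inv[OF b] flip.al_U[OF x'(3)] by blast
  next
    fix m assume "(\<exists>a\<in>U p0. \<exists>b\<in>U p0. m = b \<circ> al x \<circ> a) \<and> m p0 = pinf \<and> m pinf = p0"
    then obtain a c where m: "a \<in> U p0" "c \<in> U p0" "m = c \<circ> al x \<circ> a" "m p0 = pinf" "m pinf = p0"
      by blast
    have "c x = pinf" using m U_fix[OF m(1)] al_0[OF x'(2)] by simp
    moreover have "inv_into UNIV (be x) x = pinf"
      using inv_f(1)[OF b, of pinf] flip.al_0[OF x'(1)] by simp
    ultimately have c: "c = inv_into UNIV (be x)"
      using U_uniq[OF m(2) U_inv[OF b], of x] x' sim_sym by metis
    have "c (al x (a pinf)) = c p0" using m U_fix[OF m(2)] by simp
    then have "al x (a pinf) = p0" using U_bij[OF m(2)] by (metis bij_pointE)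
    then have "a pinf = ng x" using al_x_ng[OF x'(2)] al_inj[OF x'(2)] by metis
    then have "a = be (ng x)" using flip.al_eq[OF m(1)] by simp
    then show "m = ?m" using c m by simp
  qed
qed

lemma mu_swap:
  assumes x: "unit x"
  shows "\<mu> x p0 = pinf" and "\<mu> x pinf = p0" and "\<mu> x \<in> little_group U"
proof -
  have x': "\<not> sim x p0" "\<not> sim x pinf" "\<not> sim (ng x) p0" "\<not> sim (ng x) pinf"
    using x unit_ng by (auto simp: unit_el_def)
  note b = flip.al_U[OF x'(1)]
  show "\<mu> x p0 = pinf" "\<mu> x pinf = p0"
    using flip.al_pinf[OF x'(3)] al_0[OF x'(2)] flip.al_0[OF x'(3)] al_x_ng[OF x'(2)]
      inv_f(1)[OF b, of pinf] flip.al_0[OF x'(1)] U_fix[OF U_inv[OF b]]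
    by (simp_all add: mu_eq[OF x])
  show "\<mu> x \<in> little_group U"
    unfolding mu_eq[OF x]
    by (intro lg_comp lg_inv lg_al flip.lg_al x')
qed

lemma mu_sim: "unit x \<Longrightarrow> sim (\<mu> x a) (\<mu> x b) \<longleftrightarrow> sim a b"
  by (rule lg_sim[OF mu_swap(3)])

lemma mu_closed: "unit x \<Longrightarrow> \<not> sim y p0 \<Longrightarrow> \<not> sim (\<mu> x y) pinf"
  "unit x \<Longrightarrow> \<not> sim y pinf \<Longrightarrow> \<not> sim (\<mu> x y) p0"
  using mu_sim[of x y] mu_swap by metis+

lemma mu_unit: "unit x \<Longrightarrow> unit y \<Longrightarrow> unit (\<mu> x y)"
  using mu_closed by (simp add: unit_el_def)

lemma mu_al: "unit x \<Longrightarrow> \<not> sim y pinf \<Longrightarrow> \<mu> x (al y t) = be (\<mu> x y) (\<mu> x t)"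
  by (rule swap_al) (use mu_swap in auto)

lemma mu_be: "unit x \<Longrightarrow> \<not> sim y p0 \<Longrightarrow> \<mu> x (be y t) = al (\<mu> x y) (\<mu> x t)"
  by (rule flip.swap_al) (use mu_swap in auto)

lemma commutative_flip:
  assumes comm: "\<And>g h. g \<in> U pinf \<Longrightarrow> h \<in> U pinf \<Longrightarrow> g \<circ> h = h \<circ> g"
    and gh: "g \<in> U p0" "h \<in> U p0"
  shows "g \<circ> h = h \<circ> g"
proof -
  obtain e where e: "unit e" using ex_unit by blast
  let ?m = "\<mu> e"
  note m = mu_swap[OF e]
  have inv_m: "inv_into UNIV ?m p0 = pinf" "inv_into UNIV (inv_into UNIV ?m) = ?m"
    using lg_inv_f(1)[OF m(3), of pinf] m inv_inv_eq[OF lg_bij[OF m(3)]] by auto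
  have U: "inv_into UNIV ?m \<circ> k \<circ> ?m \<in> U pinf" if "k \<in> U p0" for k
    using lg_conj[OF lg_inv[OF m(3)] that] inv_m by simp
  have "(inv_into UNIV ?m \<circ> g \<circ> ?m) \<circ> (inv_into UNIV ?m \<circ> h \<circ> ?m) = (inv_into UNIV ?m \<circ> h \<circ> ?m) \<circ> (inv_into UNIV ?m \<circ> g \<circ> ?m)"
    by (rule comm[OF U[OF gh(1)] U[OF gh(2)]])
  then have "inv_into UNIV ?m (g (h (?m t))) = inv_into UNIV ?m (h (g (?m t)))" for t
    using lg_inv_f[OF m(3)] by (auto simp: fun_eq_iff)
  then have "g (h (?m t)) = h (g (?m t))" for t
    using lg_inv_f(2)[OF m(3)] by metis
  then have "g (h (?m (inv_into UNIV ?m t))) = h (g (?m (inv_into UNIV ?m t)))" for t by blast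
  then show ?thesis using lg_inv_f(2)[OF m(3)] by auto
qed

text \<open>Apply \<open>\<mu> e\<close> to \<open>al y (ng y) = p0\<close>, where \<open>y\<close>
  is the preimage of \<open>x\<close>. Being special thus means that the negatives of a unit in both
  groups agree.\<close>

lemma special_flip:
  assumes e: "unit e" and s: "special sim U p0 pinf (\<mu> e)" and x: "unit x"
  shows "negp U pinf p0 x = ng x"
proof -
  let ?m = "\<mu> e"
  note m = mu_swap[OF e]
  let ?y = "inv_into UNIV ?m x"
  have my: "?m ?y = x" by (rule lg_inv_f(2)[OF m(3)])
  have y: "\<not> sim ?y pinf"
    using lg_sim[OF m(3), of ?y pinf] my m x by (simp add: unit_el_def)
  have "?m p0 = ?m (al ?y (ng ?y))"
    by (simp add: al_x_ng y)
  also have "\<dots> = be x (?m (ng ?y))"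
    using swap_al[OF m(3,1,2) y] my by simp
  also have "?m (ng ?y) = ng x"
    using s x by (simp add: special_def)
  finally have "be x (ng x) = pinf" using m by simp
  then show ?thesis
    using flip.al_x_ng[of x] flip.al_inj[of x] x unfolding unit_el_def by metis
qed

end

text \<open>(J1) to (J3) in a form that is symmetric in the basis points, so that the exchange
  remains available.\<close>

locale special_moufang = based_moufang +
  assumes comm: "g \<in> U pinf \<Longrightarrow> h \<in> U pinf \<Longrightarrow> g \<circ> h = h \<circ> g"
    and comm0: "g \<in> U p0 \<Longrightarrow> h \<in> U p0 \<Longrightarrow> g \<circ> h = h \<circ> g"
    and spec: "unit x \<Longrightarrow> negp U pinf p0 x = ng x"
    and mult2: "unit x \<Longrightarrow> unit (al x x)"
    and mult3: "unit x \<Longrightarrow> unit (al x (al x x))"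
    and mult2': "unit x \<Longrightarrow> unit (be x x)"
    and mult3': "unit x \<Longrightarrow> unit (be x (be x x))"

sublocale special_moufang \<subseteq> flip: special_moufang sim U pinf p0
  by unfold_locales (use comm comm0 spec mult2 mult3 mult2' mult3' in \<open>auto simp: flip_unit\<close>)

context special_moufang
begin

lemma unitD: "unit x \<Longrightarrow> \<not> sim x p0" "unit x \<Longrightarrow> \<not> sim x pinf"
  "unit x \<Longrightarrow> \<not> sim (ng x) p0" "unit x \<Longrightarrow> \<not> sim (ng x) pinf"
  using unit_ng[of x] by (auto simp: unit_el_def)

lemma al_comm: "\<not> sim x pinf \<Longrightarrow> \<not> sim y pinf \<Longrightarrow> al x y = al y x"
  using comm[OF al_U[of x] al_U[of y]] al_0 by (metis comp_apply)

lemma be_ng: "unit x \<Longrightarrow> be (ng x) = inv_into UNIV (be x)"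
  using flip.al_ng[of x] spec[of x] unitD by simp

lemma be_ng_be: "unit x \<Longrightarrow> be (ng x) (be x t) = t" "unit x \<Longrightarrow> be x (be (ng x) t) = t"
  using flip.al_ng_al[of x] spec[of x] unitD by simp_all

lemma mu_bab: "unit x \<Longrightarrow> \<mu> x t = be (ng x) (al x (be (ng x) t))"
  by (simp add: mu_eq be_ng)

lemma mu_ng_mu: "unit x \<Longrightarrow> \<mu> (ng x) (\<mu> x t) = t" "unit x \<Longrightarrow> \<mu> x (\<mu> (ng x) t) = t"
  by (simp_all add: mu_bab unit_ng ng_ng unitD be_ng_be al_ng_al)

text \<open>Pulling a factor \<open>be (ng x)\<close> through \<open>\<mu> x\<close> turns it into
  \<open>al y\<close> for some \<open>y\<close>; the value at \<open>pinf\<close> forces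
  \<open>y = x\<close>.\<close>

lemma mu_aba: "unit x \<Longrightarrow> \<mu> x t = al x (be (ng x) (al x t))"
proof -
  assume x: "unit x"
  let ?y = "\<mu> x (ng x)"
  have y: "\<not> sim ?y pinf" by (rule mu_closed(1)[OF x unitD(3)[OF x]])
  have *: "\<mu> x t = al ?y (be (ng x) (al x t))" for t
  proof -
    have "\<mu> x t = \<mu> x (be (ng x) (be x t))" by (simp add: be_ng_be x)
    also have "\<dots> = al ?y (\<mu> x (be x t))" by (rule mu_be[OF x unitD(3)[OF x]])
    finally show ?thesis using x by (simp add: mu_bab be_ng_be)
  qed
  have "p0 = al ?y (ng x)"
    using *[of pinf] mu_swap(2)[OF x] al_pinf[OF unitD(2)[OF x]] flip.al_0[OF unitD(3)[OF x]] by simp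
  then have "al ?y (ng x) = al x (ng x)" using al_x_ng x unitD by simp
  then have "al (ng x) ?y = al (ng x) x" using al_comm y x unitD by metis
  then have "?y = x" using al_inj x unitD by metis
  then show ?thesis using *[of t] by (simp only:)
qed

end

section \<open>The conjugation rule and the Hua relation\<close>

context special_moufang
begin

text \<open>Exchanging \<open>al\<close> and \<open>be\<close> in the word \<open>mu_bab\<close>
  gives the word \<open>mu_aba\<close> of the inverse map; this is the source of the sign in
  \<open>two_sided_unit_pair\<close>.\<close>

lemma flip_mu: "unit x \<Longrightarrow> mu U pinf p0 x = \<mu> (ng x)"
  by (rule ext) (simp add: flip.mu_bab flip_unit spec mu_aba unit_ng ng_ng unitD)

lemma mu_self: "unit x \<Longrightarrow> \<mu> x x = ng x"
proof -
  assume x: "unit x"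
  have "be (ng x) x = be (ng x) (be x pinf)" using flip.al_0 x unitD by simp
  then have "be (ng x) x = pinf" using be_ng_be x by simp
  then show ?thesis
    using x al_pinf[OF unitD(2)[OF x]] flip.al_0[OF unitD(3)[OF x]] by (simp add: mu_bab)
qed

lemma mu_ng: "unit a \<Longrightarrow> \<not> sim b pinf \<Longrightarrow> \<not> sim b p0 \<Longrightarrow> \<mu> a (ng b) = ng (\<mu> a b)"
proof -
  assume a: "unit a" and "\<not> sim b pinf" "\<not> sim b p0"
  then have b: "unit b" by (simp add: unit_el_def)
  note mb = mu_unit[OF a b]
  have "be (\<mu> a b) (\<mu> a (ng b)) = \<mu> a (al b (ng b))"
    by (rule mu_al[OF a unitD(2)[OF b], symmetric])
  also have "\<dots> = pinf" using al_x_ng b unitD mu_swap(1)[OF a] by simp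
  also have "\<dots> = be (\<mu> a b) (ng (\<mu> a b))"
    using flip.al_x_ng[of "\<mu> a b"] mb spec unitD by simp
  finally show ?thesis using flip.al_inj mb unitD by metis
qed

text \<open>Conjugation by \<open>\<mu> a\<close> carries the three factors of
  \<open>\<mu> (ng b)\<close> in the form \<open>mu_aba\<close> to those of
  \<open>\<mu> (\<mu> a b)\<close> in the form \<open>mu_bab\<close>.\<close>

lemma mu_conj: "unit a \<Longrightarrow> unit b \<Longrightarrow> \<mu> (\<mu> a b) t = \<mu> a (\<mu> (ng b) (\<mu> (ng a) t))"
proof -
  assume a: "unit a" and b: "unit b"
  note mb = mu_unit[OF a b]
  have eq: "\<mu> a (ng b) = ng (\<mu> a b)" using mu_ng a b unitD by blast
  have "\<mu> a (\<mu> (ng b) s) = \<mu> (\<mu> a b) (\<mu> a s)" for s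
  proof -
    have "\<mu> (ng b) s = al (ng b) (be b (al (ng b) s))"
      using b by (simp add: mu_aba unit_ng ng_ng unitD)
    then have "\<mu> a (\<mu> (ng b) s) = be (ng (\<mu> a b)) (al (\<mu> a b) (be (ng (\<mu> a b)) (\<mu> a s)))"
      using a b by (simp add: mu_al mu_be unitD eq)
    then show ?thesis using mb by (simp add: mu_bab)
  qed
  then show ?thesis using mu_ng_mu[OF a] by simp
qed

lemma mu_hua1:
  assumes a: "unit a" and b: "unit b"
  shows "\<mu> b (al (ng b) a) = al b (be (ng b) a)"
  using b by (simp add: mu_aba al_ng_al unitD)

text \<open>With \<open>N\<close> the right side, rewriting \<open>be (ng c)\<close> shows that
  \<open>\<mu> c\<close> is \<open>v1\<close> after \<open>N\<close> after \<open>v2\<close>, for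
  \<open>v1\<close> and \<open>v2\<close> in \<open>U pinf\<close>. Both \<open>\<mu> c\<close> and
  \<open>N\<close> swap the basis points, so \<open>v1\<close> and \<open>v2\<close> fix
  \<open>p0\<close> and are trivial.\<close>

lemma mu_hua2:
  assumes a: "unit a" and b: "unit b" and d: "unit d" "d = al (ng b) a" and c: "unit c" "c = be (ng b) a"
  shows "\<mu> c t = \<mu> a (\<mu> (ng d) (\<mu> (ng b) t))"
proof -
  note u = unitD[OF a] unitD[OF b] unitD[OF d(1)] unitD[OF c(1)]
  note ngs = unit_ng[OF a] unit_ng[OF b] unit_ng[OF d(1)] unit_ng[OF c(1)]
  have be_aba: "be (ng x) s = al (ng x) (\<mu> x (al (ng x) s))" if "unit x" for x s
    using that by (simp add: mu_aba al_ng_al unitD)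
  have al_bab: "al (ng x) s = be (ng x) (\<mu> (ng x) (be (ng x) s))" if "unit x" for x s
  proof -
    have "\<mu> (ng x) (be (ng x) s) = be x (al (ng x) s)"
      using that by (simp add: mu_bab unit_ng ng_ng unitD be_ng_be)
    then show ?thesis using that by (simp add: be_ng_be)
  qed
  have ngc: "be (ng c) s = be (ng a) (be b s)" for s
  proof -
    have "be c (be (ng a) (be b s)) = be (ng b) (be a (be (ng a) (be b s)))"
      unfolding c(2) by (rule flip.al_add) (use u in auto)
    also have "\<dots> = s" using a b by (simp add: be_ng_be)
    finally have "be (ng c) (be c (be (ng a) (be b s))) = be (ng c) s" by simp
    then show ?thesis using c(1) by (simp add: be_ng_be)
  qed
  have ngd: "al (ng d) s = al (ng a) (al b s)" for s
  proof -
    have "al d (al (ng a) (al b s)) = al (ng b) (al a (al (ng a) (al b s)))"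
      unfolding d(2) by (rule al_add) (use u in auto)
    also have "\<dots> = s" using u by (simp add: al_ng_al)
    finally have "al (ng d) (al d (al (ng a) (al b s))) = al (ng d) s" by simp
    then show ?thesis using u by (simp add: al_ng_al)
  qed
  define N where "N s = \<mu> a (\<mu> (ng d) (\<mu> (ng b) s))" for s
  define y1 y2 where "y1 = \<mu> a (ng d)" and "y2 = \<mu> b (ng d)"
  have y: "\<not> sim y1 pinf" "\<not> sim y2 pinf"
    unfolding y1_def y2_def using mu_closed a b u by blast+
  have be_c: "be (ng c) s = al (ng a) (al y1 (N (al y2 (al b s))))" for s
  proof -
    have "be b s = al b (\<mu> (ng b) (al b s))"
      using be_aba[OF ngs(2)] b by (simp add: ng_ng unitD)
    then have "be (ng c) s = al (ng a) (\<mu> a (al (ng d) (\<mu> (ng b) (al b s))))"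
      unfolding ngc using be_aba[OF a] by (simp add: ngd)
    \<comment> \<open>The middle factor is split so that its outer \<open>be\<close> parts can be
      pulled through \<open>\<mu> a\<close> and \<open>\<mu> (ng b)\<close>, where they become
      elements of \<open>U pinf\<close>.\<close>
    also have "al (ng d) (\<mu> (ng b) (al b s)) = be (ng d) (\<mu> (ng d) (be (ng d) (\<mu> (ng b) (al b s))))"
      by (rule al_bab[OF d(1)])
    also have "be (ng d) (\<mu> (ng b) (al b s)) = \<mu> (ng b) (al y2 (al b s))"
      using mu_al[OF ngs(2) y(2)] mu_ng_mu(1)[OF b] by (simp add: y2_def)
    finally show ?thesis
      using mu_be[OF a, of "ng d"] u by (simp add: N_def y1_def)
  qed
  define v1 v2 where "v1 = al c \<circ> (al (ng a) \<circ> al y1)" and "v2 = al y2 \<circ> (al b \<circ> al c)"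
  have v: "v1 \<in> U pinf" "v2 \<in> U pinf"
    unfolding v1_def v2_def using u y by (auto intro!: U_comp al_U)
  have mc: "\<mu> c s = v1 (N (v2 s))" for s
    using mu_aba[OF c(1)] by (simp add: be_c v1_def v2_def)
  have N: "N p0 = pinf" "N pinf = p0" "\<And>s s'. N s = N s' \<Longrightarrow> s = s'"
  proof -
    fix s s' assume "N s = N s'"
    then show "s = s'"
      unfolding N_def using mu_ng_mu(1)[OF a] mu_ng_mu(1)[OF ngs(3)] mu_ng_mu(1)[OF ngs(2)] by metis
  qed (use mu_swap[OF a] mu_swap[OF ngs(3)] mu_swap[OF ngs(2)] in \<open>simp_all add: N_def\<close>)
  have "v1 (N (v2 p0)) = v1 (N p0)"
    using mc[of p0] mu_swap(1)[OF c(1)] N(1) U_fix[OF v(1)] by simp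
  then have "v2 p0 = id p0" using U_bij[OF v(1)] N(3) by (metis bij_pointE id_apply)
  then have v2: "v2 = id" using U_uniq[OF v(2) U_id basis'] by blast
  have "v1 p0 = id p0"
    using mc[of pinf] mu_swap(2)[OF c(1)] N(2) v2 by simp
  then have "v1 = id" using U_uniq[OF v(1) U_id basis'] by blast
  then show ?thesis using mc v2 by (simp add: N_def)
qed

lemma mu_cong: "unit a \<Longrightarrow> unit b \<Longrightarrow> sim a b \<Longrightarrow> sim (\<mu> a t) (\<mu> b t)"
  by (simp add: mu_bab) (intro al_cong flip.al_cong ng_cong sim_refl unitD; assumption)

end

text \<open>The default 0 keeps the map additive for every \<open>b\<close>, as \<open>M_add\<close>
  demands additivity outside the units too.\<close>

definition lift_mu :: "'a set \<Rightarrow> ('a \<Rightarrow> 'a \<Rightarrow> 'a) \<Rightarrow> 'a monoid \<Rightarrow> 'a monoid \<Rightarrow> 'a \<Rightarrow> 'a group_product \<Rightarrow> 'a group_product" where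
  "lift_mu B m G H b u = (if b \<in> B then embed H (m b (proj G u)) else 0)"

definition lift_triple :: "'a monoid \<Rightarrow> 'a monoid \<Rightarrow> ('a \<Rightarrow> 'a \<Rightarrow> 'a \<Rightarrow> 'a) \<Rightarrow> 'a group_product \<Rightarrow> 'a group_product \<Rightarrow> 'a group_product \<Rightarrow> 'a group_product" where
  "lift_triple V W P x y z = embed V (P (proj V x) (proj V z) (proj W y))"

text \<open>The groups stay abstract, with products fixed on the carriers only, because both
  \<open>Vminus\<close> and the intrinsic opposite group \<open>Vplus sim U pinf p0\<close> have to
  be inserted for \<open>Gm\<close>.\<close>

locale moufang_groups = special_moufang sim U p0 pinf
  for sim :: "'a \<Rightarrow> 'a \<Rightarrow> bool" and U p0 pinf +
  fixes Gp Gm :: "'a monoid"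
  assumes Gp: "carrier Gp = {x. \<not> sim x pinf}" "one Gp = p0"
    "\<And>x z. \<not> sim x pinf \<Longrightarrow> \<not> sim z pinf \<Longrightarrow> x \<otimes>\<^bsub>Gp\<^esub> z = al z x"
    and Gm: "carrier Gm = {x. \<not> sim x p0}" "one Gm = pinf"
    "\<And>x z. \<not> sim x p0 \<Longrightarrow> \<not> sim z p0 \<Longrightarrow> x \<otimes>\<^bsub>Gm\<^esub> z = be z x"

sublocale moufang_groups \<subseteq> flip: moufang_groups sim U pinf p0 Gm Gp
  by unfold_locales (simp_all add: Gp Gm)

context moufang_groups
begin

lemma comm_Gp: "comm_group Gp"
proof (rule comm_groupI)
  fix x y z assume xyz: "x \<in> carrier Gp" "y \<in> carrier Gp" "z \<in> carrier Gp"
  then show "x \<otimes>\<^bsub>Gp\<^esub> y \<otimes>\<^bsub>Gp\<^esub> z = x \<otimes>\<^bsub>Gp\<^esub> (y \<otimes>\<^bsub>Gp\<^esub> z)"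
    by (simp add: Gp al_closed al_add)
next
  fix x y assume xy: "x \<in> carrier Gp" "y \<in> carrier Gp"
  then show "x \<otimes>\<^bsub>Gp\<^esub> y \<in> carrier Gp" by (simp add: Gp al_closed)
  show "x \<otimes>\<^bsub>Gp\<^esub> y = y \<otimes>\<^bsub>Gp\<^esub> x" using xy al_comm by (simp add: Gp)
next
  show "\<one>\<^bsub>Gp\<^esub> \<in> carrier Gp" using basis by (simp add: Gp)
next
  fix x assume x: "x \<in> carrier Gp"
  then show "\<one>\<^bsub>Gp\<^esub> \<otimes>\<^bsub>Gp\<^esub> x = x" using basis by (simp add: Gp al_0)
  show "\<exists>y\<in>carrier Gp. y \<otimes>\<^bsub>Gp\<^esub> x = \<one>\<^bsub>Gp\<^esub>"
    using x by (intro bexI[of _ "ng x"]) (simp_all add: Gp ng_closed al_x_ng)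
qed

lemma inv_Gp:
  assumes x: "\<not> sim x pinf"
  shows "inv\<^bsub>Gp\<^esub> x = ng x"
proof -
  interpret comm_group Gp by (rule comm_Gp)
  show ?thesis
    by (rule inv_equality) (use x in \<open>simp_all add: Gp ng_closed al_x_ng\<close>)
qed

definition "units = {x. unit x}"

text \<open>The negatives of the two groups are known to agree on units; the default elsewhere makes
  \<open>ngB\<close> and its mirror image equal as functions.\<close>

definition "ngB b = (if unit b then ng b else b)"

abbreviation "i \<equiv> embed Gp"

abbreviation "M \<equiv> lift_mu units \<mu> Gm Gp"
abbreviation "M' \<equiv> lift_mu units \<mu> Gp Gm"

lemma embed_al: "\<not> sim x pinf \<Longrightarrow> \<not> sim z pinf \<Longrightarrow> i (al z x) = i x + i z"
  using embed_mult[OF comm_Gp, of x z] by (simp add: Gp)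

lemma embed_ng: "\<not> sim x pinf \<Longrightarrow> i (ng x) = - i x"
  using embed_inv[OF comm_Gp, of x] by (simp add: Gp inv_Gp)

lemma embed_in: "\<not> sim x pinf \<Longrightarrow> i x \<in> embedded Gp"
  by (rule embed_in_embedded) (simp add: Gp)

lemma embed_eq: "\<not> sim x pinf \<Longrightarrow> \<not> sim y pinf \<Longrightarrow> i x = i y \<longleftrightarrow> x = y"
  using embed_inj[OF comm_Gp, of x y] by (simp add: Gp)

lemma proj_i: "\<not> sim x pinf \<Longrightarrow> proj Gp (i x) = x"
  by (rule proj_embed[OF comm_Gp]) (simp add: Gp)

lemma proj_notsim: "\<not> sim (proj Gp u) pinf"
  using proj_closed[OF comm_Gp, of u] by (simp add: Gp)

lemma embeddedE: 
  assumes "u \<in> embedded Gp" obtains x where "\<not> sim x pinf" "u = i x"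
  using assms by (auto simp: embedded_def Gp)

lemma embed_unit: "\<not> sim x pinf \<Longrightarrow> i x \<in> i ` units \<longleftrightarrow> \<not> sim x p0"
  using embed_eq unitD(2) by (auto simp: units_def image_iff unit_el_def)

lemma unitsD: "b \<in> units \<Longrightarrow> unit b"
  by (simp add: units_def)

lemma embed_diff: "\<not> sim x pinf \<Longrightarrow> \<not> sim z pinf \<Longrightarrow> i x - i z = i (al (ng z) x)"
  by (simp add: embed_al ng_closed embed_ng)

lemma embed_diff_nonunit:
  "\<not> sim x pinf \<Longrightarrow> \<not> sim z pinf \<Longrightarrow> i x - i z \<notin> i ` units \<longleftrightarrow> sim x z"
proof -
  assume *: "\<not> sim x pinf" "\<not> sim z pinf"
  have "sim (al (ng z) x) p0 \<longleftrightarrow> sim (al z (al (ng z) x)) (al z p0)"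
    using * al_sim by blast
  then show ?thesis
    using * by (simp add: embed_diff embed_unit al_closed ng_closed al_ng_al al_0)
qed

end

section \<open>Special Moufang sets as unit pairs\<close>

context moufang_groups
begin

abbreviation "j \<equiv> embed Gm"

lemma M_embed: "b \<in> units \<Longrightarrow> \<not> sim y p0 \<Longrightarrow> M b (j y) = i (\<mu> b y)"
  by (simp add: lift_mu_def flip.proj_i)

lemma M'_embed: "b \<in> units \<Longrightarrow> \<not> sim x pinf \<Longrightarrow> M' b (i x) = j (\<mu> b x)"
  by (simp add: lift_mu_def proj_i)

lemma ngB: "b \<in> units \<Longrightarrow> ngB b = ng b" "b \<in> units \<Longrightarrow> ng b \<in> units"
  by (simp_all add: units_def ngB_def unit_ng)

lemma unit_pair: "unit_pair units ngB i j M M' (embedded Gp) (embedded Gm)"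
proof
  show "0 \<in> embedded Gp" by (rule embedded_zero[OF comm_Gp])
  show "x + x' \<in> embedded Gp" if "x \<in> embedded Gp" "x' \<in> embedded Gp" for x x'
    by (rule embedded_add[OF comm_Gp that])
  show "- x \<in> embedded Gp" if "x \<in> embedded Gp" for x
    by (rule embedded_uminus[OF comm_Gp that])
  show "units \<noteq> {}" using ex_unit by (auto simp: units_def)
  show "0 \<notin> i ` units"
    using embed_unit[of p0] embed_one[OF comm_Gp] basis sim_refl by (simp add: Gp)
  show "M b (y + y') = M b y + M b y'" for b y y'
  proof -
    have "proj Gm (y + y') = be (proj Gm y') (proj Gm y)"
      using flip.proj_notsim by (simp add: proj_add[OF flip.comm_Gp] Gm)
    then show ?thesis
      using flip.proj_notsim by (simp add: lift_mu_def units_def mu_be embed_al mu_closed)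
  qed
next
  fix b assume b: "b \<in> units"
  note ub = unitsD[OF b]
  show "ngB b \<in> units" "ngB (ngB b) = b" "i b \<in> embedded Gp" "i (ngB b) = - i b"
    using b ub unitD by (simp_all add: ngB ng_ng embed_in embed_ng)
  show "i b + i b \<in> i ` units"
    using mult2[OF ub] ub unitD by (simp flip: embed_al) (simp add: units_def)
  have "i b + i b + i b = i (al b (al b b))"
    using mult2[OF ub] ub unitD by (simp add: embed_al)
  then show "i b + i b + i b \<in> i ` units"
    using mult3[OF ub] by (simp add: units_def)
  show "M b y \<in> embedded Gp" if "y \<in> embedded Gm" for y
    using that b ub by (elim flip.embeddedE) (simp add: M_embed embed_in mu_closed)
  show "M b (M' (ngB b) x) = x" if "x \<in> embedded Gp" for x
    using that b ub by (elim embeddedE) (simp add: ngB M_embed M'_embed mu_closed unit_ng mu_ng_mu)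
  show "M b (j b) = - i b"
    using b ub unitD by (simp add: M_embed mu_self embed_ng)
next
  show "inj_on i units"
    using embed_eq unitsD unitD by (auto intro!: inj_onI)
next
  fix x x' assume "x \<in> embedded Gp" "x' \<in> embedded Gp" and n: "x \<notin> i ` units" "x' \<notin> i ` units"
  then obtain a a' where a: "\<not> sim a pinf" "x = i a" "\<not> sim a' pinf" "x' = i a'"
    by (auto elim!: embeddedE)
  then have "sim a p0" "sim a' p0" using n embed_unit by auto
  then have "sim (al a' a) p0"
    using al_sim[of a' a p0] al_0[of a'] a sim_trans by metis
  then show "x + x' \<notin> i ` units"
    using a embed_unit[of "al a' a"] by (simp add: embed_al al_closed)
next
  fix a b assume a: "a \<in> units" and b: "b \<in> units"
  note u = unitsD[OF a] unitsD[OF b]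
  note ud = unitD[OF u(1)] unitD[OF u(2)]
  show "\<exists>c\<in>units. i c = M a (j b) \<and> j c = M' a (i b) \<and>
      (\<forall>y\<in>embedded Gm. M c y = M a (M' (ngB b) (M (ngB a) y)))"
  proof (intro bexI conjI ballI)
    show c: "\<mu> a b \<in> units" using u mu_unit by (simp add: units_def)
    show "i (\<mu> a b) = M a (j b)" "j (\<mu> a b) = M' a (i b)"
      using a ud by (simp_all add: M_embed M'_embed)
    fix y assume "y \<in> embedded Gm"
    then show "M (\<mu> a b) y = M a (M' (ngB b) (M (ngB a) y))"
      by (elim flip.embeddedE)
        (simp add: M_embed M'_embed c ngB a b mu_closed mu_conj u unit_ng)
  qed
  fix y assume "i a - i b \<notin> i ` units" and y: "y \<in> embedded Gm"
  then have "sim a b" using embed_diff_nonunit ud by simp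
  then have "sim (\<mu> a t) (\<mu> b t)" for t by (rule mu_cong[OF u])
  with y show "M a y - M b y \<notin> i ` units"
    by (elim flip.embeddedE) (simp add: M_embed a b embed_diff_nonunit mu_closed u)
next
  fix a b d assume a: "a \<in> units" and b: "b \<in> units" and d: "d \<in> units" and eq: "i d = i a - i b"
  note u = unitsD[OF a] unitsD[OF b] unitsD[OF d]
  note ud = unitD[OF u(1)] unitD[OF u(2)] unitD[OF u(3)]
  have d': "d = al (ng b) a"
    using eq ud by (simp add: embed_diff embed_eq al_closed)
  let ?c = "be (ng b) a"
  \<comment> \<open>The difference \<open>d\<close> is a unit, so \<open>a\<close> and
    \<open>b\<close> are inequivalent; this keeps \<open>?c\<close> away from
    \<open>pinf\<close>.\<close>
  have "\<not> sim a b" 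
    using embed_diff_nonunit[of a b] ud eq d by (metis imageI)
  moreover have "be b pinf = b" "be b p0 = p0"
    using flip.al_0 flip.al_pinf ud by auto
  ultimately have "\<not> sim ?c pinf" "\<not> sim ?c p0"
    using flip.al_sim[of b ?c pinf] flip.al_sim[of b ?c p0] ud be_ng_be(2)[OF u(2), of a] by auto
  then have c: "unit ?c" by (simp add: unit_el_def)
  show "\<exists>c\<in>units. j c = j a - j b \<and> i c = M b (j d) - i b \<and>
      (\<forall>x\<in>embedded Gp. M' c x = M' a (M (ngB d) (M' (ngB b) x)))"
  proof (intro bexI conjI ballI)
    show cu: "?c \<in> units" using c by (simp add: units_def)
    show "j ?c = j a - j b"
      using ud by (simp add: flip.embed_diff spec u)
    have "i ?c + i b = i (al b ?c)"
      using ud unitD[OF c] by (simp add: embed_al)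
    also have "\<dots> = M b (j d)"
      using M_embed[OF b ud(9)] unfolding d' mu_hua1[OF u(1,2)] by simp
    finally show "i ?c = M b (j d) - i b" by (simp add: algebra_simps)
    fix x assume "x \<in> embedded Gp"
    then show "M' ?c x = M' a (M (ngB d) (M' (ngB b) x))"
      by (elim embeddedE)
        (simp add: M_embed M'_embed cu ngB a b d mu_closed u unit_ng mu_hua2[OF u(1,2,3) d' c refl])
  qed
qed

end

section \<open>Triple products and involutivity of the \<open>\<mu>\<close>-maps\<close>

context moufang_groups
begin

lemma flip_units: "flip.units = units"
  by (simp add: units_def flip.units_def flip_unit)

lemma flip_ngB: "flip.ngB = ngB"
  by (simp add: fun_eq_iff ngB_def flip.ngB_def flip_unit spec)

lemma flip_lift_mu: "lift_mu units (mu U pinf p0) G H b = lift_mu units \<mu> G H (ngB b)"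
  by (simp add: fun_eq_iff lift_mu_def ngB_def units_def flip_mu unit_ng)

lemma two_sided_unit_pair: "two_sided_unit_pair units ngB i j M M' (embedded Gp) (embedded Gm)"
proof (rule two_sided_unit_pair.intro[OF unit_pair])
  show "unit_pair units ngB j i (\<lambda>b. M' (ngB b)) (\<lambda>b. M (ngB b)) (embedded Gm) (embedded Gp)"
    using flip.unit_pair unfolding flip_units flip_ngB flip_lift_mu .
qed

lemma triple_pair:
  assumes P: "biadd_extension Gp Gm unit \<mu> P"
  shows "triple_pair units ngB i j M M' (embedded Gp) (embedded Gm) (lift_triple Gp Gm P)"
proof -
  interpret two_sided_unit_pair units ngB i j M M' "embedded Gp" "embedded Gm" by (rule two_sided_unit_pair)
  have hom: "P x z \<in> hom Gm Gp" if "x \<in> carrier Gp" "z \<in> carrier Gp" for x z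
    using P that unfolding biadd_extension_def by simp
  have clo: "P x z y \<in> carrier Gp" if "x \<in> carrier Gp" "z \<in> carrier Gp" "y \<in> carrier Gm" for x y z
    using hom[OF that(1,2)] that(3) by (auto simp: hom_def)
  note prjc = proj_closed[OF comm_Gp] proj_closed[OF flip.comm_Gp]
  note prja = proj_add[OF comm_Gp] proj_add[OF flip.comm_Gp]
  show ?thesis
  proof unfold_locales
    fix x x' y y' z z'
    show "lift_triple Gp Gm P (x + x') y z = lift_triple Gp Gm P x y z + lift_triple Gp Gm P x' y z"
      "lift_triple Gp Gm P x y (z + z') = lift_triple Gp Gm P x y z + lift_triple Gp Gm P x y z'"
      using P unfolding biadd_extension_def
      by (simp_all add: lift_triple_def prja prjc clo embed_mult[OF comm_Gp])
    show "lift_triple Gp Gm P x (y + y') z = lift_triple Gp Gm P x y z + lift_triple Gp Gm P x y' z"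
      using hom_mult[OF hom] by (simp add: lift_triple_def prja prjc clo embed_mult[OF comm_Gp])
  next
    fix x y z
    show "lift_triple Gp Gm P x y z \<in> embedded Gp"
      by (simp add: lift_triple_def embed_in_embedded clo prjc)
  next
    fix a b c y assume abc: "a \<in> units" "b \<in> units" "c \<in> units" "i a + i b = i c" and "y \<in> embedded Gm"
    then obtain t where t: "\<not> sim t p0" "y = j t" by (auto elim: flip.embeddedE)
    note u = abc(1-3)[THEN unitsD]
    note ud = unitD[OF u(1)] unitD[OF u(2)] unitD[OF u(3)]
    have c: "a \<otimes>\<^bsub>Gp\<^esub> b = c"
      using abc(4) ud by (simp add: Gp flip: embed_al) (simp add: embed_eq al_closed)
    have "P a b t = mu_pair Gp \<mu> a b t"
      using P c u ud t unfolding biadd_extension_def by (simp add: Gp Gm)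
    also have "i \<dots> = i (\<mu> c t) - i (\<mu> a t) - i (\<mu> b t)"
    proof -
      interpret comm_group Gp by (rule comm_Gp)
      have "\<mu> c t \<in> carrier Gp" "\<mu> a t \<in> carrier Gp" "\<mu> b t \<in> carrier Gp"
        using mu_closed u t by (auto simp: Gp)
      then show ?thesis
        by (simp add: mu_pair_def c embed_mult[OF comm_Gp] embed_inv[OF comm_Gp])
    qed
    finally show "lift_triple Gp Gm P (i a) y (i b) = M c y - M a y - M b y"
      using abc t ud by (simp add: lift_triple_def proj_i flip.proj_i M_embed)
  qed
qed

lemma mu_involution:
  assumes P: "biadd_extension Gp Gm unit \<mu> P" and a: "unit a"
  shows "\<mu> a (\<mu> a t) = t" and "\<mu> (ng a) = \<mu> a"
proof -
  interpret triple_pair units ngB i j M M' "embedded Gp" "embedded Gm" "lift_triple Gp Gm P" by (rule triple_pair[OF P])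
  have au: "a \<in> units" using a by (simp add: units_def)
  have plus: "\<mu> a (\<mu> a t) = t" if t: "\<not> sim t pinf" for t
  proof -
    have "M' (ngB a) (i t) = M' a (i t)"
      by (rule involution[OF au embed_in[OF t]])
    then have "j (\<mu> (ng a) t) = j (\<mu> a t)"
      using t by (simp add: M'_embed au ngB)
    then have "\<mu> (ng a) t = \<mu> a t"
      using flip.embed_eq mu_closed(2)[OF a t] mu_closed(2)[OF unit_ng[OF a] t] by simp
    then show ?thesis using mu_ng_mu(2)[OF a, of t] by simp
  qed
  have all: "\<mu> a (\<mu> a t) = t" for t
  proof (cases "sim t pinf")
    \<comment> \<open>Points equivalent to \<open>pinf\<close> lie outside \<open>V^+\<close>, but
      their images under \<open>\<mu> a\<close> do not; the claim there is cancelled back.\<close>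
    case True
    then have "\<not> sim t p0" using basis sim_sym sim_trans by blast
    then have "\<mu> a (\<mu> a (\<mu> a t)) = \<mu> a t" using plus mu_closed(1)[OF a] by blast
    then show ?thesis using mu_ng_mu(1)[OF a] by metis
  qed (rule plus)
  then show "\<mu> a (\<mu> a t) = t" .
  show "\<mu> (ng a) = \<mu> a"
    using all mu_ng_mu(1)[OF a] by (metis ext)
qed

end

context moufang_groups
begin

lemma involutive_pair:
  assumes P: "biadd_extension Gp Gm unit \<mu> P" and P': "biadd_extension Gm Gp unit \<mu> P'"
  shows "involutive_pair units ngB i j M M' (embedded Gp) (embedded Gm) (lift_triple Gp Gm P) (lift_triple Gm Gp P')"
proof (rule involutive_pair.intro)
  have eq: "M (ngB b) = M b" "M' (ngB b) = M' b" for b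
    using mu_involution(2)[OF P] by (simp_all add: fun_eq_iff lift_mu_def ngB_def units_def unit_ng)
  have flip_biadd: "biadd_extension Gm Gp flip.unit (mu U pinf p0) P'"
    using P' flip_mu mu_involution(2)[OF P] flip_unit
    unfolding biadd_extension_def mu_pair_def by simp
  show "triple_pair units ngB i j M M' (embedded Gp) (embedded Gm) (lift_triple Gp Gm P)"
    by (rule triple_pair[OF P])
  show "triple_pair units ngB j i M' M (embedded Gm) (embedded Gp) (lift_triple Gm Gp P')"
    using flip.triple_pair[OF flip_biadd] unfolding flip_units flip_ngB flip_lift_mu eq .
  show "involutive_pair_axioms units ngB M M'"
    using eq by (simp add: involutive_pair_axioms_def)
qed

end

section \<open>The Jordan pair\<close>

lemma bij_betw_transfer:
  assumes e: "bij_betw e C D" and F: "bij_betw F D D"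
    and f: "\<And>x. x \<in> C \<Longrightarrow> f x \<in> C" "\<And>x. x \<in> C \<Longrightarrow> e (f x) = F (e x)"
  shows "bij_betw f C C"
proof -
  have "bij_betw (F \<circ> e) C D" by (rule bij_betw_trans[OF e F])
  then have "bij_betw (e \<circ> f) C D"
    by (rule bij_betw_cong[THEN iffD1, rotated]) (simp add: f)
  then show ?thesis
    using bij_betw_comp_iff2[OF e, of f C] f by blast
qed

locale jordan_moufang = moufang_groups sim U p0 pinf Gp Gm
  for sim :: "'a \<Rightarrow> 'a \<Rightarrow> bool" and U p0 pinf and Gp Gm :: "'a monoid" +
  fixes P P' :: "'a \<Rightarrow> 'a \<Rightarrow> 'a \<Rightarrow> 'a"
  assumes P: "biadd_extension Gp Gm unit \<mu> P"
    and P': "biadd_extension Gm Gp unit \<mu> P'"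

sublocale jordan_moufang \<subseteq> flip: jordan_moufang sim U pinf p0 Gm Gp P' P
proof unfold_locales
  have "mu U pinf p0 x = \<mu> x" if "unit x" for x
    using flip_mu[OF that] mu_involution(2)[OF P that] by simp
  then show "biadd_extension Gm Gp flip.unit (mu U pinf p0) P'"
    "biadd_extension Gp Gm flip.unit (mu U pinf p0) P"
    using P P' flip_unit unfolding biadd_extension_def mu_pair_def by simp_all
qed

sublocale jordan_moufang \<subseteq> J: involutive_pair units ngB i j M M' "embedded Gp" "embedded Gm" "lift_triple Gp Gm P" "lift_triple Gm Gp P'"
  by (rule involutive_pair[OF P P'])

context jordan_moufang
begin

sublocale Gp: comm_group Gp by (rule comm_Gp)

abbreviation "T \<equiv> lift_triple Gp Gm P"
definition "Qp x y = half Gp (P x x y)"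

lemma carr: "x \<in> carrier Gp \<longleftrightarrow> \<not> sim x pinf"
  by (simp add: Gp)

lemma i_in: "x \<in> carrier Gp \<Longrightarrow> i x \<in> embedded Gp"
  by (rule embed_in_embedded)

lemma i_eq: "x \<in> carrier Gp \<Longrightarrow> y \<in> carrier Gp \<Longrightarrow> i x = i y \<longleftrightarrow> x = y"
  by (rule embed_inj[OF comm_Gp])

lemma i_mult: "x \<in> carrier Gp \<Longrightarrow> y \<in> carrier Gp \<Longrightarrow> i (x \<otimes>\<^bsub>Gp\<^esub> y) = i x + i y"
  by (rule embed_mult[OF comm_Gp])

lemma i_inv: "x \<in> carrier Gp \<Longrightarrow> i (inv\<^bsub>Gp\<^esub> x) = - i x"
  by (rule embed_inv[OF comm_Gp])

lemma i_unit: "x \<in> carrier Gp \<Longrightarrow> i x \<in> i ` units \<longleftrightarrow> \<not> sim x p0"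
  using embed_unit carr by simp

lemma P_closed: "x \<in> carrier Gp \<Longrightarrow> z \<in> carrier Gp \<Longrightarrow> y \<in> carrier Gm \<Longrightarrow> P x z y \<in> carrier Gp"
  using P unfolding biadd_extension_def hom_def by blast

lemma P_add: "x \<in> carrier Gp \<Longrightarrow> x' \<in> carrier Gp \<Longrightarrow> z \<in> carrier Gp \<Longrightarrow> y \<in> carrier Gm \<Longrightarrow>
    P (x \<otimes>\<^bsub>Gp\<^esub> x') z y = P x z y \<otimes>\<^bsub>Gp\<^esub> P x' z y"
  "x \<in> carrier Gp \<Longrightarrow> x' \<in> carrier Gp \<Longrightarrow> z \<in> carrier Gp \<Longrightarrow> y \<in> carrier Gm \<Longrightarrow>
    P z (x \<otimes>\<^bsub>Gp\<^esub> x') y = P z x y \<otimes>\<^bsub>Gp\<^esub> P z x' y"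
  "x \<in> carrier Gp \<Longrightarrow> z \<in> carrier Gp \<Longrightarrow> y \<in> carrier Gm \<Longrightarrow> y' \<in> carrier Gm \<Longrightarrow>
    P x z (y \<otimes>\<^bsub>Gm\<^esub> y') = P x z y \<otimes>\<^bsub>Gp\<^esub> P x z y'"
  using P unfolding biadd_extension_def hom_def by blast+

lemma i_ex2: "a \<in> carrier Gp \<Longrightarrow> \<exists>!h. h \<in> carrier Gp \<and> h \<otimes>\<^bsub>Gp\<^esub> h = a"
proof -
  assume a: "a \<in> carrier Gp"
  obtain u where "u \<in> embedded Gp" "u + u = i a" using J.halve_ex[OF i_in[OF a]] by blast
  then obtain h where h: "h \<in> carrier Gp" "i h + i h = i a" by (auto simp: embedded_def)
  show ?thesis
  proof (rule ex1I[of _ h])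
    show "h \<in> carrier Gp \<and> h \<otimes>\<^bsub>Gp\<^esub> h = a"
      using h a by (simp flip: i_mult i_eq)
    fix g assume g: "g \<in> carrier Gp \<and> g \<otimes>\<^bsub>Gp\<^esub> g = a"
    then have "i g + i g = i h + i h" using h by (simp flip: i_mult)
    then show "g = h" using J.cancel2[of "i g" "i h"] g h i_in i_eq by blast
  qed
qed

lemma i_ex3: "a \<in> carrier Gp \<Longrightarrow> \<exists>!h. h \<in> carrier Gp \<and> h \<otimes>\<^bsub>Gp\<^esub> h \<otimes>\<^bsub>Gp\<^esub> h = a"
proof -
  assume a: "a \<in> carrier Gp"
  obtain u where "u \<in> embedded Gp" "u + u + u = i a" using J.op.div3_dual[OF i_in[OF a]] by blast
  then obtain h where h: "h \<in> carrier Gp" "i h + i h + i h = i a" by (auto simp: embedded_def)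
  show ?thesis
  proof (rule ex1I[of _ h])
    show "h \<in> carrier Gp \<and> h \<otimes>\<^bsub>Gp\<^esub> h \<otimes>\<^bsub>Gp\<^esub> h = a"
      using h a by (simp flip: i_mult i_eq)
    fix g assume g: "g \<in> carrier Gp \<and> g \<otimes>\<^bsub>Gp\<^esub> g \<otimes>\<^bsub>Gp\<^esub> g = a"
    then have "i g + i g + i g = i h + i h + i h" using h by (simp flip: i_mult)
    then have "(i g - i h) + (i g - i h) + (i g - i h) = 0" by (simp add: algebra_simps)
    then have "i g - i h = 0" using J.tor3[of "i g - i h"] J.A_diff g h i_in by blast
    then show "g = h" using g h i_eq by simp
  qed
qed

lemma uniquely_divisible: "uniquely_divisible Gp 2" "uniquely_divisible Gp 3"
proof -
  have pow: "h [^]\<^bsub>Gp\<^esub> (2::nat) = h \<otimes>\<^bsub>Gp\<^esub> h" "h [^]\<^bsub>Gp\<^esub> (3::nat) = h \<otimes>\<^bsub>Gp\<^esub> h \<otimes>\<^bsub>Gp\<^esub> h"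
    if "h \<in> carrier Gp" for h
    using that by (simp_all add: numeral_2_eq_2 numeral_3_eq_3)
  show "uniquely_divisible Gp 2" "uniquely_divisible Gp 3"
    unfolding uniquely_divisible_def using i_ex2 i_ex3 by (simp_all add: pow cong: conj_cong)
qed

lemma half: "a \<in> carrier Gp \<Longrightarrow> half Gp a \<in> carrier Gp"
  "a \<in> carrier Gp \<Longrightarrow> half Gp a \<otimes>\<^bsub>Gp\<^esub> half Gp a = a"
  using theI'[OF i_ex2, of a] unfolding half_def by auto

lemma half_eq: "h \<in> carrier Gp \<Longrightarrow> h \<otimes>\<^bsub>Gp\<^esub> h = a \<Longrightarrow> half Gp a = h"
  using i_ex2[of a] half[of a] by auto

text \<open>Division by three serves to exclude 3-torsion in the scalar extensions.\<close>

definition "third a = (THE h. h \<in> carrier Gp \<and> h \<otimes>\<^bsub>Gp\<^esub> h \<otimes>\<^bsub>Gp\<^esub> h = a)"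

lemma third: "a \<in> carrier Gp \<Longrightarrow> third a \<in> carrier Gp"
  "a \<in> carrier Gp \<Longrightarrow> third a \<otimes>\<^bsub>Gp\<^esub> third a \<otimes>\<^bsub>Gp\<^esub> third a = a"
  using theI'[OF i_ex3, of a] unfolding third_def by auto

lemma third_eq: "h \<in> carrier Gp \<Longrightarrow> h \<otimes>\<^bsub>Gp\<^esub> h \<otimes>\<^bsub>Gp\<^esub> h = a \<Longrightarrow> third a = h"
  using i_ex3[of a] third[of a] by auto

lemma half_mult: "a \<in> carrier Gp \<Longrightarrow> b \<in> carrier Gp \<Longrightarrow> half Gp (a \<otimes>\<^bsub>Gp\<^esub> b) = half Gp a \<otimes>\<^bsub>Gp\<^esub> half Gp b"
proof (rule half_eq)
  assume ab: "a \<in> carrier Gp" "b \<in> carrier Gp"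
  have "half Gp a \<otimes>\<^bsub>Gp\<^esub> half Gp b \<otimes>\<^bsub>Gp\<^esub> (half Gp a \<otimes>\<^bsub>Gp\<^esub> half Gp b)
    = (half Gp a \<otimes>\<^bsub>Gp\<^esub> half Gp a) \<otimes>\<^bsub>Gp\<^esub> (half Gp b \<otimes>\<^bsub>Gp\<^esub> half Gp b)"
    using half(1)[OF ab(1)] half(1)[OF ab(2)] by (simp add: Gp.m_ac)
  then show "half Gp a \<otimes>\<^bsub>Gp\<^esub> half Gp b \<otimes>\<^bsub>Gp\<^esub> (half Gp a \<otimes>\<^bsub>Gp\<^esub> half Gp b) = a \<otimes>\<^bsub>Gp\<^esub> b"
    using half(2) ab by simp
qed (simp add: half)

lemma third_mult: "a \<in> carrier Gp \<Longrightarrow> b \<in> carrier Gp \<Longrightarrow> third (a \<otimes>\<^bsub>Gp\<^esub> b) = third a \<otimes>\<^bsub>Gp\<^esub> third b"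
proof (rule third_eq)
  assume ab: "a \<in> carrier Gp" "b \<in> carrier Gp"
  let ?a = "third a" and ?b = "third b"
  have "?a \<otimes>\<^bsub>Gp\<^esub> ?b \<otimes>\<^bsub>Gp\<^esub> (?a \<otimes>\<^bsub>Gp\<^esub> ?b) \<otimes>\<^bsub>Gp\<^esub> (?a \<otimes>\<^bsub>Gp\<^esub> ?b)
    = (?a \<otimes>\<^bsub>Gp\<^esub> ?a \<otimes>\<^bsub>Gp\<^esub> ?a) \<otimes>\<^bsub>Gp\<^esub> (?b \<otimes>\<^bsub>Gp\<^esub> ?b \<otimes>\<^bsub>Gp\<^esub> ?b)"
    using third(1)[OF ab(1)] third(1)[OF ab(2)] by (simp add: Gp.m_ac)
  then show "?a \<otimes>\<^bsub>Gp\<^esub> ?b \<otimes>\<^bsub>Gp\<^esub> (?a \<otimes>\<^bsub>Gp\<^esub> ?b) \<otimes>\<^bsub>Gp\<^esub> (?a \<otimes>\<^bsub>Gp\<^esub> ?b) = a \<otimes>\<^bsub>Gp\<^esub> b"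
    using third(2) ab by simp
qed (simp add: third)

lemma Qp_closed: "x \<in> carrier Gp \<Longrightarrow> y \<in> carrier Gm \<Longrightarrow> Qp x y \<in> carrier Gp"
  by (simp add: Qp_def half P_closed)

lemma Qp_double: "x \<in> carrier Gp \<Longrightarrow> y \<in> carrier Gm \<Longrightarrow> Qp x y \<otimes>\<^bsub>Gp\<^esub> Qp x y = P x x y"
  by (simp add: Qp_def half P_closed)

end

context jordan_moufang
begin

lemma i_P: "x \<in> carrier Gp \<Longrightarrow> z \<in> carrier Gp \<Longrightarrow> y \<in> carrier Gm \<Longrightarrow> i (P x z y) = T (i x) (j y) (i z)"
  by (simp add: lift_triple_def proj_embed[OF comm_Gp] proj_embed[OF flip.comm_Gp])

lemma i_Qp: "x \<in> carrier Gp \<Longrightarrow> y \<in> carrier Gm \<Longrightarrow> i (Qp x y) = J.Q (i x) (j y)"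
  by (rule J.halve_eq[symmetric]) (simp_all add: i_in Qp_closed Qp_double i_P flip: i_mult)

lemma qq_Qp:
  assumes "x \<in> carrier Gp" "z \<in> carrier Gp" "y \<in> carrier Gm"
  shows "qq Gp Qp x z y = P x z y"
proof -
  have "i (qq Gp Qp x z y) = J.Q (i x + i z) (j y) - J.Q (i x) (j y) - J.Q (i z) (j y)"
    using assms by (simp add: qq_def i_mult i_inv Qp_closed i_Qp)
  also have "\<dots> = i (P x z y)"
    using assms J.Q_add[of "i x" "i z" "j y"] by (simp add: i_in flip.i_in i_P)
  finally show ?thesis
    using assms i_eq[of "qq Gp Qp x z y" "P x z y"] by (simp add: qq_def Qp_closed P_closed)
qed

lemma P_sym: "x \<in> carrier Gp \<Longrightarrow> z \<in> carrier Gp \<Longrightarrow> y \<in> carrier Gm \<Longrightarrow> P x z y = P z x y"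
  using J.T_sym[of "i x" "j y" "i z"] i_eq[of "P x z y" "P z x y"]
  by (simp add: i_in flip.i_in P_closed flip: i_P)

lemma tensor_triple: "tensor_triple Gp Gm (\<lambda>x y z. P x z y) Qp"
proof (unfold_locales, goal_cases)
  case (5 x y z)
  then show ?case using P_sym by simp
next
  case (8 x y z)
  then show ?case by (simp add: trip_def qq_Qp)
qed (use P_closed P_add Qp_closed Qp_double in auto)

end

section \<open>Quadratic maps and invertibility\<close>

context jordan_moufang
begin

lemma tensor_pair_half:
  "tensor_pair_half Gp Gm (\<lambda>x y z. P x z y) Qp (\<lambda>y x w. P' y w x) flip.Qp (half Gp) third"
proof (intro tensor_pair_half.intro tensor_triple flip.tensor_triple, unfold_locales, goal_cases)
  case (7 x y u v z)
  let ?l = "P x (P u z v) y \<otimes>\<^bsub>Gp\<^esub> P u z (P' y v x)" and ?r = "P (P x u y) z v \<otimes>\<^bsub>Gp\<^esub> P u (P x z y) v"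
  note cl = 7 P_closed flip.P_closed i_in flip.i_in
  have "i ?l = i ?r"
    using J.five[of "i x" "j y" "i u" "j v" "i z"]
    by (simp add: cl i_mult i_P flip.i_P algebra_simps)
  then show ?case
    using i_eq[of ?l ?r] by (simp add: cl)
qed (use half half_mult third third_mult in auto)

lemma P_pow:
  assumes x: "x \<in> carrier Gp" and z: "z \<in> carrier Gp" and y: "y \<in> carrier Gm"
  shows "P (x [^]\<^bsub>Gp\<^esub> (n::nat)) z y = P x z y [^]\<^bsub>Gp\<^esub> n"
proof (induction n)
  case 0
  have "P \<one>\<^bsub>Gp\<^esub> z y \<otimes>\<^bsub>Gp\<^esub> P \<one>\<^bsub>Gp\<^esub> z y = P \<one>\<^bsub>Gp\<^esub> z y"
    using P_add(1)[of "\<one>\<^bsub>Gp\<^esub>" "\<one>\<^bsub>Gp\<^esub>" z y] z y by simp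
  then show ?case using P_closed[of "\<one>\<^bsub>Gp\<^esub>" z y] z y by (simp add: Gp.r_cancel_one')
next
  case (Suc n)
  then show ?case using P_add(1) x z y by simp
qed

lemma Qp_add:
  assumes "x \<in> carrier Gp" "z \<in> carrier Gp" "y \<in> carrier Gm"
  shows "Qp (x \<otimes>\<^bsub>Gp\<^esub> z) y = Qp x y \<otimes>\<^bsub>Gp\<^esub> Qp z y \<otimes>\<^bsub>Gp\<^esub> P x z y"
proof -
  have "i (Qp (x \<otimes>\<^bsub>Gp\<^esub> z) y) = i (Qp x y \<otimes>\<^bsub>Gp\<^esub> Qp z y \<otimes>\<^bsub>Gp\<^esub> P x z y)"
    using assms J.Q_add[of "i x" "i z" "j y"]
    by (simp add: i_mult Qp_closed P_closed i_Qp i_P i_in flip.i_in)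
  then show ?thesis using assms i_eq by (simp add: Qp_closed P_closed)
qed

lemma Qp_pow:
  assumes x: "x \<in> carrier Gp" and y: "y \<in> carrier Gm"
  shows "Qp (x [^]\<^bsub>Gp\<^esub> (n::nat)) y = Qp x y [^]\<^bsub>Gp\<^esub> (n * n)"
proof (induction n)
  case 0
  have "P \<one>\<^bsub>Gp\<^esub> \<one>\<^bsub>Gp\<^esub> y = \<one>\<^bsub>Gp\<^esub>" using P_pow[of x "\<one>\<^bsub>Gp\<^esub>" y 0] x y by simp
  then show ?case by (simp add: Qp_def half_eq)
next
  case (Suc n)
  \<comment> \<open>The exponents follow \<open>(n + 1)^2 = n^2 + 1 + 2n\<close>, the last term
    coming from \<open>{x y x} = 2 Q_x y\<close>.\<close>
  have "Qp (x [^]\<^bsub>Gp\<^esub> Suc n) y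
    = Qp x y [^]\<^bsub>Gp\<^esub> (n * n) \<otimes>\<^bsub>Gp\<^esub> Qp x y \<otimes>\<^bsub>Gp\<^esub> (Qp x y \<otimes>\<^bsub>Gp\<^esub> Qp x y) [^]\<^bsub>Gp\<^esub> n"
    using Suc x y by (simp add: Qp_add P_pow Qp_double)
  also have "(Qp x y \<otimes>\<^bsub>Gp\<^esub> Qp x y) [^]\<^bsub>Gp\<^esub> n = Qp x y [^]\<^bsub>Gp\<^esub> (n + n)"
    using Qp_closed[OF x y] by (simp add: Gp.nat_pow_distrib Gp.nat_pow_mult)
  also have "Qp x y [^]\<^bsub>Gp\<^esub> (n * n) \<otimes>\<^bsub>Gp\<^esub> Qp x y \<otimes>\<^bsub>Gp\<^esub> Qp x y [^]\<^bsub>Gp\<^esub> (n + n)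
    = Qp x y [^]\<^bsub>Gp\<^esub> (Suc (n * n) + (n + n))"
    using Qp_closed[OF x y] by (simp add: Gp.m_ac flip: Gp.nat_pow_mult)
  also have "Suc (n * n) + (n + n) = Suc n * Suc n" by simp
  finally show ?case .
qed

lemma Qp_inv:
  assumes "x \<in> carrier Gp" "y \<in> carrier Gm"
  shows "Qp (inv\<^bsub>Gp\<^esub> x) y = Qp x y"
proof -
  have "i (Qp (inv\<^bsub>Gp\<^esub> x) y) = i (Qp x y)"
    using assms by (simp add: i_Qp i_inv J.Q_uminus)
  then show ?thesis using assms i_eq by (simp add: Qp_closed)
qed

lemma quadratic_map: "quadratic_map Gp Gm Qp"
  unfolding quadratic_map_def
proof (intro conjI ballI allI)
  fix x assume x: "x \<in> carrier Gp"
  show "Qp x \<in> hom Gm Gp"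
  proof (rule homI)
    fix y y' assume y: "y \<in> carrier Gm" "y' \<in> carrier Gm"
    then show "Qp x (y \<otimes>\<^bsub>Gm\<^esub> y') = Qp x y \<otimes>\<^bsub>Gp\<^esub> Qp x y'"
      using x by (simp add: Qp_def P_add half_mult P_closed)
  qed (use x Qp_closed in auto)
  fix n :: int and y assume y: "y \<in> carrier Gm"
  show "Qp (x [^]\<^bsub>Gp\<^esub> n) y = Qp x y [^]\<^bsub>Gp\<^esub> (n * n)"
  proof (cases n rule: int_cases2)
    case (nonneg m)
    then show ?thesis
      using Qp_pow[OF x y, of m] by (simp add: int_pow_int flip: of_nat_mult)
  next
    case (nonpos m)
    then show ?thesis
      using Qp_pow[OF x y, of m] Qp_inv[of "x [^]\<^bsub>Gp\<^esub> m" y] x y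
      by (simp add: int_pow_int Gp.int_pow_neg flip: of_nat_mult)
  qed
next
  fix x1 x2 z y assume "x1 \<in> carrier Gp" "x2 \<in> carrier Gp" "z \<in> carrier Gp" "y \<in> carrier Gm"
  then show "qq Gp Qp (x1 \<otimes>\<^bsub>Gp\<^esub> x2) z y = qq Gp Qp x1 z y \<otimes>\<^bsub>Gp\<^esub> qq Gp Qp x2 z y"
    by (simp add: qq_Qp P_add)
qed

lemma Qp_unit: "unit x \<Longrightarrow> y \<in> carrier Gm \<Longrightarrow> Qp x y = \<mu> x y"
proof -
  assume x: "unit x" and y: "y \<in> carrier Gm"
  have xc: "x \<in> carrier Gp" using x unitD carr by blast
  have yc: "\<not> sim y p0" using y by (simp add: Gm)
  have "i (Qp x y) = i (\<mu> x y)"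
    using J.Q_unit[of x "j y"] M_embed[of x y] x y yc by (simp add: i_Qp xc units_def flip.i_in)
  then show ?thesis
    using i_eq Qp_closed[OF xc y] mu_closed(1)[OF x yc] carr by blast
qed

text \<open>For \<open>x\<close> equivalent to \<open>p0\<close> all values of \<open>Qp x\<close>
  are non-units, so an existing unit is missed; for a unit \<open>x\<close> the map is the
  involution \<open>\<mu> x\<close>.\<close>

lemma non_invertibles: "non_invertibles Gp Gm Qp = cls sim p0"
proof -
  have "x \<in> carrier Gp \<and> \<not> bij_betw (Qp x) (carrier Gm) (carrier Gp) \<longleftrightarrow> sim p0 x" for x
  proof (cases "sim x p0")
    case True
    then have x: "x \<in> carrier Gp" using basis sim_sym sim_trans carr by blast
    obtain e where e: "unit e" using ex_unit by blast
    have "\<not> bij_betw (Qp x) (carrier Gm) (carrier Gp)"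
    proof
      assume "bij_betw (Qp x) (carrier Gm) (carrier Gp)"
      moreover have "e \<in> carrier Gp" using e unitD carr by blast
      ultimately have "e \<in> Qp x ` carrier Gm" using bij_betw_imp_surj_on by blast
      then obtain y where y: "e = Qp x y" "y \<in> carrier Gm" by (rule imageE)
      have "i (Qp x y) \<notin> i ` units"
        using J.nonunit_ideal1(1)[OF i_in[OF x] _ flip.i_in[OF y(2)]] i_unit[OF x] True
        by (simp add: i_Qp[OF x y(2)])
      then show False using e by (simp add: units_def flip: y(1))
    qed
    then show ?thesis using x True sim_sym by blast
  next
    case False
    have "bij_betw (Qp x) (carrier Gm) (carrier Gp)" if "x \<in> carrier Gp"
    proof -
      have x: "unit x" using that False by (simp add: unit_el_def carr)
      have "bij_betw (\<mu> x) (carrier Gm) (carrier Gp)"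
        by (rule bij_betw_byWitness[where f' = "\<mu> x"])
          (use mu_involution(1)[OF P x] mu_closed x in \<open>auto simp: Gp Gm\<close>)
      then show ?thesis
        by (rule bij_betw_cong[THEN iffD1, rotated]) (simp add: Qp_unit x)
    qed
    then show ?thesis using False sim_sym by blast
  qed
  then show ?thesis
    by (auto simp: non_invertibles_def jp_invertible_def cls_def)
qed

lemma cls_iff: "x \<in> cls sim p0 \<longleftrightarrow> x \<in> carrier Gp \<and> i x \<notin> i ` units"
  using i_unit[of x] sim_sym[of x p0] sim_sym[of p0 x] sim_trans[of p0 x pinf] basis
  by (auto simp: cls_def carr)

lemma subgroup_cls: "subgroup (cls sim p0) Gp"
proof
  show "\<one>\<^bsub>Gp\<^esub> \<in> cls sim p0" by (simp add: Gp cls_def sim_refl)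
next
  fix x y assume "x \<in> cls sim p0" "y \<in> cls sim p0"
  then show "x \<otimes>\<^bsub>Gp\<^esub> y \<in> cls sim p0"
    using J.nonunit_add[of "i x" "i y"] by (simp add: cls_iff i_mult i_in)
next
  fix x assume "x \<in> cls sim p0"
  then show "inv\<^bsub>Gp\<^esub> x \<in> cls sim p0"
    using J.unit_uminus_iff[of "i x"] by (simp add: cls_iff i_inv)
qed (auto simp: cls_iff)

end

section \<open>The local ideal and the radical\<close>

context jordan_moufang
begin

lemma flip_nonunit: "y \<in> cls sim pinf \<longleftrightarrow> y \<in> carrier Gm \<and> j y \<notin> j ` units"
  using flip.cls_iff flip_units by simp

lemma ideal_cond: "ideal_cond Gp Gm Qp flip.Qp (cls sim p0) (cls sim pinf)"
  unfolding ideal_cond_def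
proof (intro ballI conjI)
  fix x y assume x: "x \<in> cls sim p0" and y: "y \<in> carrier Gm"
  have x': "x \<in> carrier Gp" "i x \<in> embedded Gp" "i x \<notin> i ` units" "j y \<in> embedded Gm"
    using x y cls_iff i_in flip.i_in by auto
  show "Qp x y \<in> cls sim p0"
    using J.nonunit_ideal1(1)[OF x'(2-4)] x' y by (simp add: cls_iff Qp_closed i_Qp)
  show "flip.Qp y x \<in> cls sim pinf"
    using J.flip.nonunit_ideal2(1)[OF x'(2-4)] x' y
    by (simp add: flip_nonunit flip.Qp_closed flip.i_Qp)
  fix z assume z: "z \<in> carrier Gp"
  show "trip Gp Qp x y z \<in> cls sim p0"
    using J.nonunit_ideal1(2)[OF x'(2-4) i_in[OF z]] x' y z
    by (simp add: trip_def qq_Qp cls_iff P_closed i_P)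
qed

lemma i_bergman:
  assumes "x \<in> carrier Gp" "y \<in> carrier Gm" "z \<in> carrier Gp"
  shows "bergman Gp Qp flip.Qp x y z \<in> carrier Gp"
    and "i (bergman Gp Qp flip.Qp x y z) = i z - T (i x) (j y) (i z) + J.Q (i x) (J.Q' (j y) (i z))"
  using assms by (simp_all add: bergman_def trip_def qq_Qp P_closed Qp_closed flip.Qp_closed
      i_mult i_inv i_P i_Qp flip.i_Qp)

lemma bij_i: "bij_betw i (carrier Gp) (embedded Gp)"
  unfolding embedded_def by (rule inj_on_imp_bij_betw) (auto intro!: inj_onI simp: i_eq)

text \<open>One inclusion is \<open>bergman_bij\<close>, transported along \<open>embed\<close>. For
  the other, the Bergman operator of a unit \<open>x\<close> at \<open>ng x\<close> is zero, and
  injectivity would identify \<open>x\<close> with the identity.\<close>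

lemma jp_rad: "jp_rad Gp Gm Qp flip.Qp = cls sim p0"
proof (intro Set.set_eqI iffI)
  fix x assume "x \<in> cls sim p0"
  then have x: "x \<in> carrier Gp" "i x \<in> embedded Gp" "i x \<notin> i ` units" using cls_iff i_in by auto
  have "quasi_invertible Gp Qp flip.Qp x y" if y: "y \<in> carrier Gm" for y
    unfolding quasi_invertible_def
    by (rule bij_betw_transfer[OF bij_i J.bergman_bij[OF x(2,3) flip.i_in[OF y]]])
      (use i_bergman x y in auto)
  then show "x \<in> jp_rad Gp Gm Qp flip.Qp" using x by (simp add: jp_rad_def)
next
  fix x assume "x \<in> jp_rad Gp Gm Qp flip.Qp"
  then have x: "x \<in> carrier Gp" "\<And>y. y \<in> carrier Gm \<Longrightarrow> quasi_invertible Gp Qp flip.Qp x y"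
    by (auto simp: jp_rad_def)
  show "x \<in> cls sim p0"
  proof (rule ccontr)
    assume "x \<notin> cls sim p0"
    then have "unit x" using x(1) sim_sym by (auto simp: cls_def unit_el_def carr)
    then have xu: "x \<in> units" and nx: "ng x \<in> carrier Gm" "ngB x = ng x"
      using unitD by (auto simp: units_def ngB_def Gm)
    have zero: "bergman Gp Qp flip.Qp x (ng x) z = \<one>\<^bsub>Gp\<^esub>" if z: "z \<in> carrier Gp" for z
    proof -
      have "i (bergman Gp Qp flip.Qp x (ng x) z) = i \<one>\<^bsub>Gp\<^esub>"
        using J.bergman_unit_inverse[OF xu i_in[OF z]] i_bergman(2)[OF x(1) nx(1) z] nx(2)
          embed_one[OF comm_Gp] by simp
      then show ?thesis using i_eq i_bergman(1)[OF x(1) nx(1) z] by simp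
    qed
    have inj: "inj_on (bergman Gp Qp flip.Qp x (ng x)) (carrier Gp)"
      using x(2)[OF nx(1)] unfolding quasi_invertible_def by (rule bij_betw_imp_inj_on)
    have "x = \<one>\<^bsub>Gp\<^esub>"
      by (rule inj_onD[OF inj _ x(1)]) (simp_all add: zero x(1))
    then show False using \<open>x \<notin> cls sim p0\<close> by (simp add: Gp cls_def sim_refl)
  qed
qed

end

context jordan_moufang
begin

theorem jordan_pair: "jordan_pair TYPE('r::comm_ring_1) Gp Gm Qp flip.Qp"
  unfolding jordan_pair_def
  using comm_Gp flip.comm_Gp quadratic_map flip.quadratic_map
    jp_identities_tensor[OF tensor_pair_half flip.tensor_pair_half]
    jp_identities_tensor[OF flip.tensor_pair_half tensor_pair_half] by blast

theorem jp_proper_ideal: "jp_proper_ideal Gp Gm Qp flip.Qp (cls sim p0) (cls sim pinf)"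
proof -
  obtain e where "unit e" using ex_unit by blast
  then have "e \<in> carrier Gp" "e \<notin> cls sim p0" using sim_sym by (auto simp: unit_el_def cls_def carr)
  then show ?thesis
    unfolding jp_proper_ideal_def jp_ideal_def
    using subgroup_cls flip.subgroup_cls ideal_cond flip.ideal_cond by auto
qed

theorem jp_local: "jp_local Gp Gm Qp flip.Qp"
  unfolding jp_local_def non_invertibles flip.non_invertibles by (rule jp_proper_ideal)

end

text \<open>Commutativity and the multiples of units are assumed on the side of \<open>pinf\<close>;
  the map \<open>\<mu> e\<close>, or another \<open>\<mu>\<close>-map, carries them to the side of
  \<open>p0\<close>.\<close>

lemma (in based_moufang) special_moufangI:
  assumes e: "unit e" and special: "special sim U p0 pinf (\<mu> e)"
    and comm: "\<forall>g\<in>U pinf. \<forall>h\<in>U pinf. g \<circ> h = h \<circ> g"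
    and mult: "\<forall>x. unit x \<longrightarrow> unit (smul U p0 pinf x 2) \<and> unit (smul U p0 pinf x 3)"
  shows "special_moufang sim U p0 pinf"
proof unfold_locales
  show "g \<circ> h = h \<circ> g" if "g \<in> U pinf" "h \<in> U pinf" for g h using comm that by blast
  show "g \<circ> h = h \<circ> g" if "g \<in> U p0" "h \<in> U p0" for g h
    by (rule commutative_flip[OF _ that]) (use comm in blast)
  show "negp U pinf p0 x = ng x" if "unit x" for x
    by (rule special_flip[OF e special that])
  show mult2: "unit (al x x)" and mult3: "unit (al x (al x x))" if x: "unit x" for x
  proof -
    have "al x p0 = x" using x by (intro al_0) (simp add: unit_el_def)
    then have "smul U p0 pinf x 2 = al x x" "smul U p0 pinf x 3 = al x (al x x)"
      by (simp_all add: smul_def numeral_2_eq_2 numeral_3_eq_3)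
    moreover have "unit (smul U p0 pinf x 2)" "unit (smul U p0 pinf x 3)"
      using mult x by blast+
    ultimately show "unit (al x x)" "unit (al x (al x x))" by simp_all
  qed
  fix x assume x: "unit x"
  note m = mu_swap[OF e]
  let ?y = "inv_into UNIV (\<mu> e) x"
  have y: "\<mu> e ?y = x" by (rule lg_inv_f(2)[OF m(3)])
  then have uy: "unit ?y"
    using x mu_sim[OF e, of ?y p0] mu_sim[OF e, of ?y pinf] m by (auto simp: unit_el_def)
  then have yp: "\<not> sim ?y pinf" by (simp add: unit_el_def)
  have "\<mu> e (al ?y ?y) = be x x" "\<mu> e (al ?y (al ?y ?y)) = be x (be x x)"
    using mu_al[OF e yp] y by simp_all
  then show "unit (be x x)" "unit (be x (be x x))"
    using mu_unit[OF e mult2[OF uy]] mu_unit[OF e mult3[OF uy]] by simp_all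
qed

section \<open>Comparison of \<open>Vminus\<close> with the intrinsic opposite group\<close>

context special_moufang
begin

lemma moufang_groups_Vplus: "moufang_groups sim U p0 pinf (Vplus sim U p0 pinf) (Vplus sim U pinf p0)"
  by unfold_locales (use basis basis' in \<open>auto simp: Vplus_def al_0 flip.al_0\<close>)

lemma mult_Vminus:
  assumes e: "unit e" and y: "\<not> sim y p0" and w: "\<not> sim w p0"
  shows "y \<otimes>\<^bsub>Vminus sim U p0 pinf (\<mu> e)\<^esub> w = \<mu> e (\<mu> e (be w y))"
proof -
  note m = mu_swap[OF e]
  have gamma: "gamma U p0 pinf (\<mu> e) x t = be (\<mu> e x) t" if "\<not> sim x pinf" for x t
    using mu_al[OF e that] lg_inv_f[OF m(3)] by (simp add: gamma_def)
  have n: "\<not> sim (\<mu> e y) pinf" "\<not> sim (\<mu> e w) pinf" using mu_closed(1)[OF e] y w by auto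
  have "\<mu> e (\<mu> e (be w y)) = be (\<mu> e (\<mu> e w)) (\<mu> e (\<mu> e y))"
    using mu_be[OF e w] mu_al[OF e n(2)] by simp
  then show ?thesis
    using flip.al_0[OF mu_closed(2)[OF e n(1)]] by (simp add: Vminus_def gamma n)
qed

text \<open>The addition of \<open>Vminus\<close> uses \<open>\<tau>\<close> where the intrinsic one uses its inverse, so a priori
  it differs from the latter by the automorphism \<open>\<tau> \<circ> \<tau>\<close>. Homomorphisms into \<open>Vplus\<close>
  absorb that automorphism.\<close>

lemma biadd_extension_Vplus:
  assumes e: "unit e"
    and P: "biadd_extension (Vplus sim U p0 pinf) (Vminus sim U p0 pinf (\<mu> e)) unit \<mu> P"
  shows "biadd_extension (Vplus sim U p0 pinf) (Vplus sim U pinf p0) unit \<mu> P"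
proof -
  let ?V = "Vplus sim U p0 pinf" and ?W = "Vplus sim U pinf p0" and ?N = "Vminus sim U p0 pinf (\<mu> e)"
  interpret G: moufang_groups sim U p0 pinf ?V ?W by (rule moufang_groups_Vplus)
  interpret V: comm_group ?V by (rule G.comm_Gp)
  have c: "carrier ?W = {y. \<not> sim y p0}" "carrier ?N = {y. \<not> sim y p0}"
    by (simp_all add: Vplus_def Vminus_def)
  have "h \<in> hom ?W ?V" if "h \<in> hom ?N ?V" for h
  proof -
    note m = mu_swap[OF e]
    have hc: "h y \<in> carrier ?V" if "\<not> sim y p0" for y
      using \<open>h \<in> hom ?N ?V\<close> that by (auto simp: hom_def c)
    have h: "h (\<mu> e (\<mu> e (be w y))) = h y \<otimes>\<^bsub>?V\<^esub> h w" if "\<not> sim y p0" "\<not> sim w p0" for y w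
      using hom_mult[OF \<open>h \<in> hom ?N ?V\<close>, of y w] that by (simp add: c mult_Vminus[OF e])
    have be: "be w pinf = w" "be pinf w = w" if "\<not> sim w p0" for w
      using flip.al_0[OF that] flip.al_eq[OF U_id] by simp_all
    have "h pinf \<otimes>\<^bsub>?V\<^esub> h pinf = h pinf"
      using h[OF basis' basis'] be(1)[OF basis'] m by simp
    then have one: "h pinf = \<one>\<^bsub>?V\<^esub>"
      using hc[OF basis'] by (simp add: V.r_cancel_one')
    \<comment> \<open>Inserting \<open>w = pinf\<close>, the identity, shows that \<open>h\<close>
      is unchanged when \<open>\<mu> e\<close> is applied twice to its argument.\<close>
    have hh: "h (\<mu> e (\<mu> e y)) = h y" if "\<not> sim y p0" for y
      using h[OF that basis'] be(2)[OF that] hc[OF that] one by simp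
    show ?thesis
    proof (rule homI)
      fix y w assume yw: "y \<in> carrier ?W" "w \<in> carrier ?W"
      then have yw': "\<not> sim y p0" "\<not> sim w p0" by (simp_all add: c)
      have "y \<otimes>\<^bsub>?W\<^esub> w = be w y" using G.Gm yw' by simp
      then show "h (y \<otimes>\<^bsub>?W\<^esub> w) = h y \<otimes>\<^bsub>?V\<^esub> h w"
        using h[OF yw'] hh[OF flip.al_closed[OF yw'(2,1)]] by simp
    qed (use hc in \<open>simp add: c\<close>)
  qed
  then show ?thesis
    using P unfolding biadd_extension_def c by simp
qed

text \<open>(J4) passes from \<open>Vminus\<close> to the intrinsic opposite group, where
  \<open>\<mu>\<close>-maps are shown to be involutions. Hence applying \<open>\<mu> e\<close> twice
  is trivial, and the addition of \<open>Vminus\<close> is the intrinsic one.\<close>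

lemma moufang_groups_Vminus:
  assumes e: "unit e"
    and P: "biadd_extension (Vplus sim U p0 pinf) (Vminus sim U p0 pinf (\<mu> e)) unit \<mu> P"
  shows "moufang_groups sim U p0 pinf (Vplus sim U p0 pinf) (Vminus sim U p0 pinf (\<mu> e))"
proof -
  interpret G: moufang_groups sim U p0 pinf "Vplus sim U p0 pinf" "Vplus sim U pinf p0" by (rule moufang_groups_Vplus)
  have "\<mu> e (\<mu> e t) = t" for t
    by (rule G.mu_involution(1)[OF biadd_extension_Vplus[OF e P] e])
  then show ?thesis
    by unfold_locales (use mult_Vminus[OF e] G.Gp in \<open>auto simp: Vminus_def\<close>)
qed

end

theorem mainTheorem20:
  fixes sim :: "'a \<Rightarrow> 'a \<Rightarrow> bool" and U :: "'a \<Rightarrow> ('a \<Rightarrow> 'a) set"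
    and p0 pinf :: 'a and \<tau> :: "'a \<Rightarrow> 'a"
    and P :: "'a \<Rightarrow> 'a \<Rightarrow> 'a \<Rightarrow> 'a" and Pt :: "'a \<Rightarrow> 'a \<Rightarrow> 'a \<Rightarrow> 'a"
  assumes LM: "local_moufang_set sim U"
    and basis: "\<not> sim p0 pinf"
    and tau: "is_mu_map sim U p0 pinf \<tau>"
    and J1: "special sim U p0 pinf \<tau>"
    and J2: "\<forall>g\<in>U pinf. \<forall>h\<in>U pinf. g \<circ> h = h \<circ> g"
    and J3: "\<forall>x. unit_el sim p0 pinf x \<longrightarrow>
               unit_el sim p0 pinf (smul U p0 pinf x 2) \<and> unit_el sim p0 pinf (smul U p0 pinf x 3)"
    and J4p: "biadd_extension (Vplus sim U p0 pinf) (Vminus sim U p0 pinf \<tau>)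
                (unit_el sim p0 pinf) (mu U p0 pinf) P"
    and J4m: "biadd_extension (Vminus sim U p0 pinf \<tau>) (Vplus sim U p0 pinf)
                (unit_el sim p0 pinf) (mu U p0 pinf) Pt"
  shows "let Vp = Vplus sim U p0 pinf; Vm = Vminus sim U p0 pinf \<tau>;
             Qp = (\<lambda>x y. half Vp (P x x y)); Qm = (\<lambda>y x. half Vm (Pt y y x))
         in jordan_pair TYPE('r::comm_ring_1) Vp Vm Qp Qm
          \<and> jp_local Vp Vm Qp Qm
          \<and> non_invertibles Vp Vm Qp = cls sim p0 \<and> non_invertibles Vm Vp Qm = cls sim pinf
          \<and> jp_proper_ideal Vp Vm Qp Qm (cls sim p0) (cls sim pinf)
          \<and> jp_rad Vp Vm Qp Qm = cls sim p0 \<and> jp_rad Vm Vp Qm Qp = cls sim pinf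
          \<and> uniquely_divisible Vp 2 \<and> uniquely_divisible Vp 3"
proof -
  interpret based_moufang sim U p0 pinf
    by unfold_locales (fact LM basis)+
  obtain e where e: "unit_el sim p0 pinf e" and tau_e: "\<tau> = mu U p0 pinf e"
    using tau by (auto simp: is_mu_map_def)
  interpret special_moufang sim U p0 pinf
    by (rule special_moufangI[OF e _ J2 J3]) (use J1 tau_e in simp)
  interpret moufang_groups sim U p0 pinf "Vplus sim U p0 pinf" "Vminus sim U p0 pinf \<tau>"
    unfolding tau_e by (rule moufang_groups_Vminus[OF e J4p[unfolded tau_e]])
  interpret jordan_moufang sim U p0 pinf "Vplus sim U p0 pinf" "Vminus sim U p0 pinf \<tau>" P Pt
    by unfold_locales (fact J4p J4m)+
  have "(\<lambda>x y. half (Vplus sim U p0 pinf) (P x x y)) = Qp"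
    and "(\<lambda>y x. half (Vminus sim U p0 pinf \<tau>) (Pt y y x)) = flip.Qp"
    by (simp_all add: fun_eq_iff Qp_def flip.Qp_def)
  then show ?thesis
    unfolding Let_def
    using jordan_pair jp_local non_invertibles flip.non_invertibles jp_proper_ideal
      jp_rad flip.jp_rad uniquely_divisible by simp
qed

end
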